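(* Let $\sigma\subset N_{\mathbb R}$ be a strongly convex rational polyhedral cone with $\dim\sigma=\dim N_{\mathbb R}$, let $Q\subset\sigma$ be a rational polyhedron with $0\notin Q$, and let $Q=Q_0+Q_1+\cdots+Q_k$ be a Minkowski sum decomposition into polyhedra such that for every vertex $q$ of $Q$ the induced decomposition $q=q_0+\cdots+q_k$ ($q_i$ a vertex of $Q_i$) has at most one summand not in $N$. Let $$\tilde\sigma=\Big\langle\sigma,\ Q_0-\sum_{i=1}^ke_i,\ Q_1+e_1,\dots,Q_k+e_k\Big\rangle\subset\tilde N_{\mathbb R}.$$ Then the affine toric variety $X_\sigma$ is embedded into the affine toric variety $X_{\tilde\sigma}$ (by the morphism induced by the inclusion $\sigma\subset\tilde\sigma$) as a complete intersection given by the regular sequence $$\prod_{\langle e_i^*,v_\xi\rangle>0}x_\xi^{\langle e_i^*,v_\xi\rangle}-\prod_{\langle e_i^*,v_\xi\rangle<0}x_\xi^{-\langle e_i^*,v_\xi\rangle}=0,\qquad i=1,\dots,k,$$ in the homogeneous coordinates $x_\xi$, $\xi\in\tilde\sigma(1)$, of $X_{\tilde\sigma}$.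
   Context: $N$ is a lattice, $M=\mathrm{Hom}(N,\mathbb Z)$, $\tilde N=N\oplus\mathbb Z^k$ with standard basis $e_1,\dots,e_k$ of $\mathbb Z^k$, $\tilde M=M\oplus\mathbb Z^k$ with dual basis $e_1^*,\dots,e_k^*$. $X_\sigma=\mathrm{Spec}\,\mathbb C[\sigma^\vee\cap M]$, $X_{\tilde\sigma}=\mathrm{Spec}\,\mathbb C[\tilde\sigma^\vee\cap\tilde M]$. $\langle\cdots\rangle$ applied to sets denotes the convex cone they generate. Convention: in a Minkowski sum decomposition of an unbounded polyhedron all summands have the same recession cone as the polyhedron. $\tilde\sigma(1)$ is the set of edges of $\tilde\sigma$, $v_\xi$ the primitive lattice generator of $\xi$. Homogeneous coordinates: $S(\tilde\sigma)=\mathbb C[x_\xi\mid\xi\in\tilde\sigma(1)]$ is graded by $\mathrm{coker}(\tilde M\to\mathbb Z^{\tilde\sigma(1)},\,m\mapsto(\langle m,v_\xi\rangle)_\xi)$, and $X_{\tilde\sigma}=\mathbb C^{\tilde\sigma(1)}/G(\tilde\sigma)=\mathrm{Spec}\big(S(\tilde\sigma)^{G(\tilde\sigma)}\big)$ with quotient map $\pi:\mathbb C^{\tilde\sigma(1)}\to X_{\tilde\sigma}$, where $G(\tilde\sigma)=\{(\mu_\xi)\in(\mathbb C^* )^{\tilde\sigma(1)}\mid\prod_\xi\mu_\xi^{\langle u,v_\xi\rangle}=1\ \forall u\in\tilde M\}$. A homogeneous ideal $I\subseteq S(\tilde\sigma)$ defines the closed subvariety $\mathbf V(I)=\{p\in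 X_{\tilde\sigma}\mid\exists x\in\pi^{-1}(p): f(x)=0\ \forall f\in I\}$. A complete intersection (in homogeneous coordinates) is a subvariety $\mathbf V(I)$ where $I$ is a radical homogeneous ideal generated by a regular sequence of homogeneous polynomials $f_1,\dots,f_k$ with $k=\dim X_{\tilde\sigma}-\dim\mathbf V(I)$; it is said to be given by the equations $f_i=0$. *)

theory Defs
  imports "HOL-Analysis.Analysis" "HOL-Algebra.Ideal" "HOL-Library.Poly_Mapping"
    "HOL-Library.Extended_Nat"
begin

section \<open>Lattices, cones and polyhedra\<close>

text \<open>
  A lattice of rank \<open>d\<close> is \<open>N = \<int>\<^sup>d\<close>, i.e. the type \<^typ>\<open>int ^ 'd\<close>, sitting inside
  \<open>N\<^sub>\<real> = \<real>\<^sup>d\<close>, i.e. \<^typ>\<open>real ^ 'd\<close>, via \<open>real_vec\<close>. The dual lattice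
  \<open>M = Hom(N, \<int>)\<close> is again \<^typ>\<open>int ^ 'd\<close> through the dual basis; the pairing
  \<open>M \<times> N \<rightarrow> \<int>\<close> is then \<^const>\<open>scalar_product\<close> and the pairing \<open>M \<times> N\<^sub>\<real> \<rightarrow> \<real>\<close>
  is \<open>real_vec m \<bullet> x\<close>.
\<close>

definition real_vec :: "int ^ 'd \<Rightarrow> real ^ 'd" where
  "real_vec v = (\<chi> i. real_of_int (v $ i))"

definition lattice_points :: "(real ^ 'd) set" where
  "lattice_points = range real_vec"

definition rational_polyhedral_cone :: "(real ^ 'd) set \<Rightarrow> bool" where
  "rational_polyhedral_cone \<sigma> \<longleftrightarrow>
     (\<exists>F. finite F \<and> F \<subseteq> lattice_points \<and> \<sigma> = convex_cone hull F)"

definition strongly_convex :: "(real ^ 'd) set \<Rightarrow> bool" where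
  "strongly_convex \<sigma> \<longleftrightarrow> \<sigma> \<inter> uminus ` \<sigma> = {0}"

definition rational_polyhedron :: "(real ^ 'd) set \<Rightarrow> bool" where
  "rational_polyhedron Q \<longleftrightarrow>
     (\<exists>H. finite H \<and> (\<forall>(a, b) \<in> H. (\<forall>i. a $ i \<in> \<rat>) \<and> b \<in> \<rat>) \<and>
          Q = {x. \<forall>(a, b) \<in> H. a \<bullet> x \<le> b})"

definition recession_cone :: "(real ^ 'd) set \<Rightarrow> (real ^ 'd) set" where
  "recession_cone Q = {v. \<forall>x\<in>Q. \<forall>t\<ge>0. x + t *\<^sub>R v \<in> Q}"

definition rays :: "(real ^ 'd) set \<Rightarrow> (real ^ 'd) set set" where
  "rays \<sigma> = {\<xi>. \<xi> edge_of \<sigma>}"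

text \<open>The primitive generator of a rational ray \<open>\<xi>\<close> is the generator of the semigroup \<open>\<xi> \<inter> N\<close>.\<close>

definition ray_gen :: "(real ^ 'd) set \<Rightarrow> int ^ 'd" where
  "ray_gen \<xi> = (THE v. {w. real_vec w \<in> \<xi>} = range (\<lambda>n::nat. of_nat n *s v))"

text \<open>\<open>\<sigma>\<^sup>\<or> \<inter> M\<close>\<close>

definition dual_semigroup :: "(real ^ 'd) set \<Rightarrow> (int ^ 'd) set" where
  "dual_semigroup \<sigma> = {m. \<forall>x\<in>\<sigma>. 0 \<le> real_vec m \<bullet> x}"


section \<open>Commutative algebra\<close>

text \<open>
  The semigroup algebra \<open>\<complex>[S]\<close> of a submonoid \<open>S\<close>; the element \<^term>\<open>Poly_Mapping.single u c\<close>
  is \<open>c \<chi>\<^sup>u\<close>. Polynomial rings are the case where \<open>S\<close> consists of exponent vectors.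
\<close>

definition semigroup_algebra :: "'m::comm_monoid_add set \<Rightarrow> ('m \<Rightarrow>\<^sub>0 complex) ring" where
  "semigroup_algebra S =
     \<lparr>carrier = {f. Poly_Mapping.keys f \<subseteq> S}, mult = (*), one = 1, zero = 0, add = (+)\<rparr>"

definition complex_ring :: "complex ring" where
  "complex_ring = \<lparr>carrier = UNIV, mult = (*), one = 1, zero = 0, add = (+)\<rparr>"

definition radical_ideal :: "'a set \<Rightarrow> ('a, 'b) ring_scheme \<Rightarrow> bool" where
  "radical_ideal I R \<longleftrightarrow>
     ideal I R \<and> (\<forall>f\<in>carrier R. \<forall>n::nat. f [^]\<^bsub>R\<^esub> n \<in> I \<longrightarrow> f \<in> I)"

definition regular_sequence :: "('a, 'b) ring_scheme \<Rightarrow> 'a list \<Rightarrow> bool" where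
  "regular_sequence R fs \<longleftrightarrow>
     set fs \<subseteq> carrier R \<and>
     (\<forall>i<length fs. \<forall>g\<in>carrier R.
        g \<otimes>\<^bsub>R\<^esub> (fs ! i) \<in> genideal R (set (take i fs)) \<longrightarrow> g \<in> genideal R (set (take i fs))) \<and>
     genideal R (set fs) \<noteq> carrier R"


section \<open>Dimension of topological spaces\<close>

definition irreducible_in :: "'a topology \<Rightarrow> 'a set \<Rightarrow> bool" where
  "irreducible_in T Z \<longleftrightarrow>
     Z \<noteq> {} \<and> (\<forall>A B. closedin T A \<and> closedin T B \<and> Z \<subseteq> A \<union> B \<longrightarrow> Z \<subseteq> A \<or> Z \<subseteq> B)"

definition krull_dim :: "'a topology \<Rightarrow> enat" where
  "krull_dim T = Sup {enat l | l. \<exists>Z :: nat \<Rightarrow> 'a set.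
      (\<forall>i\<le>l. closedin T (Z i) \<and> irreducible_in T (Z i)) \<and> (\<forall>i<l. Z i \<subset> Z (Suc i))}"


section \<open>Affine toric varieties\<close>

definition coord_ring :: "(real ^ 'd) set \<Rightarrow> ((int ^ 'd) \<Rightarrow>\<^sub>0 complex) ring" where
  "coord_ring \<sigma> = semigroup_algebra (dual_semigroup \<sigma>)"

text \<open>
  The variety \<open>X\<^sub>\<sigma> = Spec \<complex>[\<sigma>\<^sup>\<or> \<inter> M]\<close>, as the set of its complex points, i.e. of the homomorphisms
  of \<open>\<complex>\<close>-algebras \<open>\<complex>[\<sigma>\<^sup>\<or> \<inter> M] \<rightarrow> \<complex>\<close>. The value of the regular function \<open>f\<close> at the point \<open>p\<close>
  is \<open>p f\<close>.
\<close>

definition toric_variety :: "(real ^ 'd) set \<Rightarrow> (((int ^ 'd) \<Rightarrow>\<^sub>0 complex) \<Rightarrow> complex) set" where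
  "toric_variety \<sigma> =
     {p \<in> extensional (carrier (coord_ring \<sigma>)).
        p \<in> ring_hom (coord_ring \<sigma>) complex_ring \<and> (\<forall>c. p (Poly_Mapping.single 0 c) = c)}"

definition zariski :: "(real ^ 'd) set \<Rightarrow> (((int ^ 'd) \<Rightarrow>\<^sub>0 complex) \<Rightarrow> complex) topology" where
  "zariski \<sigma> = topology (\<lambda>U. \<exists>F \<subseteq> carrier (coord_ring \<sigma>).
      U = toric_variety \<sigma> - {p \<in> toric_variety \<sigma>. \<forall>f\<in>F. p f = 0})"

lemma dual_semigroup_add:
  assumes "u \<in> dual_semigroup \<sigma>" "v \<in> dual_semigroup \<sigma>"
  shows "u + v \<in> dual_semigroup \<sigma>"
proof -
  have "real_vec (u + v) = real_vec u + real_vec v"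
    by (simp add: real_vec_def vec_eq_iff)
  then show ?thesis
    using assms by (simp add: dual_semigroup_def inner_add_left)
qed

lemma coord_ring_mult_closed:
  assumes "f \<in> carrier (coord_ring \<sigma>)" "g \<in> carrier (coord_ring \<sigma>)"
  shows "f * g \<in> carrier (coord_ring \<sigma>)"
  using assms keys_mult[of f g] dual_semigroup_add
  by (fastforce simp: coord_ring_def semigroup_algebra_def)

lemma toric_variety_mult:
  assumes "p \<in> toric_variety \<sigma>" "f \<in> carrier (coord_ring \<sigma>)" "g \<in> carrier (coord_ring \<sigma>)"
  shows "p (f * g) = p f * p g"
  using assms
  by (auto simp: toric_variety_def ring_hom_def complex_ring_def coord_ring_def semigroup_algebra_def)

lemma istopology_zariski:
  "istopology (\<lambda>U. \<exists>F \<subseteq> carrier (coord_ring \<sigma>).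
      U = toric_variety \<sigma> - {p \<in> toric_variety \<sigma>. \<forall>f\<in>F. p f = 0})"
proof -
  let ?A = "carrier (coord_ring \<sigma>)"
  let ?D = "\<lambda>F. toric_variety \<sigma> - {p \<in> toric_variety \<sigma>. \<forall>f\<in>F. p f = 0}"
  have Int: "\<exists>H\<subseteq>?A. ?D F \<inter> ?D G = ?D H" if "F \<subseteq> ?A" "G \<subseteq> ?A" for F G
  proof (intro exI conjI)
    let ?H = "{f * g | f g. f \<in> F \<and> g \<in> G}"
    show "?H \<subseteq> ?A" using that coord_ring_mult_closed by blast
    have m: "p (f * g) = p f * p g" if "p \<in> toric_variety \<sigma>" "f \<in> F" "g \<in> G" for p f g
      using that \<open>F \<subseteq> ?A\<close> \<open>G \<subseteq> ?A\<close> toric_variety_mult by blast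
    show "?D F \<inter> ?D G = ?D ?H"
    proof (rule Set.set_eqI)
      fix p
      show "p \<in> ?D F \<inter> ?D G \<longleftrightarrow> p \<in> ?D ?H"
      proof
        assume "p \<in> ?D F \<inter> ?D G"
        then obtain f g where "p \<in> toric_variety \<sigma>" "f \<in> F" "g \<in> G" "p f \<noteq> 0" "p g \<noteq> 0"
          by auto
        then show "p \<in> ?D ?H" using m[of p f g] by fastforce
      next
        assume "p \<in> ?D ?H"
        then obtain f g where "p \<in> toric_variety \<sigma>" "f \<in> F" "g \<in> G" "p (f * g) \<noteq> 0"
          by auto
        then show "p \<in> ?D F \<inter> ?D G" using m[of p f g] by auto
      qed
    qed
  qed
  have Un: "\<exists>H\<subseteq>?A. \<Union>\<U> = ?D H" if \<U>: "\<And>U. U \<in> \<U> \<Longrightarrow> \<exists>F\<subseteq>?A. U = ?D F" for \<U>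
  proof (intro exI conjI)
    let ?H = "\<Union>{F. F \<subseteq> ?A \<and> ?D F \<in> \<U>}"
    show "?H \<subseteq> ?A" by blast
    show "\<Union>\<U> = ?D ?H"
    proof (rule Set.set_eqI)
      fix p
      show "p \<in> \<Union>\<U> \<longleftrightarrow> p \<in> ?D ?H"
      proof
        assume "p \<in> \<Union>\<U>"
        then obtain U where U: "U \<in> \<U>" "p \<in> U" by blast
        then obtain F where "F \<subseteq> ?A" "U = ?D F" using \<U> by blast
        then show "p \<in> ?D ?H" using U by blast
      next
        assume "p \<in> ?D ?H"
        then obtain f F where "p \<in> toric_variety \<sigma>" "f \<in> F" "F \<subseteq> ?A" "?D F \<in> \<U>" "p f \<noteq> 0"
          by blast
        then show "p \<in> \<Union>\<U>" by blast
      qed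
    qed
  qed
  show ?thesis
    unfolding istopology_def
  proof (intro conjI allI impI)
    fix U V
    assume "\<exists>F\<subseteq>?A. U = ?D F" "\<exists>F\<subseteq>?A. V = ?D F"
    then obtain F G where "F \<subseteq> ?A" "G \<subseteq> ?A" "U = ?D F" "V = ?D G" by (elim exE conjE)
    then show "\<exists>F\<subseteq>?A. U \<inter> V = ?D F" by (simp only: Int)
  next
    fix \<U>
    assume "\<forall>U\<in>\<U>. \<exists>F\<subseteq>?A. U = ?D F"
    then show "\<exists>F\<subseteq>?A. \<Union>\<U> = ?D F" by (intro Un) (rule bspec)
  qed
qed

text \<open>
  A morphism of lattices \<open>\<phi>\<close> mapping one cone into another induces a toric morphism, whose
  comorphism sends \<open>\<chi>\<^sup>u\<close> to \<open>\<chi>\<^sup>L\<^sup>u\<close>, where \<open>L u = u \<circ> \<phi>\<close> is the transpose of \<open>\<phi>\<close>.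
\<close>

definition toric_comorphism ::
    "(int ^ 'd \<Rightarrow> int ^ 'n) \<Rightarrow> ((int ^ 'd) \<Rightarrow>\<^sub>0 complex) \<Rightarrow> ((int ^ 'n) \<Rightarrow>\<^sub>0 complex)" where
  "toric_comorphism L f =
     (\<Sum>u\<in>Poly_Mapping.keys f. Poly_Mapping.single (L u) (Poly_Mapping.lookup f u))"

text \<open>The map on points \<open>X\<^sub>\<sigma> \<rightarrow> X\<^sub>\<tau>\<close> with comorphism \<open>h : \<complex>[\<tau>\<^sup>\<or> \<inter> M\<^sub>\<tau>] \<rightarrow> \<complex>[\<sigma>\<^sup>\<or> \<inter> M\<^sub>\<sigma>]\<close>.\<close>

definition morphism_of ::
    "(real ^ 'd) set \<Rightarrow> (((int ^ 'd) \<Rightarrow>\<^sub>0 complex) \<Rightarrow> ((int ^ 'n) \<Rightarrow>\<^sub>0 complex)) \<Rightarrow>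
     (((int ^ 'n) \<Rightarrow>\<^sub>0 complex) \<Rightarrow> complex) \<Rightarrow> (((int ^ 'd) \<Rightarrow>\<^sub>0 complex) \<Rightarrow> complex)" where
  "morphism_of \<tau> h p = restrict (p \<circ> h) (carrier (coord_ring \<tau>))"

text \<open>
  \<open>h\<close> is the comorphism of a closed embedding \<open>X\<^sub>\<sigma> \<rightarrow> X\<^sub>\<tau>\<close>, i.e. a surjective homomorphism of
  \<open>\<complex>\<close>-algebras.
\<close>

definition closed_embedding ::
    "(real ^ 'n) set \<Rightarrow> (real ^ 'd) set \<Rightarrow>
     (((int ^ 'd) \<Rightarrow>\<^sub>0 complex) \<Rightarrow> ((int ^ 'n) \<Rightarrow>\<^sub>0 complex)) \<Rightarrow> bool" where
  "closed_embedding \<sigma> \<tau> h \<longleftrightarrow>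
     h \<in> ring_hom (coord_ring \<tau>) (coord_ring \<sigma>) \<and>
     (\<forall>c. h (Poly_Mapping.single 0 c) = Poly_Mapping.single 0 c) \<and>
     h ` carrier (coord_ring \<tau>) = carrier (coord_ring \<sigma>)"


section \<open>Homogeneous coordinates\<close>

text \<open>The polynomial ring \<open>S(\<sigma>) = \<complex>[x\<^sub>\<xi> | \<xi> \<in> \<sigma>(1)]\<close>.\<close>

type_synonym 'd cox_poly = "((real ^ 'd) set \<Rightarrow>\<^sub>0 nat) \<Rightarrow>\<^sub>0 complex"

definition cox_ring :: "(real ^ 'd) set \<Rightarrow> ('d cox_poly) ring" where
  "cox_ring \<sigma> = semigroup_algebra {a. Poly_Mapping.keys a \<subseteq> rays \<sigma>}"

definition cox_var :: "(real ^ 'd) set \<Rightarrow> 'd cox_poly" where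
  "cox_var \<xi> = Poly_Mapping.single (Poly_Mapping.single \<xi> 1) 1"

definition cox_space :: "(real ^ 'd) set \<Rightarrow> ((real ^ 'd) set \<Rightarrow> complex) set" where
  "cox_space \<sigma> = rays \<sigma> \<rightarrow>\<^sub>E UNIV"

definition cox_eval :: "((real ^ 'd) set \<Rightarrow> complex) \<Rightarrow> 'd cox_poly \<Rightarrow> complex" where
  "cox_eval x f = (\<Sum>a\<in>Poly_Mapping.keys f.
     Poly_Mapping.lookup f a * (\<Prod>\<xi>\<in>Poly_Mapping.keys a. x \<xi> ^ Poly_Mapping.lookup a \<xi>))"

text \<open>
  The degree of the monomial \<open>x\<^sup>a\<close>: the class of \<open>a\<close> in the cokernel of
  \<open>M \<rightarrow> \<int>\<^bsup>\<sigma>(1)\<^esup>, m \<mapsto> (\<langle>m, v\<^sub>\<xi>\<rangle>)\<^sub>\<xi>\<close>, as a coset of the image.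
\<close>

definition cox_degree ::
    "(real ^ 'd) set \<Rightarrow> ((real ^ 'd) set \<Rightarrow>\<^sub>0 nat) \<Rightarrow> ((real ^ 'd) set \<Rightarrow> int) set" where
  "cox_degree \<sigma> a = {b \<in> rays \<sigma> \<rightarrow>\<^sub>E UNIV. \<exists>m :: int ^ 'd. \<forall>\<xi>\<in>rays \<sigma>.
     b \<xi> = int (Poly_Mapping.lookup a \<xi>) + scalar_product m (ray_gen \<xi>)}"

definition cox_homogeneous :: "(real ^ 'd) set \<Rightarrow> 'd cox_poly \<Rightarrow> bool" where
  "cox_homogeneous \<sigma> f \<longleftrightarrow> (\<exists>\<gamma>. \<forall>a\<in>Poly_Mapping.keys f. cox_degree \<sigma> a = \<gamma>)"

definition homogeneous_component ::
    "(real ^ 'd) set \<Rightarrow> ((real ^ 'd) set \<Rightarrow> int) set \<Rightarrow> 'd cox_poly \<Rightarrow> 'd cox_poly" where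
  "homogeneous_component \<sigma> \<gamma> f =
     (\<Sum>a\<in>{a \<in> Poly_Mapping.keys f. cox_degree \<sigma> a = \<gamma>}.
        Poly_Mapping.single a (Poly_Mapping.lookup f a))"

definition homogeneous_ideal :: "(real ^ 'd) set \<Rightarrow> 'd cox_poly set \<Rightarrow> bool" where
  "homogeneous_ideal \<sigma> I \<longleftrightarrow>
     ideal I (cox_ring \<sigma>) \<and> (\<forall>f\<in>I. \<forall>\<gamma>. homogeneous_component \<sigma> \<gamma> f \<in> I)"

text \<open>
  The quotient map \<open>\<pi> : \<complex>\<^bsup>\<sigma>(1)\<^esup> \<rightarrow> X\<^sub>\<sigma>\<close> by \<open>G(\<sigma>)\<close>. Its comorphism is the isomorphism of
  \<open>\<complex>[\<sigma>\<^sup>\<or> \<inter> M]\<close> onto the invariants \<open>S(\<sigma>)\<^bsup>G(\<sigma>)\<^esup>\<close> that maps \<open>\<chi>\<^sup>u\<close> to \<open>\<Prod>\<^sub>\<xi> x\<^sub>\<xi>\<^bsup>\<langle>u, v\<^sub>\<xi>\<rangle>\<^esup>\<close>; the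
  exponents are nonnegative since \<open>u \<in> \<sigma>\<^sup>\<or>\<close>.
\<close>

definition cox_quotient ::
    "(real ^ 'd) set \<Rightarrow> ((real ^ 'd) set \<Rightarrow> complex) \<Rightarrow> (((int ^ 'd) \<Rightarrow>\<^sub>0 complex) \<Rightarrow> complex)" where
  "cox_quotient \<sigma> x = restrict
     (\<lambda>f. \<Sum>u\<in>Poly_Mapping.keys f.
        Poly_Mapping.lookup f u * (\<Prod>\<xi>\<in>rays \<sigma>. x \<xi> ^ nat (scalar_product u (ray_gen \<xi>))))
     (carrier (coord_ring \<sigma>))"

definition vanishing_locus ::
    "(real ^ 'd) set \<Rightarrow> 'd cox_poly set \<Rightarrow> (((int ^ 'd) \<Rightarrow>\<^sub>0 complex) \<Rightarrow> complex) set" where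
  "vanishing_locus \<sigma> I =
     {p \<in> toric_variety \<sigma>. \<exists>x\<in>cox_space \<sigma>. cox_quotient \<sigma> x = p \<and> (\<forall>f\<in>I. cox_eval x f = 0)}"

text \<open>
  \<open>Y \<subseteq> X\<^sub>\<sigma>\<close> is the complete intersection in homogeneous coordinates given by the equations
  \<open>f = 0\<close> for \<open>f\<close> in the list \<open>fs\<close>. The codimension condition is stated additively, which also
  forces both dimensions to be finite.
\<close>

definition complete_intersection ::
    "(real ^ 'd) set \<Rightarrow> (((int ^ 'd) \<Rightarrow>\<^sub>0 complex) \<Rightarrow> complex) set \<Rightarrow> 'd cox_poly list \<Rightarrow> bool" where
  "complete_intersection \<sigma> Y fs \<longleftrightarrow>
     (let I = genideal (cox_ring \<sigma>) (set fs) in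
        (\<forall>f\<in>set fs. cox_homogeneous \<sigma> f) \<and>
        regular_sequence (cox_ring \<sigma>) fs \<and>
        radical_ideal I (cox_ring \<sigma>) \<and>
        homogeneous_ideal \<sigma> I \<and>
        Y = vanishing_locus \<sigma> I \<and>
        (\<exists>d::nat. krull_dim (subtopology (zariski \<sigma>) Y) = enat d \<and>
                  krull_dim (zariski \<sigma>) = enat (d + length fs)))"


section \<open>The cone of a Minkowski sum decomposition\<close>

text \<open>
  \<open>N \<oplus> \<int>\<^sup>k\<close> is the lattice with coordinates indexed by \<^typ>\<open>'n + 'k\<close>; a decomposition
  \<open>Q = Q\<^sub>0 + Q\<^sub>1 + \<dots> + Q\<^sub>k\<close> is a family \<open>P\<close> indexed by \<^typ>\<open>'k option\<close>, with \<open>P None\<close> for \<open>Q\<^sub>0\<close>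
  and \<open>P (Some i)\<close> for \<open>Q\<^sub>i\<close>.
\<close>

definition vec_append :: "'a ^ 'n \<Rightarrow> 'a ^ 'k \<Rightarrow> 'a ^ ('n + 'k)" where
  "vec_append x a = (\<chi> s. case s of Inl i \<Rightarrow> x $ i | Inr j \<Rightarrow> a $ j)"

definition cayley_cone ::
    "(real ^ 'n) set \<Rightarrow> ('k::finite option \<Rightarrow> (real ^ 'n) set) \<Rightarrow> (real ^ ('n + 'k)) set" where
  "cayley_cone \<sigma> P = convex_cone hull
     ((\<lambda>x. vec_append x 0) ` \<sigma> \<union>
      (\<lambda>q. vec_append q (- (\<Sum>i\<in>UNIV. axis i 1))) ` P None \<union>
      (\<Union>i. (\<lambda>q. vec_append q (axis i 1)) ` P (Some i)))"

text \<open>The restriction \<open>M \<oplus> \<int>\<^sup>k \<rightarrow> M\<close>, transpose to the inclusion \<open>v \<mapsto> vec_append v 0\<close>.\<close>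

definition restrict_dual :: "int ^ ('n::finite + 'k::finite) \<Rightarrow> int ^ 'n" where
  "restrict_dual u = (\<chi> i. u $ Inl i)"

lemma scalar_product_restrict_dual:
  "scalar_product (restrict_dual u) v = scalar_product u (vec_append v 0)"
proof -
  have "scalar_product u (vec_append v 0) = (\<Sum>s\<in>UNIV <+> UNIV. u $ s * vec_append v 0 $ s)"
    by (simp add: scalar_product_def)
  also have "\<dots> = scalar_product (restrict_dual u) v"
    by (subst sum.Plus) (simp_all add: scalar_product_def restrict_dual_def vec_append_def)
  finally show ?thesis ..
qed

definition dual_basis :: "'k::finite \<Rightarrow> int ^ ('n::finite + 'k)" where
  "dual_basis i = vec_append 0 (axis i 1)"

definition cox_binomial :: "(real ^ ('n::finite + 'k::finite)) set \<Rightarrow> 'k \<Rightarrow> ('n + 'k) cox_poly" where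
  "cox_binomial \<tau> i =
     (let a = (\<lambda>\<xi>. scalar_product (dual_basis i) (ray_gen \<xi>)) in
        (\<Prod>\<xi>\<in>{\<xi> \<in> rays \<tau>. a \<xi> > 0}. cox_var \<xi> ^ nat (a \<xi>)) -
        (\<Prod>\<xi>\<in>{\<xi> \<in> rays \<tau>. a \<xi> < 0}. cox_var \<xi> ^ nat (- a \<xi>)))"

end

theory Submission
  imports Defs "HOL-Complex_Analysis.Conformal_Mappings"
begin

text \<open>
  A linear functional \<open>m \<in> \<sigma>\<^sup>\<or>\<close> attains its minimum over \<open>Q\<close> at a vertex \<open>q = q\<^sub>0 + \<dots> + q\<^sub>k\<close>, and then
  \<open>m\<close> is minimal over \<open>Q\<^sub>j\<close> at \<open>q\<^sub>j\<close>. Rounding the values \<open>m \<bullet> q\<^sub>j\<close> gives a lift of \<open>m\<close> to the dual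
  of the big cone, so the comorphism is surjective.

  The rays of the big cone outside \<open>\<sigma>\<close> fall into \<open>k + 1\<close> nonempty blocks, according to the \<open>Q\<^sub>j\<close> from
  which they come, and the equations read \<open>y\<^sub>i = y\<^sub>0\<close> with monomials \<open>y\<^sub>0, \<dots>, y\<^sub>k\<close> in disjoint sets of
  variables. Reducing modulo the equations to monomials not divisible by \<open>y\<^sub>1, \<dots>, y\<^sub>k\<close>, and
  separating these by points of the torus, one sees that the ideal consists of all polynomials
  vanishing on the part of the torus where \<open>y\<^sub>0 = \<dots> = y\<^sub>k\<close>. Hence it is radical, and the sequence is
  regular since the value of \<open>y\<^sub>i\<close> can be perturbed independently.

  The Krull dimension of an affine toric variety is bounded above by counting monomials: functions
  \<open>b\<^sub>i\<close> separating the members of a chain of irreducible closed sets have linearly independent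
  monomials. Closures of subtori attain the bound.
\<close>

section \<open>Semigroup algebras and ideals of binomials in disjoint variables\<close>

text \<open>Two obstacles shape the argument. The exponents of a block may have a common divisor, so
  the part of the torus where all y_i agree can be disconnected; its positive real points do not
  separate the reduced monomials, and roots of unity are needed besides. Moreover, a point belongs
  to the zero locus if some point of its fibre in Cox space solves the equations, and off the torus
  coordinates vanish. A point of X_\<sigma> is a monoid homomorphism; where it is nonzero it gives a
  character of a subgroup of a free abelian group, which extends to the remaining coordinates
  because the nonzero complex numbers form a divisible group. Conversely, at a solution of the
  equations the value of a character depends only on its restriction to N: if the y_j are nonzero,
  quotients y_i / y_0 are 1; if all are 0, positivity on the generators takes over. The lattice
  hypothesis on vertices enters twice: it limits the loss by rounding, and it makes all parts q_j
  rational, the exceptional one being the rational vertex q minus lattice points, so that the big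
  cone is rational.\<close>

abbreviation "keys \<equiv> Poly_Mapping.keys"
abbreviation "lookup \<equiv> Poly_Mapping.lookup"
abbreviation "single \<equiv> Poly_Mapping.single"

text \<open>Evaluation of polynomials, comorphisms of toric morphisms and complex points of toric
  varieties are all written in this form, so that additivity and multiplicativity are proved
  once.\<close>

definition lin_sum :: "('a \<Rightarrow> 'b::zero \<Rightarrow> 'c::comm_monoid_add) \<Rightarrow> ('a \<Rightarrow>\<^sub>0 'b) \<Rightarrow> 'c" where
  "lin_sum \<phi> f = (\<Sum>a\<in>keys f. \<phi> a (lookup f a))"

lemma lin_sum_superset:
  fixes \<phi> :: "'a \<Rightarrow> 'b::ab_group_add \<Rightarrow> 'c::ab_group_add"
  assumes "\<And>a. Modules.additive (\<phi> a)" "finite A" "keys f \<subseteq> A"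
  shows "lin_sum \<phi> f = (\<Sum>a\<in>A. \<phi> a (lookup f a))"
  unfolding lin_sum_def using assms
  by (intro sum.mono_neutral_left) (auto simp: in_keys_iff additive.zero)

lemma lin_sum_single:
  fixes \<phi> :: "'a \<Rightarrow> 'b::ab_group_add \<Rightarrow> 'c::ab_group_add"
  assumes "\<And>a. Modules.additive (\<phi> a)"
  shows "lin_sum \<phi> (single a c) = \<phi> a c"
  by (subst lin_sum_superset[of _ "{a}"]) (use assms in auto)

lemma additive_lin_sum:
  fixes \<phi> :: "'a \<Rightarrow> 'b::ab_group_add \<Rightarrow> 'c::ab_group_add"
  assumes "\<And>a. Modules.additive (\<phi> a)"
  shows "Modules.additive (lin_sum \<phi>)"
proof
  fix f g :: "'a \<Rightarrow>\<^sub>0 'b"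
  let ?A = "keys f \<union> keys g"
  have "lin_sum \<phi> (f + g) = (\<Sum>a\<in>?A. \<phi> a (lookup (f + g) a))"
    by (rule lin_sum_superset) (use assms keys_add[of f g] in auto)
  also have "\<dots> = (\<Sum>a\<in>?A. \<phi> a (lookup f a)) + (\<Sum>a\<in>?A. \<phi> a (lookup g a))"
    by (simp add: lookup_add additive.add[OF assms] sum.distrib)
  also have "\<dots> = lin_sum \<phi> f + lin_sum \<phi> g"
    using lin_sum_superset[OF assms, of ?A] by simp
  finally show "lin_sum \<phi> (f + g) = lin_sum \<phi> f + lin_sum \<phi> g" .
qed

lemma poly_mapping_expansion:
  "f = (\<Sum>a\<in>keys f. single a (lookup f a))"
  by (rule poly_mapping_eqI) (simp add: lookup_sum lookup_single when_def in_keys_iff)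

text \<open>Multiplicativity of \<open>\<phi>\<close> is demanded on \<open>S\<close> only: a
  complex point of a toric variety comes from a function that is multiplicative on the dual
  semigroup and arbitrary elsewhere.\<close>

lemma lin_sum_mult:
  fixes \<phi> :: "'a::comm_monoid_add \<Rightarrow> 'b::comm_ring_1 \<Rightarrow> 'c::comm_ring_1"
  assumes \<phi>: "\<And>a. Modules.additive (\<phi> a)"
    and mult: "\<And>a b c d. a \<in> S \<Longrightarrow> b \<in> S \<Longrightarrow> \<phi> (a + b) (c * d) = \<phi> a c * \<phi> b d"
    and f: "keys f \<subseteq> S" and g: "keys g \<subseteq> S"
  shows "lin_sum \<phi> (f * g) = lin_sum \<phi> f * lin_sum \<phi> g"
proof -
  interpret additive "lin_sum \<phi>" by (rule additive_lin_sum) (rule \<phi>)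
  let ?s = "\<lambda>f a. single a (lookup f a)"
  have "f * g = (\<Sum>a\<in>keys f. \<Sum>b\<in>keys g. ?s f a * ?s g b)"
    by (subst poly_mapping_expansion[of f], subst poly_mapping_expansion[of g])
      (simp add: sum_product)
  also have "lin_sum \<phi> \<dots> = (\<Sum>a\<in>keys f. \<Sum>b\<in>keys g.
      \<phi> a (lookup f a) * \<phi> b (lookup g b))"
    unfolding sum mult_single using f g
    by (intro sum.cong refl) (simp add: lin_sum_single[OF \<phi>] mult subset_iff)
  finally show ?thesis
    by (simp add: lin_sum_def sum_product)
qed

section \<open>Semigroup algebras as commutative rings\<close>

lemma semigroup_algebra_simps [simp]:
  "carrier (semigroup_algebra S) = {f. keys f \<subseteq> S}"
  "f \<otimes>\<^bsub>semigroup_algebra S\<^esub> g = f * g" "f \<oplus>\<^bsub>semigroup_algebra S\<^esub> g = f + g"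
  "\<one>\<^bsub>semigroup_algebra S\<^esub> = 1" "\<zero>\<^bsub>semigroup_algebra S\<^esub> = 0"
  by (simp_all add: semigroup_algebra_def)

lemma nat_pow_semigroup_algebra [simp]: "f [^]\<^bsub>semigroup_algebra S\<^esub> (n::nat) = f ^ n"
  by (induction n) (simp_all add: nat_pow_def mult.commute)

lemma keys_mult_closed:
  assumes "\<And>a b. a \<in> S \<Longrightarrow> b \<in> S \<Longrightarrow> a + b \<in> S"
    and "keys f \<subseteq> S" "keys g \<subseteq> S"
  shows "keys (f * g) \<subseteq> S"
  using keys_mult[of f g] assms by blast

lemma cring_semigroup_algebra:
  assumes "0 \<in> S" "\<And>a b. a \<in> S \<Longrightarrow> b \<in> S \<Longrightarrow> a + b \<in> S"
  shows "cring (semigroup_algebra S)"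
proof (rule cringI)
  show "abelian_group (semigroup_algebra S)"
  proof (rule abelian_groupI; simp)
    show "keys (x + y) \<subseteq> S"
      if "keys x \<subseteq> S" "keys y \<subseteq> S" for x y :: "'a \<Rightarrow>\<^sub>0 complex"
      using that keys_add[of x y] by auto
    show "\<exists>y. keys y \<subseteq> S \<and> y + x = 0" if "keys x \<subseteq> S" for x :: "'a \<Rightarrow>\<^sub>0 complex"
      using that by (intro exI[of _ "-x"]) (auto simp: in_keys_iff)
  qed
  show "comm_monoid (semigroup_algebra S)"
    by (rule comm_monoidI) (use assms in \<open>simp_all add: keys_mult_closed mult_ac\<close>)
qed (simp_all add: algebra_simps)

text \<open>Additive inverses are multiples by the constant \<open>- 1\<close>, which lies in the
  algebra because \<open>0 \<in> S\<close>.\<close>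

lemma ideal_semigroup_algebraI:
  assumes "cring (semigroup_algebra S)" "I \<subseteq> carrier (semigroup_algebra S)" "0 \<in> I" "0 \<in> S"
    and add: "\<And>f g. f \<in> I \<Longrightarrow> g \<in> I \<Longrightarrow> f + g \<in> I"
    and mult: "\<And>f g. f \<in> I \<Longrightarrow> keys g \<subseteq> S \<Longrightarrow> g * f \<in> I"
  shows "ideal I (semigroup_algebra S)"
proof -
  interpret cring "semigroup_algebra S" by fact
  show ?thesis
  proof (rule idealI[OF ring_axioms subgroup.intro])
    fix f assume f: "f \<in> I"
    have "- 1 * f \<in> I" using mult[OF f, of "- 1"] \<open>0 \<in> S\<close> by (auto simp: in_keys_iff lookup_one when_def)
    moreover have "\<ominus>\<^bsub>semigroup_algebra S\<^esub> f = - 1 * f"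
      using f \<open>- 1 * f \<in> I\<close> assms(2) by (intro minus_equality) auto
    ultimately show "inv\<^bsub>add_monoid (semigroup_algebra S)\<^esub> f \<in> I"
      by (metis a_inv_def)
  qed (use assms(2,3) add mult in \<open>auto simp: mult.commute\<close>)
qed

text \<open>Artin's proof of the independence of characters: subtracting \<open>e b s\<close> times
  the relation at \<open>t\<close> from the relation at \<open>m s t\<close> eliminates
  \<open>b\<close> and scales the other coefficients by \<open>e a s - e b s\<close>, which is
  nonzero for a suitable \<open>s\<close>.\<close>

lemma multiplicative_functions_independent:
  fixes c :: "'a \<Rightarrow> 'c::idom" and e :: "'a \<Rightarrow> 't \<Rightarrow> 'c"
  assumes "finite K"
    and T: "\<And>s t. s \<in> T \<Longrightarrow> t \<in> T \<Longrightarrow> m s t \<in> T"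
    and e: "\<And>a s t. a \<in> K \<Longrightarrow> s \<in> T \<Longrightarrow> t \<in> T \<Longrightarrow> e a (m s t) = e a s * e a t"
    and nz: "\<And>a. a \<in> K \<Longrightarrow> \<exists>t\<in>T. e a t \<noteq> 0"
    and sep: "\<And>a b. a \<in> K \<Longrightarrow> b \<in> K \<Longrightarrow> a \<noteq> b \<Longrightarrow> \<exists>t\<in>T. e a t \<noteq> e b t"
    and "\<And>t. t \<in> T \<Longrightarrow> (\<Sum>a\<in>K. c a * e a t) = 0" and "a \<in> K"
  shows "c a = 0"
  using assms(1) e nz sep assms(6,7)
proof (induction K arbitrary: c a rule: finite_induct)
  case (insert b K)
  have c0: "c a0 = 0" if a0: "a0 \<in> K" for a0
  proof -
    have "a0 \<noteq> b" using a0 insert.hyps by blast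
    then obtain s where s: "s \<in> T" "e a0 s \<noteq> e b s"
      using insert.prems(3)[of a0 b] a0 by blast
    have "(\<Sum>a\<in>K. c a * (e a s - e b s) * e a t) = 0" if t: "t \<in> T" for t
    proof -
      have "(\<Sum>a\<in>insert b K. c a * e a (m s t)) = 0"
        using insert.prems(4) T s t by blast
      then have "c b * (e b s * e b t) + (\<Sum>a\<in>K. c a * (e a s * e a t)) = 0"
        using insert.hyps insert.prems(1) s t by (simp cong: sum.cong)
      moreover have "e b s * (c b * e b t + (\<Sum>a\<in>K. c a * e a t)) = 0"
        using insert.prems(4)[OF t] insert.hyps by simp
      moreover have "(\<Sum>a\<in>K. c a * (e a s - e b s) * e a t) =
          (c b * (e b s * e b t) + (\<Sum>a\<in>K. c a * (e a s * e a t))) -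
          e b s * (c b * e b t + (\<Sum>a\<in>K. c a * e a t))"
        by (simp add: algebra_simps sum_subtractf sum_distrib_left)
      ultimately show ?thesis by simp
    qed
    then have "c a0 * (e a0 s - e b s) = 0"
      using insert.prems(1-3) a0 by (intro insert.IH[of "\<lambda>a. c a * (e a s - e b s)" a0]) simp_all
    then show ?thesis using s by simp
  qed
  show ?case
  proof (cases "a = b")
    case True
    obtain t where t: "t \<in> T" "e b t \<noteq> 0" using insert.prems(2) by blast
    have "(\<Sum>a\<in>K. c a * e a t) = 0" by (rule sum.neutral) (simp add: c0)
    then have "c b * e b t = 0" using insert.prems(4)[OF t(1)] insert.hyps by simp
    then show ?thesis using t True by simp
  next
    case False
    then show ?thesis using insert.prems(5) c0 by simp
  qed
qed simp

text \<open>Isolates the commutative algebra from the geometry: \<open>R\<close> will be the rays of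
  the big cone, \<open>D j\<close> the exponent vector of y_j and \<open>o\<^sub>0\<close> the index
  of Q_0. Radicality and regularity rest only on the finiteness of \<open>R\<close> and on nonempty,
  pairwise disjoint supports.\<close>

locale block_binomials =
  fixes R :: "'v set" and o\<^sub>0 :: "'j::finite" and D :: "'j \<Rightarrow> 'v \<Rightarrow>\<^sub>0 nat"
  assumes finite_R: "finite R"
    and keys_D: "keys (D j) \<subseteq> R" "keys (D j) \<noteq> {}"
    and disjoint_D: "i \<noteq> j \<Longrightarrow> keys (D i) \<inter> keys (D j) = {}"
begin

lemma lookup_D_other: "\<xi> \<in> keys (D j) \<Longrightarrow> i \<noteq> j \<Longrightarrow> lookup (D i) \<xi> = 0"
  by (meson disjoint_D disjoint_iff not_in_keys_iff_lookup_eq_zero)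

abbreviation "A \<equiv> semigroup_algebra {a::'v \<Rightarrow>\<^sub>0 nat. keys a \<subseteq> R}"

definition mon :: "('v \<Rightarrow> complex) \<Rightarrow> ('v \<Rightarrow>\<^sub>0 nat) \<Rightarrow> complex" where
  "mon \<tau> a = (\<Prod>\<xi>\<in>R. \<tau> \<xi> ^ lookup a \<xi>)"

definition ev :: "('v \<Rightarrow> complex) \<Rightarrow> (('v \<Rightarrow>\<^sub>0 nat) \<Rightarrow>\<^sub>0 complex) \<Rightarrow> complex" where
  "ev \<tau> = lin_sum (\<lambda>a c. c * mon \<tau> a)"

definition bin :: "'j \<Rightarrow> ('v \<Rightarrow>\<^sub>0 nat) \<Rightarrow>\<^sub>0 complex" where
  "bin i = single (D i) 1 - single (D o\<^sub>0) 1"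

definition torus :: "'j set \<Rightarrow> ('v \<Rightarrow> complex) set" where
  "torus J = {\<tau>. (\<forall>\<xi>. \<tau> \<xi> \<noteq> 0) \<and> (\<forall>i\<in>J. mon \<tau> (D i) = mon \<tau> (D o\<^sub>0))}"

definition reduction :: "'j set \<Rightarrow> (('v \<Rightarrow>\<^sub>0 nat) \<times> ('v \<Rightarrow>\<^sub>0 nat)) set" where
  "reduction J = {(b + D i, b + D o\<^sub>0) | b i. i \<in> J \<and> keys b \<subseteq> R}"

definition normal :: "'j set \<Rightarrow> ('v \<Rightarrow>\<^sub>0 nat) \<Rightarrow> bool" where
  "normal J a \<longleftrightarrow> (\<forall>i\<in>J. \<exists>\<xi>. lookup a \<xi> < lookup (D i) \<xi>)"

text \<open>A choice suffices and confluence is not proved: it only matters that a normal monomial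
  is reached and that it has the same class modulo the ideal.\<close>

definition nf :: "'j set \<Rightarrow> ('v \<Rightarrow>\<^sub>0 nat) \<Rightarrow> ('v \<Rightarrow>\<^sub>0 nat)" where
  "nf J a = (SOME b. normal J b \<and> (a, b) \<in> (reduction J)\<^sup>*)"

section \<open>Evaluation and the ideal of the binomials\<close>

lemma keys_add_nat: "keys (a + b :: 'v \<Rightarrow>\<^sub>0 nat) = keys a \<union> keys b"
  by (auto simp: in_keys_iff lookup_add)

lemma cring_A: "cring A"
  by (rule cring_semigroup_algebra) (auto simp: keys_add_nat)

sublocale cring A by (rule cring_A)

lemma mon_add: "mon \<tau> (a + b) = mon \<tau> a * mon \<tau> b"
  by (simp add: mon_def lookup_add power_add prod.distrib)

lemma mon_0 [simp]: "mon \<tau> 0 = 1"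
  by (simp add: mon_def)

lemma mon_times: "mon (\<lambda>\<xi>. \<tau> \<xi> * \<psi> \<xi>) a = mon \<tau> a * mon \<psi> a"
  by (simp add: mon_def power_mult_distrib prod.distrib)

lemma additive_mon: "Modules.additive (\<lambda>c. c * mon \<tau> a)"
  by standard (simp add: algebra_simps)

lemma ev_single: "ev \<tau> (single a c) = c * mon \<tau> a"
  by (simp add: ev_def lin_sum_single[OF additive_mon])

sublocale ev: additive "ev \<tau>" for \<tau>
  unfolding ev_def by (rule additive_lin_sum) (rule additive_mon)

lemma ev_mult: "ev \<tau> (f * g) = ev \<tau> f * ev \<tau> g"
  unfolding ev_def by (rule lin_sum_mult[where S = UNIV]) (simp_all add: additive_mon mon_add)

lemma ev_1 [simp]: "ev \<tau> 1 = 1"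
  using ev_single[of \<tau> 0 1] by simp

lemma ev_power: "ev \<tau> (f ^ n) = ev \<tau> f ^ n"
  by (induction n) (simp_all add: ev_mult)

lemma ev_bin: "ev \<tau> (bin i) = mon \<tau> (D i) - mon \<tau> (D o\<^sub>0)"
  by (simp add: bin_def ev.diff ev_single)

lemma ideal_ev_zero: "ideal {f \<in> carrier A. \<forall>\<tau>\<in>T. ev \<tau> f = 0} A"
proof (rule ideal_semigroup_algebraI[OF cring_A])
  show "f + g \<in> {f \<in> carrier A. \<forall>\<tau>\<in>T. ev \<tau> f = 0}"
    if "f \<in> {f \<in> carrier A. \<forall>\<tau>\<in>T. ev \<tau> f = 0}" "g \<in> {f \<in> carrier A. \<forall>\<tau>\<in>T. ev \<tau> f = 0}" for f g
    using that a_closed[of f g] by (simp add: ev.add)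
  show "g * f \<in> {f \<in> carrier A. \<forall>\<tau>\<in>T. ev \<tau> f = 0}"
    if "f \<in> {f \<in> carrier A. \<forall>\<tau>\<in>T. ev \<tau> f = 0}" "keys g \<subseteq> {a. keys a \<subseteq> R}" for f g
    using that m_closed[of g f] by (simp add: ev_mult)
qed (auto simp: ev.zero)

lemma bin_carrier: "bin i \<in> carrier A"
proof -
  have "keys (bin i) \<subseteq> {D i, D o\<^sub>0}"
    using keys_diff[of "single (D i) (1::complex)" "single (D o\<^sub>0) 1"]
    by (auto simp: bin_def)
  then show ?thesis using keys_D(1) by auto
qed

lemma genideal_bin: "ideal (genideal A (bin ` J)) A"
  using bin_carrier by (intro genideal_ideal) auto

lemma genideal_ev:
  assumes "f \<in> genideal A (bin ` J)" "\<forall>i\<in>J. mon \<tau> (D i) = mon \<tau> (D o\<^sub>0)"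
  shows "ev \<tau> f = 0"
proof -
  have "genideal A (bin ` J) \<subseteq> {f \<in> carrier A. \<forall>\<tau>\<in>{\<tau>}. ev \<tau> f = 0}"
    using bin_carrier assms(2) by (intro genideal_minimal ideal_ev_zero) (auto simp: ev_bin)
  then show ?thesis using assms(1) by blast
qed

text \<open>The total degree in the variables of the blocks in \<open>J\<close> drops at each step:
  a factor \<open>D i\<close> is removed, and the new factor \<open>D o\<^sub>0\<close> contributes
  nothing since \<open>o\<^sub>0 \<notin> J\<close>.\<close>

lemma ex_nf:
  assumes "o\<^sub>0 \<notin> J" "keys a \<subseteq> R"
  shows "\<exists>b. normal J b \<and> (a, b) \<in> (reduction J)\<^sup>*"
  using assms(2)
proof (induction a rule: measure_induct_rule[where
    f = "\<lambda>a. \<Sum>i\<in>J. \<Sum>\<xi>\<in>keys (D i). lookup a \<xi>"])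
  case (less a)
  show ?case
  proof (cases "normal J a")
    case False
    then obtain i where i: "i \<in> J" "\<And>\<xi>. lookup (D i) \<xi> \<le> lookup a \<xi>"
      by (auto simp: normal_def not_less)
    define b where "b = a - D i"
    have a: "a = b + D i"
      by (rule poly_mapping_eqI) (simp add: b_def lookup_add lookup_minus i)
    have b: "keys b \<subseteq> R" using less.prems by (auto simp: a keys_add_nat)
    have step: "(a, b + D o\<^sub>0) \<in> reduction J"
      using i(1) b by (auto simp: a reduction_def)
    have D0: "lookup (D o\<^sub>0) \<xi> = 0" if "\<xi> \<in> keys (D l)" "l \<in> J" for \<xi> l
    proof -
      have "l \<noteq> o\<^sub>0" using that assms(1) by blast
      then show ?thesis using disjoint_D[of l o\<^sub>0] that by (auto simp: in_keys_iff)
    qed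
    have 1: "(\<Sum>i\<in>J. \<Sum>\<xi>\<in>keys (D i). lookup (b + D o\<^sub>0) \<xi>) =
      (\<Sum>i\<in>J. \<Sum>\<xi>\<in>keys (D i). lookup b \<xi>)"
      by (intro sum.cong refl) (simp add: lookup_add D0)
    obtain \<eta> where \<eta>: "\<eta> \<in> keys (D i)" using keys_D(2) by blast
    have "(\<Sum>\<xi>\<in>keys (D i). lookup b \<xi>) < (\<Sum>\<xi>\<in>keys (D i). lookup a \<xi>)"
      using \<eta> by (intro sum_strict_mono_ex1) (auto simp: a lookup_add in_keys_iff)
    then have 2: "(\<Sum>i\<in>J. \<Sum>\<xi>\<in>keys (D i). lookup b \<xi>) <
      (\<Sum>i\<in>J. \<Sum>\<xi>\<in>keys (D i). lookup a \<xi>)"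
      using i(1) by (intro sum_strict_mono_ex1) (auto simp: a lookup_add intro!: sum_mono)
    have "keys (b + D o\<^sub>0) \<subseteq> R" using b keys_D(1) by (auto simp: keys_add_nat)
    with 1 2 obtain c where "normal J c" "(b + D o\<^sub>0, c) \<in> (reduction J)\<^sup>*"
      using less.IH[of "b + D o\<^sub>0"] by auto
    then show ?thesis
      by (intro exI[of _ c] conjI converse_rtrancl_into_rtrancl[OF step])
  next
    case True
    then show ?thesis by (intro exI[of _ a] conjI rtrancl_refl)
  qed
qed

lemma nf:
  assumes "keys a \<subseteq> R" "o\<^sub>0 \<notin> J"
  shows "normal J (nf J a)" "(a, nf J a) \<in> (reduction J)\<^sup>*"
  using someI_ex[OF ex_nf[OF assms(2,1)]] by (auto simp: nf_def)

lemma reduction_keys: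
  assumes "(a, b) \<in> (reduction J)\<^sup>*" "keys a \<subseteq> R"
  shows "keys b \<subseteq> R"
  using assms
proof induction
  case (step y z)
  then obtain b i where "z = b + D o\<^sub>0" "keys b \<subseteq> R" by (auto simp: reduction_def)
  then show ?case using keys_D(1)[of o\<^sub>0] by (simp add: keys_add_nat)
qed

lemma reduction_mon:
  assumes "(a, b) \<in> (reduction J)\<^sup>*" "\<forall>i\<in>J. mon \<tau> (D i) = mon \<tau> (D o\<^sub>0)"
  shows "mon \<tau> a = mon \<tau> b"
  using assms(1) by induction (use assms(2) in \<open>auto simp: reduction_def mon_add\<close>)

section \<open>Normal forms modulo the binomial ideal\<close>

lemma genideal_add:
  assumes "f \<in> genideal A (bin ` J)" "g \<in> genideal A (bin ` J)"
  shows "f + g \<in> genideal A (bin ` J)"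
  using additive_subgroup.a_closed[OF ideal.axioms(1)[OF genideal_bin] assms] by simp

lemma genideal_sum:
  assumes "\<And>x. x \<in> X \<Longrightarrow> f x \<in> genideal A (bin ` J)"
  shows "(\<Sum>x\<in>X. f x) \<in> genideal A (bin ` J)"
proof -
  have 0: "0 \<in> genideal A (bin ` J)"
    using additive_subgroup.zero_closed[OF ideal.axioms(1)[OF genideal_bin]] by simp
  show ?thesis
    using assms by (induction X rule: infinite_finite_induct) (auto simp: 0 genideal_add)
qed

lemma genideal_mult:
  assumes "f \<in> genideal A (bin ` J)" "keys g \<subseteq> {a. keys a \<subseteq> R}"
  shows "g * f \<in> genideal A (bin ` J)"
  using ideal.I_l_closed[OF genideal_bin assms(1)] assms(2) by simp

lemma reduction_genideal:
  assumes "(a, b) \<in> (reduction J)\<^sup>*"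
  shows "single a c - single b c \<in> genideal A (bin ` J)"
  using assms
proof induction
  case base
  then show ?case using genideal_sum[of "{}"] by simp
next
  case (step y z)
  then obtain b i where bi: "y = b + D i" "z = b + D o\<^sub>0" "i \<in> J" "keys b \<subseteq> R"
    by (auto simp: reduction_def)
  have "bin i \<in> genideal A (bin ` J)"
    using genideal_self[of "bin ` J"] bin_carrier bi(3) by auto
  then have "single b c * bin i \<in> genideal A (bin ` J)"
    using bi(4) by (intro genideal_mult) auto
  then have "single y c - single z c \<in> genideal A (bin ` J)"
    by (simp add: bin_def bi right_diff_distrib mult_single)
  from genideal_add[OF step.IH this] show ?case by simp
qed

text \<open>In logarithmic coordinates the equations between monomials become linear, so solutions
  \<open>\<theta>\<close> of a linear system provide positive real points of the torus part.\<close>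

lemma torus_exp:
  fixes \<theta> :: "'v \<Rightarrow> real"
  assumes "\<And>i. i \<in> J \<Longrightarrow> (\<Sum>\<xi>\<in>R. lookup (D i) \<xi> * \<theta> \<xi>) = (\<Sum>\<xi>\<in>R. lookup (D o\<^sub>0) \<xi> * \<theta> \<xi>)"
  shows "(\<lambda>\<xi>. of_real (exp (\<theta> \<xi>))) \<in> torus J"
    "mon (\<lambda>\<xi>. of_real (exp (\<theta> \<xi>))) a = of_real (exp (\<Sum>\<xi>\<in>R. lookup a \<xi> * \<theta> \<xi>))"
proof -
  show *: "mon (\<lambda>\<xi>. of_real (exp (\<theta> \<xi>))) a = of_real (exp (\<Sum>\<xi>\<in>R. lookup a \<xi> * \<theta> \<xi>))" for a
    by (simp add: mon_def exp_sum finite_R exp_of_nat_mult del: of_real_exp)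
  show "(\<lambda>\<xi>. of_real (exp (\<theta> \<xi>))) \<in> torus J"
    using assms by (simp add: torus_def * del: of_real_exp)
qed

text \<open>The character with exponent \<delta>, the difference of the two, is trivial on the torus
  part. Positive points show that \<delta> vanishes off the blocks and is \<open>c j\<close> times
  \<open>D j\<close> on block j; roots of unity make \<open>c j\<close> an integer. Normality then
  gives \<open>c i = 0\<close> for \<open>i \<in> J\<close>, and scaling blocks gives the
  rest.\<close>

lemma normal_separated:
  assumes a: "normal J a" "keys a \<subseteq> R" and b: "normal J b" "keys b \<subseteq> R"
    and eq: "\<And>\<tau>. \<tau> \<in> torus J \<Longrightarrow> mon \<tau> a = mon \<tau> b"
  shows "a = b"
proof -
  let ?l = "lookup"
  define \<delta> where "\<delta> \<xi> = int (?l a \<xi>) - int (?l b \<xi>)" for \<xi>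
  have \<delta>0: "(\<Sum>\<xi>\<in>R. real_of_int (\<delta> \<xi>) * \<theta> \<xi>) = 0"
    if "\<And>i. i \<in> J \<Longrightarrow> (\<Sum>\<xi>\<in>R. ?l (D i) \<xi> * \<theta> \<xi>) = (\<Sum>\<xi>\<in>R. ?l (D o\<^sub>0) \<xi> * \<theta> \<xi>)" for \<theta> :: "'v \<Rightarrow> real"
  proof -
    have "complex_of_real (exp (\<Sum>\<xi>\<in>R. ?l a \<xi> * \<theta> \<xi>)) = of_real (exp (\<Sum>\<xi>\<in>R. ?l b \<xi> * \<theta> \<xi>))"
      using eq[OF torus_exp(1)[OF that]] torus_exp(2)[OF that] by metis
    then have "(\<Sum>\<xi>\<in>R. ?l a \<xi> * \<theta> \<xi>) = (\<Sum>\<xi>\<in>R. ?l b \<xi> * \<theta> \<xi>)" unfolding of_real_eq_iff by simp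
    then show ?thesis by (simp add: \<delta>_def algebra_simps sum_subtractf)
  qed
  have free: "\<delta> \<xi> = 0" if \<xi>: "\<xi> \<in> R" "\<And>j. \<xi> \<notin> keys (D j)" for \<xi>
  proof -
    have "(\<Sum>\<eta>\<in>R. real_of_int (\<delta> \<eta>) * (if \<eta> = \<xi> then 1 else 0)) = 0"
      using \<xi>(2) by (intro \<delta>0) (simp add: finite_R in_keys_iff if_distrib[of "\<lambda>x. _ * x"] cong: if_cong)
    then show ?thesis using \<xi>(1) finite_R by (simp add: if_distrib[of "\<lambda>x. _ * x"] cong: if_cong)
  qed
  have proportional: "\<delta> \<xi> * ?l (D j) \<eta> = \<delta> \<eta> * ?l (D j) \<xi>"
    if \<xi>: "\<xi> \<in> keys (D j)" and \<eta>: "\<eta> \<in> keys (D j)" for \<xi> \<eta> j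
  proof (cases "\<xi> = \<eta>")
    case False
    \<comment> \<open>Supported at \<xi> and \<eta> and orthogonal to \<open>D j\<close>, so that no
      block changes its value.\<close>
    define \<theta> :: "'v \<Rightarrow> real" where
      "\<theta> \<zeta> = (if \<zeta> = \<xi> then real (?l (D j) \<eta>) else 0) - (if \<zeta> = \<eta> then real (?l (D j) \<xi>) else 0)" for \<zeta>
    have R: "\<xi> \<in> R" "\<eta> \<in> R" using \<xi> \<eta> keys_D(1) by auto
    have sum\<theta>: "(\<Sum>\<zeta>\<in>R. x \<zeta> * \<theta> \<zeta>) = x \<xi> * ?l (D j) \<eta> - x \<eta> * ?l (D j) \<xi>" for x
      using R finite_R
      by (simp add: \<theta>_def right_diff_distrib sum_subtractf if_distrib[of "\<lambda>y. _ * y"] cong: if_cong)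
    have "(\<Sum>\<zeta>\<in>R. ?l (D i) \<zeta> * \<theta> \<zeta>) = 0" for i
      unfolding sum\<theta> using lookup_D_other \<xi> \<eta> by (cases "i = j") auto
    then have "(\<Sum>\<zeta>\<in>R. real_of_int (\<delta> \<zeta>) * \<theta> \<zeta>) = 0" by (intro \<delta>0) simp
    then have "real_of_int (\<delta> \<xi> * ?l (D j) \<eta>) = real_of_int (\<delta> \<eta> * ?l (D j) \<xi>)"
      unfolding sum\<theta> by simp
    then show ?thesis unfolding of_int_eq_iff .
  qed simp
  have dvd: "int (?l (D j) \<xi>) dvd \<delta> \<xi>" if \<xi>: "\<xi> \<in> keys (D j)" for \<xi> j
  proof -
    define d where "d = ?l (D j) \<xi>"
    have d: "d > 0" using \<xi> by (simp add: d_def in_keys_iff)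
    \<comment> \<open>Positive points cannot detect divisibility, and a fractional factor would be
      compatible with normality. A d-th root of unity in the single coordinate \<xi> preserves every
      block, since \<open>D j\<close> has exponent d there, and it sees \<delta> modulo d.\<close>
    define \<omega> where "\<omega> = cis (2 * pi / d)"
    define \<tau> where "\<tau> = (\<lambda>\<zeta>. if \<zeta> = \<xi> then \<omega> else 1)"
    have R: "\<xi> \<in> R" using \<xi> keys_D(1) by auto
    have mon\<tau>: "mon \<tau> c = \<omega> ^ ?l c \<xi>" for c
      using R finite_R by (simp add: mon_def \<tau>_def if_distrib[of "\<lambda>x. x ^ _"] prod.If_cases prod_power_distrib[symmetric] cong: if_cong)
    have \<omega>d: "\<omega> ^ d = 1" using d by (simp add: \<omega>_def Complex.DeMoivre)
    have "mon \<tau> (D i) = 1" for i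
      unfolding mon\<tau> using lookup_D_other[OF \<xi>] \<omega>d by (cases "i = j") (auto simp: d_def)
    moreover have "\<omega> \<noteq> 0" by (simp add: \<omega>_def)
    ultimately have "\<tau> \<in> torus J" by (simp add: torus_def \<tau>_def)
    then have "\<omega> ^ ?l a \<xi> = \<omega> ^ ?l b \<xi>" using eq mon\<tau> by metis
    then have "cis (2 * pi / d * ?l a \<xi>) = cis (2 * pi / d * ?l b \<xi>)"
      unfolding \<omega>_def Complex.DeMoivre by (simp add: mult.commute)
    then have "exp (\<i> * of_real (2 * pi / d * ?l a \<xi>)) = exp (\<i> * of_real (2 * pi / d * ?l b \<xi>))"
      by (simp add: cis_conv_exp)
    then obtain n where "\<i> * of_real (2 * pi / d * ?l a \<xi>) = \<i> * of_real (2 * pi / d * ?l b \<xi>) + complex_of_real (of_int (2 * n) * pi) * \<i>"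
      unfolding exp_eq by blast
    then have "complex_of_real (2 * pi / d * ?l a \<xi>) = of_real (2 * pi / d * ?l b \<xi> + of_int (2 * n) * pi)"
      by (simp add: algebra_simps complex_eq_iff)
    then have "2 * pi / d * ?l a \<xi> = 2 * pi / d * ?l b \<xi> + of_int (2 * n) * pi"
      unfolding of_real_eq_iff .
    then have "real_of_int (\<delta> \<xi>) = of_int (int d * n)"
      using d pi_gt_zero by (simp add: \<delta>_def field_simps) (simp add: distrib_left[symmetric] del: distrib_left)
    then have "\<delta> \<xi> = int d * n" unfolding of_int_eq_iff .
    then show ?thesis by (simp add: d_def)
  qed
  define r where "r j = (SOME \<xi>. \<xi> \<in> keys (D j))" for j
  have r: "r j \<in> keys (D j)" for j using keys_D(2) by (simp add: r_def some_in_eq)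
  define c where "c j = \<delta> (r j) div ?l (D j) (r j)" for j
  have rpos: "?l (D j) (r j) > 0" for j using r[of j] by (simp add: in_keys_iff)
  have \<delta>r: "\<delta> (r j) = c j * ?l (D j) (r j)" for j
    using dvd[OF r[of j]] by (simp add: c_def)
  have \<delta>c: "\<delta> \<xi> = c j * ?l (D j) \<xi>" if "\<xi> \<in> keys (D j)" for \<xi> j
  proof -
    have "\<delta> \<xi> * ?l (D j) (r j) = (c j * ?l (D j) \<xi>) * ?l (D j) (r j)"
      using proportional[OF that r[of j]] \<delta>r[of j] by simp
    then show ?thesis using rpos[of j] by simp
  qed
  \<comment> \<open>An integer \<open>c i \<ge> 1\<close> would make \<open>a\<close> divisible by
    \<open>D i\<close>, and \<open>c i \<le> -1\<close> would make \<open>b\<close> divisible by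
    it.\<close>
  have cJ: "c i = 0" if i: "i \<in> J" for i
  proof (rule ccontr)
    assume "c i \<noteq> 0"
    then consider "c i \<ge> 1" | "c i \<le> -1" by linarith
    then show False
    proof cases
      case 1
      obtain \<xi> where \<xi>: "?l a \<xi> < ?l (D i) \<xi>" using a(1) i by (auto simp: normal_def)
      then have "\<xi> \<in> keys (D i)" by (simp add: in_keys_iff)
      then have "\<delta> \<xi> \<ge> 1 * int (?l (D i) \<xi>)" unfolding \<delta>c[OF \<open>\<xi> \<in> _\<close>] by (intro mult_right_mono 1) simp
      then show False using \<xi> by (simp add: \<delta>_def)
    next
      case 2
      obtain \<xi> where \<xi>: "?l b \<xi> < ?l (D i) \<xi>" using b(1) i by (auto simp: normal_def)
      then have "\<xi> \<in> keys (D i)" by (simp add: in_keys_iff)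
      then have "\<delta> \<xi> \<le> (- 1) * int (?l (D i) \<xi>)" unfolding \<delta>c[OF \<open>\<xi> \<in> _\<close>] by (intro mult_right_mono 2) simp
      then show False using \<xi> by (simp add: \<delta>_def)
    qed
  qed
  have c_out: "c j = 0" if "j \<notin> J" "j \<noteq> o\<^sub>0" for j
  proof -
    \<comment> \<open>Moves only block j, which occurs in no equation of \<open>J\<close>.\<close>
    define \<theta> :: "'v \<Rightarrow> real" where "\<theta> \<zeta> = (if \<zeta> = r j then 1 else 0)" for \<zeta>
    have R: "r j \<in> R" using r keys_D(1) by blast
    have S: "(\<Sum>\<zeta>\<in>R. x \<zeta> * \<theta> \<zeta>) = x (r j)" for x
      using R finite_R by (simp add: \<theta>_def if_distrib[of "\<lambda>y. _ * y"] cong: if_cong)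
    have z: "?l (D i) (r j) = 0" if "i \<noteq> j" for i
      using disjoint_D[OF that] r[of j] by (auto simp: in_keys_iff)
    have "(\<Sum>\<zeta>\<in>R. real_of_int (\<delta> \<zeta>) * \<theta> \<zeta>) = 0"
    proof (rule \<delta>0)
      fix i assume "i \<in> J"
      then have "i \<noteq> j" using that by blast
      then show "(\<Sum>\<zeta>\<in>R. ?l (D i) \<zeta> * \<theta> \<zeta>) = (\<Sum>\<zeta>\<in>R. ?l (D o\<^sub>0) \<zeta> * \<theta> \<zeta>)"
        unfolding S using z[of i] z[of o\<^sub>0] that by simp
    qed
    with S have "real_of_int (\<delta> (r j)) = 0" by simp
    then show ?thesis by (simp add: c_def)
  qed
  have c_o: "c o\<^sub>0 = 0"
  proof -
    \<comment> \<open>The reciprocal exponent as weight at one representative of each block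
      multiplies all monomials \<open>D j\<close> by the same factor. Hence the \<open>c j\<close>
      add up to 0, and only \<open>c o\<^sub>0\<close> is left.\<close>
    define \<theta> :: "'v \<Rightarrow> real" where "\<theta> \<zeta> = (\<Sum>j\<in>UNIV. if \<zeta> = r j then 1 / ?l (D j) (r j) else 0)" for \<zeta>
    have R: "r j \<in> R" for j using r keys_D(1) by blast
    have S: "(\<Sum>\<zeta>\<in>R. x \<zeta> * \<theta> \<zeta>) = (\<Sum>j\<in>UNIV. x (r j) / ?l (D j) (r j))" for x
    proof -
      have "(\<Sum>\<zeta>\<in>R. x \<zeta> * \<theta> \<zeta>) = (\<Sum>j\<in>UNIV. \<Sum>\<zeta>\<in>R. x \<zeta> * (if \<zeta> = r j then 1 / ?l (D j) (r j) else 0))"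
        unfolding \<theta>_def sum_distrib_left by (rule sum.swap)
      also have "\<dots> = (\<Sum>j\<in>UNIV. x (r j) / ?l (D j) (r j))"
        using R finite_R by (simp add: if_distrib[of "\<lambda>y. _ * y"] cong: if_cong)
      finally show ?thesis .
    qed
    have z: "?l (D i) (r j) = 0" if "i \<noteq> j" for i j
      using disjoint_D[OF that] r[of j] by (auto simp: in_keys_iff)
    have "(\<Sum>j\<in>UNIV. ?l (D i) (r j) / ?l (D j) (r j)) = (\<Sum>j\<in>UNIV. if j = i then 1 else 0)" for i
    proof (intro sum.cong refl)
      fix j show "real (?l (D i) (r j)) / ?l (D j) (r j) = (if j = i then 1 else 0)"
        using rpos[of j] z[of i j] by auto
    qed
    then have one: "(\<Sum>\<zeta>\<in>R. ?l (D i) \<zeta> * \<theta> \<zeta>) = 1" for i unfolding S by simp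
    have "(\<Sum>j\<in>UNIV. real_of_int (\<delta> (r j)) / ?l (D j) (r j)) = 0"
      using \<delta>0[of \<theta>] one S by simp
    moreover have "real_of_int (\<delta> (r j)) / ?l (D j) (r j) = c j" for j
      using rpos[of j] by (simp add: \<delta>r)
    moreover have "(\<Sum>j\<in>UNIV. real_of_int (c j)) = (\<Sum>j\<in>UNIV. if j = o\<^sub>0 then real_of_int (c o\<^sub>0) else 0)"
      using cJ c_out by (intro sum.cong) auto
    ultimately show ?thesis by simp
  qed
  have c0: "c j = 0" for j
    using cJ c_out c_o by (cases "j \<in> J"; cases "j = o\<^sub>0") auto
  have "\<delta> \<xi> = 0" for \<xi>
  proof (cases "\<xi> \<in> R")
    case True
    then show ?thesis using free[OF True] \<delta>c c0 by (cases "\<exists>j. \<xi> \<in> keys (D j)") auto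
  next
    case False
    then have "\<xi> \<notin> keys a" "\<xi> \<notin> keys b" using a b by blast+
    then show ?thesis by (simp add: \<delta>_def in_keys_iff)
  qed
  then show ?thesis by (intro poly_mapping_eqI) (simp add: \<delta>_def)
qed

section \<open>Vanishing on the torus part: radicality, homogeneity, regularity\<close>

lemma mon_nonzero: "\<tau> \<in> torus J \<Longrightarrow> mon \<tau> a \<noteq> 0"
  using finite_R by (simp add: mon_def torus_def)

lemma torus_times:
  assumes "\<tau> \<in> torus J" "\<psi> \<in> torus J"
  shows "(\<lambda>\<xi>. \<tau> \<xi> * \<psi> \<xi>) \<in> torus J"
  using assms by (auto simp: torus_def mon_times)

definition nf_coeff :: "'j set \<Rightarrow> (('v \<Rightarrow>\<^sub>0 nat) \<Rightarrow>\<^sub>0 complex) \<Rightarrow> ('v \<Rightarrow>\<^sub>0 nat) \<Rightarrow> complex" where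
  "nf_coeff J f b = (\<Sum>a\<in>{a \<in> keys f. nf J a = b}. lookup f a)"

text \<open>Reduction does not change values on \<open>torus J\<close>, and distinct normal
  monomials are distinct characters there, hence linearly independent.\<close>

lemma nf_coeff_zero_of_vanishing:
  assumes o: "o\<^sub>0 \<notin> J" and f: "f \<in> carrier A" and ev: "\<And>\<tau>. \<tau> \<in> torus J \<Longrightarrow> ev \<tau> f = 0"
  shows "nf_coeff J f b = 0"
proof (cases "b \<in> nf J ` keys f")
  case True
  let ?K = "nf J ` keys f"
  have key: "keys a \<subseteq> R" if "a \<in> keys f" for a using f that by auto
  have K: "normal J b" "keys b \<subseteq> R" if "b \<in> ?K" for b
    using that nf[OF key o] reduction_keys[OF nf(2)[OF key o]] key by auto
  have mon_nz: "mon \<tau> a \<noteq> 0" if "\<tau> \<in> torus J" for \<tau> a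
    using that by (rule mon_nonzero)
  have sum0: "(\<Sum>b\<in>?K. nf_coeff J f b * mon \<tau> b) = 0" if \<tau>: "\<tau> \<in> torus J" for \<tau>
  proof -
    have "ev \<tau> f = (\<Sum>a\<in>keys f. lookup f a * mon \<tau> (nf J a))"
      unfolding ev_def lin_sum_def
    proof (intro sum.cong refl)
      fix a assume "a \<in> keys f"
      then have "mon \<tau> a = mon \<tau> (nf J a)"
        using \<tau> reduction_mon[OF nf(2)[OF key o]] by (auto simp: torus_def)
      then show "lookup f a * mon \<tau> a = lookup f a * mon \<tau> (nf J a)" by simp
    qed
    also have "\<dots> = (\<Sum>b\<in>?K. \<Sum>a\<in>{a \<in> keys f. nf J a = b}. lookup f a * mon \<tau> (nf J a))"
      by (rule sum.image_gen) simp
    also have "\<dots> = (\<Sum>b\<in>?K. nf_coeff J f b * mon \<tau> b)"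
      unfolding nf_coeff_def sum_distrib_right by (intro sum.cong) auto
    finally show ?thesis using ev[OF \<tau>] by simp
  qed
  show ?thesis
  proof (rule multiplicative_functions_independent[of ?K "torus J" "\<lambda>\<tau> \<psi> \<xi>. \<tau> \<xi> * \<psi> \<xi>" "\<lambda>a \<tau>. mon \<tau> a"])
    show "\<exists>\<tau>\<in>torus J. mon \<tau> a \<noteq> 0" for a
      using mon_nz[of "\<lambda>_. 1"] by (intro bexI[of _ "\<lambda>_. 1"]) (auto simp: torus_def mon_def)
    show "\<exists>\<tau>\<in>torus J. mon \<tau> a \<noteq> mon \<tau> b" if "a \<in> ?K" "b \<in> ?K" "a \<noteq> b" for a b
      using normal_separated[of J a b] K that by blast
  qed (use True in \<open>auto simp: torus_times mon_times sum0\<close>)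
next
  case False
  then have "{a \<in> keys f. nf J a = b} = {}" by blast
  then show ?thesis unfolding nf_coeff_def by (simp only: sum.empty)
qed

text \<open>\<open>f\<close> differs by an element of the ideal from the sum of its reduced terms,
  and that sum is 0 once equal monomials are collected.\<close>

lemma genideal_of_nf_coeff:
  assumes o: "o\<^sub>0 \<notin> J" and f: "f \<in> carrier A" and 0: "\<And>b. nf_coeff J f b = 0"
  shows "f \<in> genideal A (bin ` J)"
proof -
  let ?K = "nf J ` keys f"
  have "(\<Sum>a\<in>keys f. single (nf J a) (lookup f a))
    = (\<Sum>b\<in>?K. \<Sum>a\<in>{a \<in> keys f. nf J a = b}. single (nf J a) (lookup f a))"
    by (rule sum.image_gen) simp
  also have "\<dots> = (\<Sum>b\<in>?K. single b (nf_coeff J f b))"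
  proof (rule sum.cong[OF refl])
    fix b :: "'v \<Rightarrow>\<^sub>0 nat"
    have "Modules.additive (single b :: complex \<Rightarrow> _)" by standard (simp add: single_add)
    then show "(\<Sum>a\<in>{a \<in> keys f. nf J a = b}. single (nf J a) (lookup f a))
      = single b (nf_coeff J f b)"
      unfolding nf_coeff_def by (subst additive.sum) (auto intro!: sum.cong)
  qed
  also have "\<dots> = 0" by (simp add: 0)
  finally have eq: "f = (\<Sum>a\<in>keys f. single a (lookup f a) -
      single (nf J a) (lookup f a))"
    using poly_mapping_expansion[of f] by (simp add: sum_subtractf)
  have "single a (lookup f a) -
      single (nf J a) (lookup f a) \<in> genideal A (bin ` J)"
    if "a \<in> keys f" for a
    using f that by (intro reduction_genideal nf o) auto
  then show ?thesis by (subst eq) (rule genideal_sum)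
qed

lemma genideal_vanishing:
  assumes "f \<in> genideal A (bin ` J)" "\<tau> \<in> torus J"
  shows "ev \<tau> f = 0"
  using genideal_ev[OF assms(1)] assms(2) by (simp add: torus_def)

text \<open>A Nullstellensatz for this ideal in which points with nonzero coordinates are enough;
  radicality and regularity are read off from it.\<close>

lemma genideal_of_vanishing:
  assumes "o\<^sub>0 \<notin> J" "f \<in> carrier A" "\<And>\<tau>. \<tau> \<in> torus J \<Longrightarrow> ev \<tau> f = 0"
  shows "f \<in> genideal A (bin ` J)"
  by (intro genideal_of_nf_coeff nf_coeff_zero_of_vanishing assms)

lemma radical_genideal:
  assumes "o\<^sub>0 \<notin> J"
  shows "radical_ideal (genideal A (bin ` J)) A"
  unfolding radical_ideal_def
proof (intro conjI ballI allI impI genideal_bin)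
  fix f n assume f: "f \<in> carrier A" "f [^]\<^bsub>A\<^esub> (n::nat) \<in> genideal A (bin ` J)"
  show "f \<in> genideal A (bin ` J)"
  proof (rule genideal_of_vanishing[OF assms f(1)])
    fix \<tau> assume "\<tau> \<in> torus J"
    then have "ev \<tau> (f [^]\<^bsub>A\<^esub> n) = 0" by (rule genideal_vanishing[OF f(2)])
    then show "ev \<tau> f = 0" by (simp add: ev_power)
  qed
qed

lemma genideal_proper: "genideal A (bin ` J) \<noteq> carrier A"
proof
  assume "genideal A (bin ` J) = carrier A"
  then have "1 \<in> genideal A (bin ` J)" using one_closed by simp
  moreover have "(\<lambda>_. 1) \<in> torus J" by (simp add: torus_def mon_def)
  ultimately show False using genideal_vanishing by fastforce
qed

text \<open>Reduction preserves \<open>deg\<close>, so the normal form coefficients of a component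
  are those of \<open>f\<close> at monomials of degree \<gamma> and 0 elsewhere. The degree is left
  abstract; the grading of the Cox ring is put in later.\<close>

lemma genideal_component:
  assumes o: "o\<^sub>0 \<notin> J" and f: "f \<in> genideal A (bin ` J)"
    and deg: "\<And>b i. i \<in> J \<Longrightarrow> deg (b + D i) = deg (b + D o\<^sub>0)"
  shows "(\<Sum>a\<in>{a \<in> keys f. deg a = \<gamma>}. single a (lookup f a))
    \<in> genideal A (bin ` J)" (is "?g \<in> _")
proof (rule genideal_of_nf_coeff[OF o])
  have fA: "f \<in> carrier A" by (rule ideal.Icarr[OF genideal_bin f])
  have lookup: "lookup ?g a = (if deg a = \<gamma> then lookup f a else 0)" for a
    by (simp add: lookup_sum lookup_single when_def in_keys_iff)
  have keys: "keys ?g = {a \<in> keys f. deg a = \<gamma>}"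
  proof (rule Set.set_eqI)
    fix x
    show "x \<in> keys ?g \<longleftrightarrow> x \<in> {a \<in> keys f. deg a = \<gamma>}"
      unfolding in_keys_iff[of x ?g] lookup mem_Collect_eq in_keys_iff[of x f] by simp
  qed
  then show "?g \<in> carrier A" using fA by auto
  fix b
  have red: "deg a = deg c" if "(a, c) \<in> (reduction J)\<^sup>*" for a c
    using that by induction (auto simp: reduction_def deg)
  have degnf: "deg (nf J a) = deg a" if "a \<in> keys f" for a
    using red[OF nf(2)[OF _ o]] fA that by auto
  have "nf_coeff J ?g b = (\<Sum>a\<in>{a \<in> keys f. deg a = \<gamma> \<and> nf J a = b}. lookup f a)"
    unfolding nf_coeff_def keys by (rule sum.cong) (auto simp: lookup)
  also have "\<dots> = (if deg b = \<gamma> then nf_coeff J f b else 0)"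
  proof (cases "deg b = \<gamma>")
    case True
    then have "{a \<in> keys f. deg a = \<gamma> \<and> nf J a = b} = {a \<in> keys f. nf J a = b}"
      using degnf by auto
    then show ?thesis using True by (simp add: nf_coeff_def)
  next
    case False
    then have "{a \<in> keys f. deg a = \<gamma> \<and> nf J a = b} = {}"
      using degnf by auto
    then show ?thesis using False by (simp only: if_False sum.empty)
  qed
  also have "\<dots> = 0"
    using nf_coeff_zero_of_vanishing[OF o fA genideal_vanishing[OF f]] by simp
  finally show "nf_coeff J ?g b = 0" .
qed

text \<open>Where the monomials \<open>D i\<close> and \<open>D o\<^sub>0\<close> differ, the factor
  can be cancelled. Any other point of \<open>torus J\<close> is a limit of such points, because
  scaling the variables of block i disturbs no equation of \<open>J\<close>; continuity of
  evaluation concludes.\<close>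

lemma bin_not_zero_divisor:
  assumes o: "o\<^sub>0 \<notin> J" and i: "i \<notin> J" "i \<noteq> o\<^sub>0" and g: "g \<in> carrier A"
    and gi: "g * bin i \<in> genideal A (bin ` J)"
  shows "g \<in> genideal A (bin ` J)"
proof (rule genideal_of_vanishing[OF o g])
  fix \<tau> assume \<tau>: "\<tau> \<in> torus J"
  have van: "ev \<psi> g = 0" if "\<psi> \<in> torus J" "mon \<psi> (D i) \<noteq> mon \<psi> (D o\<^sub>0)" for \<psi>
    using genideal_vanishing[OF gi that(1)] that(2) by (simp add: ev_mult ev_bin)
  show "ev \<tau> g = 0"
  proof (cases "mon \<tau> (D i) = mon \<tau> (D o\<^sub>0)")
    case True
    \<comment> \<open>Tends to 1 from above, so that no positive power of it equals 1 and the scaled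
      monomial \<open>D i\<close> differs from \<open>D o\<^sub>0\<close>.\<close>
    define t where "t n = 1 + 1 / real (Suc n)" for n
    have t: "t n > 1" for n by (simp add: t_def)
    define \<psi> where "\<psi> n \<xi> = (if \<xi> \<in> keys (D i) then of_real (t n) else 1) * \<tau> \<xi>" for n \<xi>
    define S where "S = (\<Sum>\<xi>\<in>keys (D i). lookup (D i) \<xi>)"
    have "S > 0"
      unfolding S_def using keys_D(2)[of i] by (intro sum_pos) (auto simp: in_keys_iff)
    have mon\<psi>: "mon (\<psi> n) (D j) = (if j = i then of_real (t n) ^ S else 1) * mon \<tau> (D j)" for n j
    proof -
      have "mon (\<lambda>\<xi>. if \<xi> \<in> keys (D i) then of_real (t n) else 1) (D j)
        = (\<Prod>\<xi>\<in>R. if \<xi> \<in> keys (D i) then of_real (t n) ^ lookup (D j) \<xi> else 1)"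
        unfolding mon_def by (intro prod.cong) auto
      also have "\<dots> = (\<Prod>\<xi>\<in>keys (D i). of_real (t n) ^ lookup (D j) \<xi>)"
        using keys_D(1)[of i] finite_R by (simp add: prod.If_cases Int_absorb1)
      also have "\<dots> = (if j = i then of_real (t n) ^ S else 1)"
        using lookup_D_other[of _ i j] by (simp add: S_def power_sum)
      finally show ?thesis unfolding \<psi>_def mon_times by simp
    qed
    have "t n ^ S > 1" for n
      using \<open>S > 0\<close> t by (intro one_less_power) auto
    then have "t n ^ S \<noteq> 1" for n by (simp add: less_imp_neq[symmetric])
    then have "complex_of_real (t n) ^ S \<noteq> 1" for n
      unfolding of_real_power[symmetric] of_real_eq_1_iff .
    have nz: "mon \<tau> (D j) \<noteq> 0" for j using \<tau> by (rule mon_nonzero)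
    have ne: "mon (\<psi> n) (D i) \<noteq> mon (\<psi> n) (D o\<^sub>0)" for n
    proof -
      have "mon (\<psi> n) (D i) = of_real (t n) ^ S * mon \<tau> (D o\<^sub>0)" using mon\<psi>[of n i] True by simp
      moreover have "mon (\<psi> n) (D o\<^sub>0) = mon \<tau> (D o\<^sub>0)" using mon\<psi>[of n o\<^sub>0] i(2) by simp
      ultimately show ?thesis using \<open>complex_of_real (t n) ^ S \<noteq> 1\<close> nz[of o\<^sub>0] by simp
    qed
    have "t n \<noteq> 0" for n using t[of n] by linarith
    then have "\<psi> n \<xi> \<noteq> 0" for n \<xi> using \<tau> by (simp add: \<psi>_def torus_def)
    moreover have "mon (\<psi> n) (D j) = mon (\<psi> n) (D o\<^sub>0)" if "j \<in> J" for n j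
      using \<tau> o i that unfolding torus_def mon\<psi> by auto
    ultimately have "\<psi> n \<in> torus J" for n
      unfolding torus_def by blast
    then have "ev (\<psi> n) g = 0" for n using van ne by blast
    moreover have "(\<lambda>n. ev (\<psi> n) g) \<longlonglongrightarrow> ev \<tau> g"
    proof -
      have "t \<longlonglongrightarrow> 1 + 0"
        unfolding t_def by (intro tendsto_add tendsto_const LIMSEQ_Suc lim_1_over_n)
      then have "(\<lambda>n. complex_of_real (t n)) \<longlonglongrightarrow> 1"
        using tendsto_of_real by fastforce
      then have "(\<lambda>n. complex_of_real (t n) * \<tau> \<xi>) \<longlonglongrightarrow> 1 * \<tau> \<xi>" for \<xi>
        by (intro tendsto_mult tendsto_const)
      then have "(\<lambda>n. \<psi> n \<xi>) \<longlonglongrightarrow> \<tau> \<xi>" for \<xi>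
        by (cases "\<xi> \<in> keys (D i)") (simp_all add: \<psi>_def)
      then show ?thesis unfolding ev_def lin_sum_def mon_def
        by (intro tendsto_sum tendsto_mult tendsto_prod tendsto_power tendsto_const)
    qed
    ultimately show ?thesis by (simp add: LIMSEQ_const_iff)
  qed (use van \<tau> in blast)
qed

lemma regular_sequence_bin:
  assumes "distinct js" "o\<^sub>0 \<notin> set js"
  shows "regular_sequence A (map bin js)"
  unfolding regular_sequence_def
proof (intro conjI allI ballI impI)
  show "set (map bin js) \<subseteq> carrier A" using bin_carrier by auto
  show "genideal A (set (map bin js)) \<noteq> carrier A"
    using genideal_proper[of "set js"] by simp
  fix l g
  assume l: "l < length (map bin js)" and g: "g \<in> carrier A"
    and gl: "g \<otimes>\<^bsub>A\<^esub> (map bin js ! l) \<in> genideal A (set (take l (map bin js)))"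
  have eq: "set (take l (map bin js)) = bin ` set (take l js)" by (simp add: take_map)
  have "js ! l \<notin> set (take l js)"
    using assms(1) l by (auto simp: in_set_conv_nth nth_eq_iff_index_eq)
  moreover have "o\<^sub>0 \<notin> set (take l js)" using assms(2) by (meson in_set_takeD)
  moreover have "js ! l \<noteq> o\<^sub>0" using assms(2) l by (metis length_map nth_mem)
  moreover have "g * bin (js ! l) \<in> genideal A (bin ` set (take l js))"
    using gl l by (simp add: take_map)
  ultimately show "g \<in> genideal A (set (take l (map bin js)))"
    unfolding eq by (intro bin_not_zero_divisor[OF _ _ _ g])
qed

end

section \<open>Krull dimension of toric varieties\<close>

text \<open>Gaussian elimination on the equations \<open>b\<close>: one with a nonzero coefficient
  at \<open>a0\<close> is solved for the unknown \<open>c a0\<close> and substituted into the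
  others.\<close>

lemma finite_linear_dependence:
  fixes m :: "'b \<Rightarrow> 'a \<Rightarrow> 'c::field"
  assumes "finite B" "finite A" "card B < card A"
  shows "\<exists>c. (\<exists>a\<in>A. c a \<noteq> 0) \<and> (\<forall>b\<in>B. (\<Sum>a\<in>A. c a * m b a) = 0)"
  using assms
proof (induction B arbitrary: A m rule: finite_induct)
  case empty
  then have "A \<noteq> {}" by auto
  then show ?case by (intro exI[of _ "\<lambda>_. 1"]) auto
next
  case (insert b B)
  show ?case
  proof (cases "\<forall>a\<in>A. m b a = 0")
    case True
    have "card B < card A" using insert.prems insert.hyps by simp
    then obtain c where "\<exists>a\<in>A. c a \<noteq> 0" "\<forall>b\<in>B. (\<Sum>a\<in>A. c a * m b a) = 0"
      using insert.IH[OF insert.prems(1)] by metis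
    then show ?thesis using True by (intro exI[of _ c]) simp
  next
    case False
    then obtain a0 where a0: "a0 \<in> A" "m b a0 \<noteq> 0" by blast
    define m' where "m' b' a = m b' a - m b' a0 * m b a / m b a0" for b' a
    have "card B < card (A - {a0})" using insert.prems insert.hyps a0 by simp
    then obtain c where c: "\<exists>a\<in>A - {a0}. c a \<noteq> 0" "\<forall>b\<in>B. (\<Sum>a\<in>A - {a0}. c a * m' b a) = 0"
      using insert.IH[of "A - {a0}" m'] insert.prems(1) by auto
    define s where "s = (\<Sum>a\<in>A - {a0}. c a * m b a)"
    define c' where "c' = c(a0 := - s / m b a0)"
    have sum_c': "(\<Sum>a\<in>A. c' a * m b' a) = - s / m b a0 * m b' a0 + (\<Sum>a\<in>A - {a0}. c a * m b' a)" for b'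
      using insert.prems(1) a0(1) by (simp add: sum.remove[of A a0] c'_def)
    have "(\<Sum>a\<in>A. c' a * m b' a) = 0" if "b' \<in> B" for b'
    proof -
      have "(\<Sum>a\<in>A - {a0}. c a * m' b' a) =
          (\<Sum>a\<in>A - {a0}. c a * m b' a) - (\<Sum>a\<in>A - {a0}. m b' a0 / m b a0 * (c a * m b a))"
        by (simp add: m'_def algebra_simps sum_subtractf)
      then have "(\<Sum>a\<in>A - {a0}. c a * m b' a) - m b' a0 / m b a0 * s = 0"
        using c(2) that by (simp add: s_def sum_distrib_left)
      then show ?thesis unfolding sum_c' by (simp add: algebra_simps)
    qed
    moreover have "(\<Sum>a\<in>A. c' a * m b a) = 0"
      unfolding sum_c' using a0(2) by (simp add: s_def)
    moreover have "\<exists>a\<in>A. c' a \<noteq> 0" using c(1) by (auto simp: c'_def)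
    ultimately show ?thesis by (intro exI[of _ c']) simp
  qed
qed

section \<open>Regular functions and Zariski closed sets\<close>

lemma zero_in_dual_semigroup: "0 \<in> dual_semigroup \<sigma>"
  by (simp add: dual_semigroup_def real_vec_def inner_vec_def)

lemma carrier_coord_ring: "carrier (coord_ring \<sigma>) = {f. keys f \<subseteq> dual_semigroup \<sigma>}"
  by (simp add: coord_ring_def)

lemma cring_coord_ring: "cring (coord_ring \<sigma>)"
  unfolding coord_ring_def by (intro cring_semigroup_algebra zero_in_dual_semigroup dual_semigroup_add)

lemma const_in_coord_ring: "single 0 c \<in> carrier (coord_ring \<sigma>)"
  by (simp add: carrier_coord_ring zero_in_dual_semigroup)

lemma toric_variety_add:
  assumes "p \<in> toric_variety \<sigma>" "f \<in> carrier (coord_ring \<sigma>)" "g \<in> carrier (coord_ring \<sigma>)"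
  shows "p (f + g) = p f + p g"
  using assms
  by (auto simp: toric_variety_def ring_hom_def complex_ring_def coord_ring_def)

lemma toric_variety_const: "p \<in> toric_variety \<sigma> \<Longrightarrow> p (single 0 c) = c"
  by (simp add: toric_variety_def)

lemma toric_variety_zero_one: "p \<in> toric_variety \<sigma> \<Longrightarrow> p 0 = 0" "p \<in> toric_variety \<sigma> \<Longrightarrow> p 1 = 1"
  using toric_variety_const[of p \<sigma> 0] toric_variety_const[of p \<sigma> 1] by simp_all

text \<open>A calculus of functions instead of ring elements: polynomial expressions in values
  \<open>p (b i)\<close> are regular by closure rules, without naming the element that induces
  them.\<close>

definition regular_fun :: "(real ^ 'd) set \<Rightarrow> ((((int ^ 'd) \<Rightarrow>\<^sub>0 complex) \<Rightarrow> complex) \<Rightarrow> complex) \<Rightarrow> bool" where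
  "regular_fun \<sigma> h \<longleftrightarrow> (\<exists>f\<in>carrier (coord_ring \<sigma>). \<forall>p\<in>toric_variety \<sigma>. h p = p f)"

lemma regular_fun_eval: "f \<in> carrier (coord_ring \<sigma>) \<Longrightarrow> regular_fun \<sigma> (\<lambda>p. p f)"
  by (auto simp: regular_fun_def)

lemma regular_fun_const: "regular_fun \<sigma> (\<lambda>p. c)"
  unfolding regular_fun_def
  by (intro bexI[of _ "single 0 c"] const_in_coord_ring) (simp add: toric_variety_const)

lemma regular_fun_add: "regular_fun \<sigma> g \<Longrightarrow> regular_fun \<sigma> h \<Longrightarrow> regular_fun \<sigma> (\<lambda>p. g p + h p)"
  unfolding regular_fun_def
proof (elim bexE)
  fix f f' assume f: "f \<in> carrier (coord_ring \<sigma>)" "f' \<in> carrier (coord_ring \<sigma>)"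
    and e: "\<forall>p\<in>toric_variety \<sigma>. g p = p f" "\<forall>p\<in>toric_variety \<sigma>. h p = p f'"
  have "f + f' \<in> carrier (coord_ring \<sigma>)"
    using f keys_add[of f f'] by (auto simp: carrier_coord_ring)
  with f e show "\<exists>f\<in>carrier (coord_ring \<sigma>). \<forall>p\<in>toric_variety \<sigma>. g p + h p = p f"
    by (intro bexI[of _ "f + f'"]) (simp_all add: toric_variety_add)
qed

lemma regular_fun_mult: "regular_fun \<sigma> g \<Longrightarrow> regular_fun \<sigma> h \<Longrightarrow> regular_fun \<sigma> (\<lambda>p. g p * h p)"
  unfolding regular_fun_def
proof (elim bexE)
  fix f f' assume f: "f \<in> carrier (coord_ring \<sigma>)" "f' \<in> carrier (coord_ring \<sigma>)"
    and e: "\<forall>p\<in>toric_variety \<sigma>. g p = p f" "\<forall>p\<in>toric_variety \<sigma>. h p = p f'"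
  with f e show "\<exists>f\<in>carrier (coord_ring \<sigma>). \<forall>p\<in>toric_variety \<sigma>. g p * h p = p f"
    by (intro bexI[of _ "f * f'"] coord_ring_mult_closed) (simp_all add: toric_variety_mult)
qed

lemma regular_fun_power: "regular_fun \<sigma> h \<Longrightarrow> regular_fun \<sigma> (\<lambda>p. h p ^ n)"
  by (induction n) (simp_all add: regular_fun_const regular_fun_mult)

lemma regular_fun_sum: "(\<And>i. i \<in> I \<Longrightarrow> regular_fun \<sigma> (h i)) \<Longrightarrow> regular_fun \<sigma> (\<lambda>p. \<Sum>i\<in>I. h i p)"
  by (induction I rule: infinite_finite_induct) (simp_all add: regular_fun_const regular_fun_add)

lemma regular_fun_prod: "(\<And>i. i \<in> I \<Longrightarrow> regular_fun \<sigma> (h i)) \<Longrightarrow> regular_fun \<sigma> (\<lambda>p. \<Prod>i\<in>I. h i p)"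
  by (induction I rule: infinite_finite_induct) (simp_all add: regular_fun_const regular_fun_mult)

lemma openin_zariski: "openin (zariski \<sigma>) U \<longleftrightarrow>
   (\<exists>F \<subseteq> carrier (coord_ring \<sigma>). U = toric_variety \<sigma> - {p \<in> toric_variety \<sigma>. \<forall>f\<in>F. p f = 0})"
  unfolding zariski_def topology_inverse'[OF istopology_zariski] ..

lemma topspace_zariski [simp]: "topspace (zariski \<sigma>) = toric_variety \<sigma>"
proof
  show "topspace (zariski \<sigma>) \<subseteq> toric_variety \<sigma>"
    unfolding topspace_def by (auto simp: openin_zariski)
  have "openin (zariski \<sigma>) (toric_variety \<sigma>)"
    unfolding openin_zariski using const_in_coord_ring[of 1 \<sigma>]
    by (intro exI[of _ "{1}"]) (auto simp: toric_variety_zero_one)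
  then show "toric_variety \<sigma> \<subseteq> topspace (zariski \<sigma>)" by (rule openin_subset)
qed

lemma closedin_zariski: "closedin (zariski \<sigma>) Z \<longleftrightarrow>
   (\<exists>F \<subseteq> carrier (coord_ring \<sigma>). Z = {p \<in> toric_variety \<sigma>. \<forall>f\<in>F. p f = 0})"
proof
  assume Z: "closedin (zariski \<sigma>) Z"
  then obtain F where F: "F \<subseteq> carrier (coord_ring \<sigma>)"
      "toric_variety \<sigma> - Z = toric_variety \<sigma> - {p \<in> toric_variety \<sigma>. \<forall>f\<in>F. p f = 0}"
    by (auto simp: closedin_def openin_zariski)
  moreover have "Z \<subseteq> toric_variety \<sigma>" using closedin_subset[OF Z] by simp
  ultimately have "Z = {p \<in> toric_variety \<sigma>. \<forall>f\<in>F. p f = 0}" by blast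
  with F(1) show "\<exists>F \<subseteq> carrier (coord_ring \<sigma>). Z = {p \<in> toric_variety \<sigma>. \<forall>f\<in>F. p f = 0}"
    by (intro exI[of _ F] conjI)
next
  assume "\<exists>F \<subseteq> carrier (coord_ring \<sigma>). Z = {p \<in> toric_variety \<sigma>. \<forall>f\<in>F. p f = 0}"
  then obtain F where F: "F \<subseteq> carrier (coord_ring \<sigma>)" "Z = {p \<in> toric_variety \<sigma>. \<forall>f\<in>F. p f = 0}"
    by (elim exE conjE) (rule that)
  then show "closedin (zariski \<sigma>) Z"
    unfolding closedin_def openin_zariski topspace_zariski by (intro conjI exI[of _ F]) simp_all
qed

lemma closedin_zero_set:
  assumes "regular_fun \<sigma> h"
  shows "closedin (zariski \<sigma>) {p \<in> toric_variety \<sigma>. h p = 0}"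
proof -
  obtain f where f: "f \<in> carrier (coord_ring \<sigma>)" "\<forall>p\<in>toric_variety \<sigma>. h p = p f"
    using assms by (auto simp: regular_fun_def)
  then show ?thesis unfolding closedin_zariski by (intro exI[of _ "{f}"]) auto
qed

lemma irreducible_prod_zero:
  assumes "irreducible_in (zariski \<sigma>) Z" "Z \<subseteq> toric_variety \<sigma>" "regular_fun \<sigma> g" "regular_fun \<sigma> h"
    and "\<And>p. p \<in> Z \<Longrightarrow> g p = 0 \<or> h p = 0"
  shows "(\<forall>p\<in>Z. g p = 0) \<or> (\<forall>p\<in>Z. h p = 0)"
proof -
  have sub: "Z \<subseteq> {p \<in> toric_variety \<sigma>. g p = 0} \<union> {p \<in> toric_variety \<sigma>. h p = 0}"
    using assms(2,5) by blast
  have "Z \<subseteq> {p \<in> toric_variety \<sigma>. g p = 0} \<or> Z \<subseteq> {p \<in> toric_variety \<sigma>. h p = 0}"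
    by (rule assms(1)[unfolded irreducible_in_def, THEN conjunct2, rule_format])
      (intro conjI closedin_zero_set assms(3,4) sub)
  then show ?thesis by blast
qed

lemma sum_PiE_lessThan_Suc:
  fixes l D :: nat
  shows "(\<Sum>\<alpha>\<in>{..<Suc l} \<rightarrow>\<^sub>E {..D}. h \<alpha>) = (\<Sum>j\<le>D. \<Sum>\<beta>\<in>{..<l} \<rightarrow>\<^sub>E {..D}. h (\<beta>(l := j)))"
proof -
  have "(\<Sum>\<alpha>\<in>{..<Suc l} \<rightarrow>\<^sub>E {..D}. h \<alpha>) = (\<Sum>(j, \<beta>)\<in>{..D} \<times> ({..<l} \<rightarrow>\<^sub>E {..D}). h (\<beta>(l := j)))"
    unfolding lessThan_Suc PiE_insert_eq
    by (subst sum.reindex, rule inj_combinator) (simp_all add: case_prod_unfold)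
  then show ?thesis by (simp add: sum.cartesian_product)
qed

text \<open>Peeling off the last variable \<open>b\<^sub>l\<close>: the lowest power of it occurring in a relation can be cancelled
  by irreducibility, and the remaining relation, restricted to the smaller set on which \<open>b\<^sub>l\<close>
  vanishes, no longer involves \<open>b\<^sub>l\<close>.\<close>

lemma chain_monomials_independent:
  fixes Z :: "nat \<Rightarrow> (((int ^ 'd) \<Rightarrow>\<^sub>0 complex) \<Rightarrow> complex) set"
  assumes Z: "\<And>i. i \<le> l \<Longrightarrow> irreducible_in (zariski \<sigma>) (Z i) \<and> Z i \<subseteq> toric_variety \<sigma>"
    and mono: "\<And>i. i < l \<Longrightarrow> Z i \<subseteq> Z (Suc i)"
    and b: "\<And>i. i < l \<Longrightarrow> b i \<in> carrier (coord_ring \<sigma>)"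
    and b0: "\<And>i p. i < l \<Longrightarrow> p \<in> Z i \<Longrightarrow> p (b i) = 0"
    and b1: "\<And>i. i < l \<Longrightarrow> \<exists>p\<in>Z (Suc i). p (b i) \<noteq> 0"
    and rel: "\<And>p. p \<in> Z l \<Longrightarrow> (\<Sum>\<alpha>\<in>{..<l} \<rightarrow>\<^sub>E {..D}. c \<alpha> * (\<Prod>i<l. p (b i) ^ \<alpha> i)) = 0"
    and \<alpha>: "\<alpha> \<in> {..<l} \<rightarrow>\<^sub>E {..D}"
  shows "c \<alpha> = 0"
  using assms
proof (induction l arbitrary: c \<alpha>)
  case 0
  obtain p where "p \<in> Z 0" using "0.prems"(1)[of 0] by (auto simp: irreducible_in_def)
  then show ?case using "0.prems"(6)[of p] "0.prems"(7) by simp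
next
  case (Suc l)
  let ?I = "{..<l} \<rightarrow>\<^sub>E {..D}"
  define g where "g j p = (\<Sum>\<beta>\<in>?I. c (\<beta>(l := j)) * (\<Prod>i<l. p (b i) ^ \<beta> i))" for j p
  have rel: "(\<Sum>j\<le>D. p (b l) ^ j * g j p) = 0" if "p \<in> Z (Suc l)" for p
  proof -
    have "(\<Sum>\<alpha>\<in>{..<Suc l} \<rightarrow>\<^sub>E {..D}. c \<alpha> * (\<Prod>i<Suc l. p (b i) ^ \<alpha> i)) = (\<Sum>j\<le>D. p (b l) ^ j * g j p)"
      unfolding sum_PiE_lessThan_Suc g_def sum_distrib_left
      by (intro sum.cong refl) (simp add: mult_ac)
    then show ?thesis using Suc.prems(6)[OF that] by simp
  qed
  have reg_g: "regular_fun \<sigma> (g j)" for j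
    unfolding g_def using Suc.prems(3)
    by (intro regular_fun_sum regular_fun_mult regular_fun_const regular_fun_prod regular_fun_power regular_fun_eval) auto
  have coeff0: "\<forall>\<beta>\<in>?I. c (\<beta>(l := j)) = 0" if "j \<le> D" for j
    using that
  proof (induction j rule: less_induct)
    case (less j)
    have g0: "g j' p = 0" if "j' < j" for j' p
      unfolding g_def
    proof (intro sum.neutral ballI)
      fix \<beta> assume "\<beta> \<in> ?I"
      moreover have "\<forall>\<beta>\<in>?I. c (\<beta>(l := j')) = 0"
        by (rule less.IH[OF that]) (use less.prems that in linarith)
      ultimately have "c (\<beta>(l := j')) = 0" by (rule bspec[rotated])
      then show "c (\<beta>(l := j')) * (\<Prod>i<l. p (b i) ^ \<beta> i) = 0" by (simp only: mult_zero_left)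
    qed
    \<comment> \<open>The relation divided by the j-th power of b_l; all terms of lower order vanish
      because the \<open>g j'\<close> with j' < j do.\<close>
    define h where "h p = (\<Sum>k\<le>D - j. p (b l) ^ k * g (j + k) p)" for p
    have reg_h: "regular_fun \<sigma> h"
      unfolding h_def using Suc.prems(3)
      by (intro regular_fun_sum regular_fun_mult regular_fun_power regular_fun_eval reg_g) auto
    have h: "p (b l) = 0 \<or> h p = 0" if "p \<in> Z (Suc l)" for p
    proof -
      have "(\<Sum>i\<le>D. p (b l) ^ i * g i p) = (\<Sum>i\<in>{j..D}. p (b l) ^ i * g i p)"
        using g0 by (intro sum.mono_neutral_right) auto
      also have "\<dots> = (\<Sum>k\<in>{..D - j}. p (b l) ^ (j + k) * g (j + k) p)"
        using less.prems by (intro sum.reindex_bij_witness[of _ "\<lambda>k. j + k" "\<lambda>i. i - j"]) auto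
      also have "\<dots> = p (b l) ^ j * h p"
        by (simp add: h_def sum_distrib_left power_add mult_ac)
      finally show ?thesis using rel[OF that] by auto
    qed
    \<comment> \<open>By irreducibility one factor vanishes on all of \<open>Z (Suc l)\<close>, and
      it is not b_l, by its choice. On \<open>Z l\<close>, where b_l is 0, only the constant term
      \<open>g j\<close> of \<open>h\<close> remains.\<close>
    have "(\<forall>p\<in>Z (Suc l). p (b l) = 0) \<or> (\<forall>p\<in>Z (Suc l). h p = 0)"
      using Suc.prems(1)[of "Suc l"] Suc.prems(3)[of l] h
      by (intro irreducible_prod_zero[OF _ _ regular_fun_eval reg_h]) auto
    then have h0: "h p = 0" if "p \<in> Z l" for p
      using Suc.prems(5)[of l] Suc.prems(2)[of l] that by auto
    have "g j p = 0" if "p \<in> Z l" for p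
    proof -
      have "h p = (\<Sum>k\<in>{0}. p (b l) ^ k * g (j + k) p)"
        unfolding h_def using Suc.prems(4)[of l p] that by (intro sum.mono_neutral_right) auto
      then show ?thesis using h0[OF that] by simp
    qed
    then show ?case
      using Suc.prems(1-5) unfolding g_def
      by (intro ballI Suc.IH[of "\<lambda>\<beta>. c (\<beta>(l := j))"]) (simp_all add: less_Suc_eq_le)
  qed
  have "restrict \<alpha> {..<l} \<in> ?I" "\<alpha> l \<le> D"
    using Suc.prems(7) by (auto simp: PiE_iff)
  moreover have "(restrict \<alpha> {..<l})(l := \<alpha> l) = \<alpha>"
    using Suc.prems(7) by (auto simp: fun_eq_iff PiE_iff extensional_def)
  ultimately show ?case using coeff0 by metis
qed

section \<open>Counting monomials: the upper bound for the dimension\<close>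

definition lattice_box :: "nat \<Rightarrow> (int ^ 'd) set" where
  "lattice_box m = {u. \<forall>s. \<bar>u $ s\<bar> \<le> int m}"

lemma lattice_box_finite_card:
  "finite (lattice_box m :: (int ^ 'd) set)"
  "card (lattice_box m :: (int ^ 'd) set) \<le> (2 * m + 1) ^ CARD('d)"
proof -
  have sub: "(lattice_box m :: (int ^ 'd) set) \<subseteq> vec_lambda ` (UNIV \<rightarrow>\<^sub>E {- int m..int m})"
  proof
    fix u :: "int ^ 'd" assume "u \<in> lattice_box m"
    then have "u = vec_lambda (($) u)" "($) u \<in> UNIV \<rightarrow>\<^sub>E {- int m..int m}"
      by (auto simp: lattice_box_def abs_le_iff PiE_iff) (smt (verit) abs_le_iff)
    then show "u \<in> vec_lambda ` (UNIV \<rightarrow>\<^sub>E {- int m..int m})" by blast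
  qed
  have fin: "finite ((UNIV :: 'd set) \<rightarrow>\<^sub>E {- int m..int m})" by (intro finite_PiE) auto
  then show "finite (lattice_box m :: (int ^ 'd) set)"
    using sub finite_subset by blast
  have "card (lattice_box m :: (int ^ 'd) set) \<le> card ((UNIV :: 'd set) \<rightarrow>\<^sub>E {- int m..int m})"
    using sub fin by (meson card_image_le card_mono finite_imageI order_trans)
  also have "\<dots> = (2 * m + 1) ^ CARD('d)" by (simp add: card_PiE nat_add_distrib nat_mult_distrib)
  finally show "card (lattice_box m :: (int ^ 'd) set) \<le> (2 * m + 1) ^ CARD('d)" .
qed

lemma keys_mult_box:
  fixes f g :: "(int ^ 'd) \<Rightarrow>\<^sub>0 complex"
  assumes "keys f \<subseteq> lattice_box m" "keys g \<subseteq> lattice_box n"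
  shows "keys (f * g) \<subseteq> lattice_box (m + n)"
proof
  fix u assume "u \<in> keys (f * g)"
  then obtain v w where "u = v + w" "v \<in> lattice_box m" "w \<in> lattice_box n"
    using keys_mult[of f g] assms by blast
  then show "u \<in> lattice_box (m + n)"
    by (auto simp: lattice_box_def intro: order_trans[OF abs_triangle_ineq] add_mono)
qed

lemma keys_power_box:
  fixes f :: "(int ^ 'd) \<Rightarrow>\<^sub>0 complex"
  assumes "keys f \<subseteq> lattice_box m"
  shows "keys (f ^ n) \<subseteq> lattice_box (n * m)"
proof (induction n)
  case (Suc n)
  then show ?case using keys_mult_box[OF assms Suc] by simp
qed (simp add: lattice_box_def)

lemma keys_prod_box:
  fixes f :: "'i \<Rightarrow> (int ^ 'd) \<Rightarrow>\<^sub>0 complex"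
  assumes "finite I" "\<And>i. i \<in> I \<Longrightarrow> keys (f i) \<subseteq> lattice_box m"
  shows "keys (\<Prod>i\<in>I. f i) \<subseteq> lattice_box (card I * m)"
  using assms
proof (induction I rule: finite_induct)
  case (insert i I)
  then show ?case using keys_mult_box[of "f i" m "\<Prod>i\<in>I. f i" "card I * m"] by simp
qed (simp add: lattice_box_def)

lemma lattice_box_mono: "m \<le> n \<Longrightarrow> lattice_box m \<subseteq> lattice_box n"
  by (auto simp: lattice_box_def intro: order_trans)

lemma finite_subset_lattice_box:
  fixes S :: "(int ^ 'd) set"
  assumes "finite S"
  shows "\<exists>m. S \<subseteq> lattice_box m"
  using assms
proof induction
  case (insert u S)
  then obtain m where m: "S \<subseteq> lattice_box m" by blast
  define n where "n = Max (range (\<lambda>s. nat \<bar>u $ s\<bar>))"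
  have "nat \<bar>u $ s\<bar> \<le> n" for s unfolding n_def by (intro Max_ge) auto
  then have "u \<in> lattice_box n" by (auto simp: lattice_box_def nat_le_iff)
  then have "insert u S \<subseteq> lattice_box (max m n)"
    using m lattice_box_mono[of m "max m n"] lattice_box_mono[of n "max m n"] by auto
  then show ?case ..
qed auto

lemma toric_variety_sum:
  assumes p: "p \<in> toric_variety \<sigma>" and "\<And>i. i \<in> I \<Longrightarrow> f i \<in> carrier (coord_ring \<sigma>)"
  shows "(\<Sum>i\<in>I. f i) \<in> carrier (coord_ring \<sigma>) \<and> p (\<Sum>i\<in>I. f i) = (\<Sum>i\<in>I. p (f i))"
  using assms(2)
proof (induction I rule: infinite_finite_induct)
  case (insert i I)
  then have "f i + (\<Sum>i\<in>I. f i) \<in> carrier (coord_ring \<sigma>)"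
    using keys_add[of "f i" "\<Sum>i\<in>I. f i"] by (auto simp: carrier_coord_ring)
  then show ?case using insert toric_variety_add[OF p] by simp
qed (use p const_in_coord_ring[of 0 \<sigma>] in \<open>auto simp: toric_variety_zero_one\<close>)

lemma toric_variety_power:
  assumes p: "p \<in> toric_variety \<sigma>" and f: "f \<in> carrier (coord_ring \<sigma>)"
  shows "f ^ n \<in> carrier (coord_ring \<sigma>) \<and> p (f ^ n) = p f ^ n"
  using const_in_coord_ring[of 1 \<sigma>]
  by (induction n) (simp_all add: toric_variety_mult[OF p f] coord_ring_mult_closed[OF f] toric_variety_zero_one[OF p])

lemma toric_variety_prod:
  assumes p: "p \<in> toric_variety \<sigma>" and "\<And>i. i \<in> I \<Longrightarrow> f i \<in> carrier (coord_ring \<sigma>)"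
  shows "(\<Prod>i\<in>I. f i) \<in> carrier (coord_ring \<sigma>) \<and> p (\<Prod>i\<in>I. f i) = (\<Prod>i\<in>I. p (f i))"
  using assms(2) const_in_coord_ring[of 1 \<sigma>]
  by (induction I rule: infinite_finite_induct)
    (simp_all add: toric_variety_mult[OF p] coord_ring_mult_closed toric_variety_zero_one[OF p])

lemma lookup_single_zero_mult:
  fixes c :: "'c::comm_ring_1"
  shows "lookup (single 0 c * f) u = c * lookup f u"
  by (simp add: mult_map_scale_conv_mult[symmetric] map.rep_eq when_def)

text \<open>If l exceeded d = \<open>CARD('d)\<close>, the (D + 1)^l monomials in the
  \<open>b i\<close> with exponents at most D would outnumber the lattice points available to their
  terms, a box of side linear in D. The resulting linear relation contradicts
  \<open>chain_monomials_independent\<close>.\<close>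

lemma chain_length_le:
  fixes Z :: "nat \<Rightarrow> (((int ^ 'd) \<Rightarrow>\<^sub>0 complex) \<Rightarrow> complex) set"
  assumes Z: "\<And>i. i \<le> l \<Longrightarrow> closedin (zariski \<sigma>) (Z i) \<and> irreducible_in (zariski \<sigma>) (Z i)"
    and less: "\<And>i. i < l \<Longrightarrow> Z i \<subset> Z (Suc i)"
  shows "l \<le> CARD('d)"
proof (rule ccontr)
  assume "\<not> l \<le> CARD('d)"
  have ZX: "Z i \<subseteq> toric_variety \<sigma>" if "i \<le> l" for i
    using Z[OF that] closedin_subset by fastforce
  have "\<exists>f\<in>carrier (coord_ring \<sigma>). (\<forall>p\<in>Z i. p f = 0) \<and> (\<exists>p\<in>Z (Suc i). p f \<noteq> 0)" if i: "i < l" for i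
  proof -
    obtain F where F: "F \<subseteq> carrier (coord_ring \<sigma>)" "Z i = {p \<in> toric_variety \<sigma>. \<forall>f\<in>F. p f = 0}"
      using Z[of i] i unfolding closedin_zariski by auto
    obtain p where "p \<in> Z (Suc i)" "p \<notin> Z i" using less[OF i] by blast
    then show ?thesis using F ZX[of "Suc i"] i by fastforce
  qed
  then obtain b where b: "\<And>i. i < l \<Longrightarrow> b i \<in> carrier (coord_ring \<sigma>)"
      "\<And>i p. i < l \<Longrightarrow> p \<in> Z i \<Longrightarrow> p (b i) = 0"
      "\<And>i. i < l \<Longrightarrow> \<exists>p\<in>Z (Suc i). p (b i) \<noteq> 0"
    by metis
  have "finite (\<Union>i<l. keys (b i))" by simp
  then obtain B where "(\<Union>i<l. keys (b i)) \<subseteq> lattice_box B"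
    using finite_subset_lattice_box by blast
  then have B: "keys (b i) \<subseteq> lattice_box B" if "i < l" for i using that by blast
  \<comment> \<open>Large enough to absorb the constant: (2lDB + 1)^d \<le> (2lB + 1)^d (D + 1)^d =
    D (D + 1)^d < (D + 1)^(d + 1).\<close>
  define D where "D = (2 * l * B + 1) ^ CARD('d)"
  let ?I = "{..<l} \<rightarrow>\<^sub>E {..D}"
  have finI: "finite ?I" by (intro finite_PiE) auto
  define m where "m \<alpha> = (\<Prod>i<l. b i ^ \<alpha> i)" for \<alpha> :: "nat \<Rightarrow> nat"
  have keys_m: "keys (m \<alpha>) \<subseteq> lattice_box (l * (D * B))" if "\<alpha> \<in> ?I" for \<alpha>
  proof -
    have "keys (b i ^ \<alpha> i) \<subseteq> lattice_box (D * B)" if "i < l" for i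
      using keys_power_box[OF B[OF that], of "\<alpha> i"] lattice_box_mono[of "\<alpha> i * B" "D * B"] \<open>\<alpha> \<in> ?I\<close> that
      by (force simp: PiE_iff)
    then show ?thesis unfolding m_def using keys_prod_box[of "{..<l}" "\<lambda>i. b i ^ \<alpha> i" "D * B"] by simp
  qed
  have "card (lattice_box (l * (D * B)) :: (int ^ 'd) set) \<le> (2 * (l * (D * B)) + 1) ^ CARD('d)"
    by (rule lattice_box_finite_card(2))
  also have "\<dots> \<le> ((2 * l * B + 1) * (D + 1)) ^ CARD('d)"
    by (intro power_mono) (auto simp: algebra_simps)
  also have "\<dots> = D * (D + 1) ^ CARD('d)"
    unfolding power_mult_distrib by (simp only: D_def)
  also have "\<dots> < (D + 1) * (D + 1) ^ CARD('d)"
    by (intro mult_strict_right_mono) auto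
  also have "\<dots> = (D + 1) ^ Suc (CARD('d))" by simp
  also have "\<dots> \<le> (D + 1) ^ l"
    using \<open>\<not> l \<le> CARD('d)\<close> by (intro power_increasing) auto
  also have "\<dots> = card ?I" by (simp add: card_PiE)
  finally have card: "card (lattice_box (l * (D * B)) :: (int ^ 'd) set) < card ?I" .
  obtain c where c: "\<exists>\<alpha>\<in>?I. c \<alpha> \<noteq> 0"
      "\<forall>u\<in>lattice_box (l * (D * B)). (\<Sum>\<alpha>\<in>?I. c \<alpha> * lookup (m \<alpha>) u) = 0"
    using finite_linear_dependence[OF lattice_box_finite_card(1) finI card,
        of "\<lambda>u \<alpha>. lookup (m \<alpha>) u"] by blast
  have zero: "(\<Sum>\<alpha>\<in>?I. single 0 (c \<alpha>) * m \<alpha>) = 0"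
  proof (rule poly_mapping_eqI)
    fix u
    have "lookup (\<Sum>\<alpha>\<in>?I. single 0 (c \<alpha>) * m \<alpha>) u = (\<Sum>\<alpha>\<in>?I. c \<alpha> * lookup (m \<alpha>) u)"
      unfolding lookup_sum by (simp only: lookup_single_zero_mult)
    also have "\<dots> = 0"
    proof (cases "u \<in> lattice_box (l * (D * B))")
      case False
      then have "lookup (m \<alpha>) u = 0" if "\<alpha> \<in> ?I" for \<alpha>
        using keys_m[OF that] by (auto simp: in_keys_iff)
      then show ?thesis by (intro sum.neutral) simp
    qed (use c(2) in blast)
    finally show "lookup (\<Sum>\<alpha>\<in>?I. single 0 (c \<alpha>) * m \<alpha>) u = lookup 0 u"
      by simp
  qed
  have rel: "(\<Sum>\<alpha>\<in>?I. c \<alpha> * (\<Prod>i<l. p (b i) ^ \<alpha> i)) = 0" if "p \<in> Z l" for p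
  proof -
    have p: "p \<in> toric_variety \<sigma>" using ZX that by blast
    have m: "m \<alpha> \<in> carrier (coord_ring \<sigma>)" "p (m \<alpha>) = (\<Prod>i<l. p (b i) ^ \<alpha> i)" for \<alpha>
      unfolding m_def using toric_variety_prod[OF p, of "{..<l}" "\<lambda>i. b i ^ \<alpha> i"]
        toric_variety_power[OF p b(1)] by auto
    have "p (\<Sum>\<alpha>\<in>?I. single 0 (c \<alpha>) * m \<alpha>) = (\<Sum>\<alpha>\<in>?I. p (single 0 (c \<alpha>) * m \<alpha>))"
      by (intro conjunct2[OF toric_variety_sum[OF p]] coord_ring_mult_closed const_in_coord_ring m(1))
    also have "\<dots> = (\<Sum>\<alpha>\<in>?I. c \<alpha> * (\<Prod>i<l. p (b i) ^ \<alpha> i))"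
      by (simp add: toric_variety_mult[OF p const_in_coord_ring m(1)] toric_variety_const[OF p] m(2))
    finally show ?thesis using zero toric_variety_zero_one(1)[OF p] by simp
  qed
  have "c \<alpha> = 0" if "\<alpha> \<in> ?I" for \<alpha>
  proof (rule chain_monomials_independent[of l \<sigma> Z b c D])
    show "irreducible_in (zariski \<sigma>) (Z i) \<and> Z i \<subseteq> toric_variety \<sigma>" if "i \<le> l" for i
      using Z[OF that] ZX[OF that] by blast
    show "Z i \<subseteq> Z (Suc i)" if "i < l" for i using less[OF that] by blast
  qed (fact b rel that)+
  then show False using c(1) by blast
qed

lemma krull_dim_zariski_le: "krull_dim (zariski (\<sigma> :: (real ^ 'd) set)) \<le> enat (CARD('d))"
  unfolding krull_dim_def
proof (rule Sup_least)
  fix x assume "x \<in> {enat l |l. \<exists>Z. (\<forall>i\<le>l. closedin (zariski \<sigma>) (Z i) \<and> irreducible_in (zariski \<sigma>) (Z i)) \<and> (\<forall>i<l. Z i \<subset> Z (Suc i))}"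
  then obtain l Z where x: "x = enat l" and "\<forall>i\<le>l. closedin (zariski \<sigma>) (Z i) \<and> irreducible_in (zariski \<sigma>) (Z i)" "\<forall>i<l. Z i \<subset> Z (Suc i)"
    by blast
  then have "l \<le> CARD('d)" using chain_length_le[of l \<sigma> Z] by blast
  then show "x \<le> enat (CARD('d))" using x by simp
qed

text \<open>The torus point with coordinates exp (\<theta> s). The logarithmic parameter makes every
  regular function entire in \<theta>, as the identity theorem requires.\<close>

definition exp_point :: "(real ^ 'd) set \<Rightarrow> ('d \<Rightarrow> complex) \<Rightarrow> ((int ^ 'd) \<Rightarrow>\<^sub>0 complex) \<Rightarrow> complex" where
  "exp_point \<sigma> \<theta> = restrict (lin_sum (\<lambda>u c. c * exp (\<Sum>s\<in>UNIV. of_int (u $ s) * \<theta> s))) (carrier (coord_ring \<sigma>))"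

text \<open>A monoid homomorphism from the dual semigroup to the multiplicative monoid of complex
  numbers is a point of the variety; the value 0 is allowed, and nothing but
  additive-to-multiplicative behaviour on the semigroup is asked.\<close>

lemma toric_pointI:
  assumes e0: "e 0 = 1" and e: "\<And>u v. u \<in> dual_semigroup \<sigma> \<Longrightarrow> v \<in> dual_semigroup \<sigma> \<Longrightarrow> e (u + v) = e u * e v"
  shows "restrict (lin_sum (\<lambda>u c. c * e u)) (carrier (coord_ring \<sigma>)) \<in> toric_variety \<sigma>"
proof -
  let ?l = "lin_sum (\<lambda>u c. c * e u)"
  let ?p = "restrict ?l (carrier (coord_ring \<sigma>))"
  have add: "Modules.additive (\<lambda>c. c * e u)" for u by standard (simp add: algebra_simps)
  interpret L: additive "?l" by (rule additive_lin_sum) (rule add)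
  interpret cring "coord_ring \<sigma>" by (rule cring_coord_ring)
  have single: "?l (single 0 c) = c" for c
    using lin_sum_single[of "\<lambda>u c. c * e u" 0 c, OF add] e0 by simp
  have "?p \<in> ring_hom (coord_ring \<sigma>) complex_ring"
  proof (rule ring_hom_memI)
    fix f g assume fg: "f \<in> carrier (coord_ring \<sigma>)" "g \<in> carrier (coord_ring \<sigma>)"
    then show "?p (f \<oplus>\<^bsub>coord_ring \<sigma>\<^esub> g) =
      ?p f \<oplus>\<^bsub>complex_ring\<^esub> ?p g"
      using a_closed[OF fg] by (simp add: complex_ring_def) (simp add: coord_ring_def L.add)
    have "?l (f * g) = ?l f * ?l g"
      using fg by (intro lin_sum_mult[where S = "dual_semigroup \<sigma>"]) (auto simp: add e carrier_coord_ring)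
    then show "?p (f \<otimes>\<^bsub>coord_ring \<sigma>\<^esub> g) =
      ?p f \<otimes>\<^bsub>complex_ring\<^esub> ?p g"
      using m_closed[OF fg] fg by (simp add: complex_ring_def) (simp add: coord_ring_def)
  next
    show "?p \<one>\<^bsub>coord_ring \<sigma>\<^esub> = \<one>\<^bsub>complex_ring\<^esub>"
      using one_closed single[of 1] by (simp add: complex_ring_def) (simp add: coord_ring_def)
  qed (simp add: complex_ring_def)
  then show ?thesis
    by (simp add: toric_variety_def single const_in_coord_ring)
qed

lemma exp_point_in: "exp_point \<sigma> \<theta> \<in> toric_variety \<sigma>"
  unfolding exp_point_def
  by (rule toric_pointI) (simp_all add: algebra_simps sum.distrib exp_add)

lemma exp_point_apply:
  "f \<in> carrier (coord_ring \<sigma>) \<Longrightarrow> exp_point \<sigma> \<theta> f =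
    (\<Sum>u\<in>keys f. lookup f u * exp (\<Sum>s\<in>UNIV. of_int (u $ s) * \<theta> s))"
  by (simp add: exp_point_def lin_sum_def)

text \<open>The Zariski closure of the subtorus whose coordinates outside \<open>S\<close> are
  1.\<close>

definition subtorus_closure :: "(real ^ 'd) set \<Rightarrow> 'd set \<Rightarrow> (((int ^ 'd) \<Rightarrow>\<^sub>0 complex) \<Rightarrow> complex) set" where
  "subtorus_closure \<sigma> S = {p \<in> toric_variety \<sigma>. \<forall>f\<in>carrier (coord_ring \<sigma>).
     (\<forall>\<theta>. (\<forall>s. s \<notin> S \<longrightarrow> \<theta> s = 0) \<longrightarrow> exp_point \<sigma> \<theta> f = 0) \<longrightarrow> p f = 0}"

lemma closedin_subtorus_closure: "closedin (zariski \<sigma>) (subtorus_closure \<sigma> S)"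
  unfolding closedin_zariski subtorus_closure_def
  by (intro exI[of _ "{f \<in> carrier (coord_ring \<sigma>). \<forall>\<theta>. (\<forall>s. s \<notin> S \<longrightarrow> \<theta> s = 0) \<longrightarrow> exp_point \<sigma> \<theta> f = 0}"]) auto

lemma exp_point_subtorus: "(\<And>s. s \<notin> S \<Longrightarrow> \<theta> s = 0) \<Longrightarrow> exp_point \<sigma> \<theta> \<in> subtorus_closure \<sigma> S"
  by (simp add: subtorus_closure_def exp_point_in)

text \<open>Two points of the torus are joined by the image of an entire curve, so the identity theorem
  excludes that a product of two nonzero regular functions vanishes.\<close>

lemma irreducible_subtorus_closure: "irreducible_in (zariski \<sigma>) (subtorus_closure \<sigma> S)"
  unfolding irreducible_in_def
proof (intro conjI allI impI)
  show "subtorus_closure \<sigma> S \<noteq> {}" using exp_point_subtorus[of S "\<lambda>_. 0"] by blast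
  fix A B assume AB: "closedin (zariski \<sigma>) A \<and> closedin (zariski \<sigma>) B \<and> subtorus_closure \<sigma> S \<subseteq> A \<union> B"
  have wit: "\<exists>f\<in>carrier (coord_ring \<sigma>). (\<forall>p\<in>C. p f = 0) \<and> (\<exists>\<theta>. (\<forall>s. s \<notin> S \<longrightarrow> \<theta> s = 0) \<and> exp_point \<sigma> \<theta> f \<noteq> 0)"
    if C: "closedin (zariski \<sigma>) C" "\<not> subtorus_closure \<sigma> S \<subseteq> C" for C
  proof -
    obtain F where F: "F \<subseteq> carrier (coord_ring \<sigma>)" "C = {p \<in> toric_variety \<sigma>. \<forall>f\<in>F. p f = 0}"
      using C(1) unfolding closedin_zariski by (elim exE conjE) (rule that)
    obtain p where p: "p \<in> subtorus_closure \<sigma> S" "p \<notin> C" using C(2) by blast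
    then obtain f where f: "f \<in> F" "p f \<noteq> 0" using F by (auto simp: subtorus_closure_def)
    have "\<not> (\<forall>\<theta>. (\<forall>s. s \<notin> S \<longrightarrow> \<theta> s = 0) \<longrightarrow> exp_point \<sigma> \<theta> f = 0)"
    proof
      assume "\<forall>\<theta>. (\<forall>s. s \<notin> S \<longrightarrow> \<theta> s = 0) \<longrightarrow> exp_point \<sigma> \<theta> f = 0"
      moreover have "f \<in> carrier (coord_ring \<sigma>)" using f F(1) by blast
      ultimately show False using p(1) f(2) by (simp add: subtorus_closure_def)
    qed
    then show ?thesis using f F by blast
  qed
  show "subtorus_closure \<sigma> S \<subseteq> A \<or> subtorus_closure \<sigma> S \<subseteq> B"
  proof (rule ccontr)
    assume "\<not> ?thesis"
    then have nA: "\<not> subtorus_closure \<sigma> S \<subseteq> A" and nB: "\<not> subtorus_closure \<sigma> S \<subseteq> B" by auto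
    obtain f \<theta>\<^sub>1 where f: "f \<in> carrier (coord_ring \<sigma>)" "\<forall>p\<in>A. p f = 0"
      "\<forall>s. s \<notin> S \<longrightarrow> \<theta>\<^sub>1 s = 0" "exp_point \<sigma> \<theta>\<^sub>1 f \<noteq> 0" using wit[OF _ nA] AB by blast
    obtain g \<theta>\<^sub>2 where g: "g \<in> carrier (coord_ring \<sigma>)" "\<forall>p\<in>B. p g = 0"
      "\<forall>s. s \<notin> S \<longrightarrow> \<theta>\<^sub>2 s = 0" "exp_point \<sigma> \<theta>\<^sub>2 g \<noteq> 0" using wit[OF _ nB] AB by blast
    define \<theta> where "\<theta> z s = (1 - z) * \<theta>\<^sub>1 s + z * \<theta>\<^sub>2 s" for z s
    have \<theta>01: "\<theta> 0 = \<theta>\<^sub>1" "\<theta> 1 = \<theta>\<^sub>2" by (simp_all add: \<theta>_def fun_eq_iff)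
    have hol: "(\<lambda>z. exp_point \<sigma> (\<theta> z) h) holomorphic_on UNIV" if "h \<in> carrier (coord_ring \<sigma>)" for h
      unfolding exp_point_apply[OF that] \<theta>_def by (intro holomorphic_intros)
    have prod0: "exp_point \<sigma> (\<theta> z) f = 0 \<or> exp_point \<sigma> (\<theta> z) g = 0" for z
    proof -
      have "exp_point \<sigma> (\<theta> z) \<in> subtorus_closure \<sigma> S"
        using f(3) g(3) by (intro exp_point_subtorus) (simp add: \<theta>_def)
      then show ?thesis using AB f(2) g(2) by blast
    qed
    have "isCont (\<lambda>z. exp_point \<sigma> (\<theta> z) f) 0"
      using holomorphic_on_imp_continuous_on[OF hol[OF f(1)]] by (simp add: continuous_on_eq_continuous_at)
    moreover have "exp_point \<sigma> (\<theta> 0) f \<noteq> 0" using f(4) by (simp add: \<theta>01)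
    \<comment> \<open>\<open>f\<close> stays nonzero near the start of the curve, so
      \<open>g\<close> vanishes on a ball, hence along the whole curve and at its end
      \<open>\<theta>\<^sub>2\<close>.\<close>
    ultimately obtain e where e: "e > 0" "\<And>z. dist 0 z < e \<Longrightarrow> exp_point \<sigma> (\<theta> z) f \<noteq> 0"
      using continuous_at_avoid[of 0 "\<lambda>z. exp_point \<sigma> (\<theta> z) f" 0] by auto
    have "exp_point \<sigma> (\<theta> 1) g = 0"
    proof (rule analytic_continuation[OF hol[OF g(1)], of "ball 0 e" 0])
      show "0 islimpt ball (0::complex) e" using e(1) by (simp add: islimpt_ball)
      show "exp_point \<sigma> (\<theta> z) g = 0" if "z \<in> ball 0 e" for z
        using prod0[of z] e(2)[of z] that by auto
    qed auto
    then show False using g(4) by (simp add: \<theta>01)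
  qed
qed

lemma subtorus_closure_mono: "S \<subseteq> T \<Longrightarrow> subtorus_closure \<sigma> S \<subseteq> subtorus_closure \<sigma> T"
  unfolding subtorus_closure_def by blast

text \<open>The torus coordinate s need not be regular, so it is multiplied by the character of
  \<open>w\<close>: \<open>f\<close> is that character times (coordinate s minus 1). It vanishes on
  the smaller subtorus, but not at the point of the larger one whose coordinate s is exp (i pi) =
  -1.\<close>

lemma subtorus_closure_strict_mono:
  assumes w: "w \<in> dual_semigroup \<sigma>" "w + axis s 1 \<in> dual_semigroup \<sigma>" and s: "s \<notin> S"
  shows "subtorus_closure \<sigma> S \<noteq> subtorus_closure \<sigma> (insert s S)"
proof -
  define f :: "(int ^ 'a) \<Rightarrow>\<^sub>0 complex" where
    "f = single (w + axis s 1) 1 - single w 1"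
  have f: "f \<in> carrier (coord_ring \<sigma>)"
    using w keys_diff[of "single (w + axis s 1) (1::complex)" "single w 1"]
    by (auto simp: f_def carrier_coord_ring)
  have add: "Modules.additive (\<lambda>c. c * exp (\<Sum>s\<in>UNIV. of_int (u $ s) * \<theta> s))" for u :: "int ^ 'a" and \<theta> :: "'a \<Rightarrow> complex"
    by standard (simp add: algebra_simps)
  have ax: "(\<Sum>s'\<in>UNIV. of_int (axis s 1 $ s') * \<theta> s') = (\<theta> s :: complex)" for \<theta>
  proof -
    have "(\<Sum>s'\<in>UNIV. of_int (axis s 1 $ s') * \<theta> s') = (\<Sum>s'\<in>UNIV. if s' = s then \<theta> s else 0)"
      by (intro sum.cong) (auto simp: axis_def)
    then show ?thesis by simp
  qed
  have ev: "exp_point \<sigma> \<theta> f = exp (\<Sum>s\<in>UNIV. of_int (w $ s) * \<theta> s) * (exp (\<theta> s) - 1)" for \<theta>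
  proof -
    have "exp_point \<sigma> \<theta> f = lin_sum (\<lambda>u c. c * exp (\<Sum>s\<in>UNIV. of_int (u $ s) * \<theta> s)) f"
      using f by (simp add: exp_point_def)
    also have "\<dots> = exp (\<Sum>s'\<in>UNIV. of_int ((w + axis s 1) $ s') * \<theta> s') - exp (\<Sum>s\<in>UNIV. of_int (w $ s) * \<theta> s)"
      unfolding f_def additive.diff[OF additive_lin_sum[OF add]] lin_sum_single[OF add] by simp
    also have "(\<Sum>s'\<in>UNIV. of_int ((w + axis s 1) $ s') * \<theta> s') = (\<Sum>s\<in>UNIV. of_int (w $ s) * \<theta> s) + \<theta> s"
      using ax[of \<theta>] by (simp add: algebra_simps sum.distrib)
    finally show ?thesis by (simp add: exp_add algebra_simps)
  qed
  define \<theta>\<^sub>0 where "\<theta>\<^sub>0 = (\<lambda>s'. if s' = s then \<i> * pi else 0)"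
  have "exp_point \<sigma> \<theta>\<^sub>0 f \<noteq> 0" by (simp add: ev \<theta>\<^sub>0_def)
  moreover have "exp_point \<sigma> \<theta> f = 0" if "\<forall>s. s \<notin> S \<longrightarrow> \<theta> s = 0" for \<theta>
    using that s by (simp add: ev)
  ultimately have "exp_point \<sigma> \<theta>\<^sub>0 \<notin> subtorus_closure \<sigma> S"
    using f unfolding subtorus_closure_def by blast
  moreover have "exp_point \<sigma> \<theta>\<^sub>0 \<in> subtorus_closure \<sigma> (insert s S)"
    by (rule exp_point_subtorus) (simp add: \<theta>\<^sub>0_def)
  ultimately show ?thesis by metis
qed

text \<open>The chain has \<open>CARD('d) + 1\<close> members, from the closure of the unit point to
  the closure of the full torus; each step sets one more torus coordinate free.\<close>

theorem krull_dim_zariski: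
  fixes \<sigma> :: "(real ^ 'd) set"
  assumes w: "w \<in> dual_semigroup \<sigma>" "\<And>s. w + axis s 1 \<in> dual_semigroup \<sigma>"
  shows "krull_dim (zariski \<sigma>) = enat (CARD('d))"
proof (rule antisym[OF krull_dim_zariski_le])
  obtain idx :: "'d \<Rightarrow> nat" where idx: "bij_betw idx UNIV {0..<CARD('d)}"
    using ex_bij_betw_finite_nat[of "UNIV :: 'd set"] by auto
  define Z where "Z i = subtorus_closure \<sigma> {s. idx s < i}" for i
  have "Z i \<subset> Z (Suc i)" if "i < CARD('d)" for i
  proof -
    have "i \<in> range idx" using idx \<open>i < CARD('d)\<close> by (simp add: bij_betw_def)
    then obtain s where s: "idx s = i" by blast
    have "idx s' = i \<longleftrightarrow> s' = s" for s' using idx s by (auto simp: bij_betw_def inj_on_def)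
    then have "{s. idx s < Suc i} = insert s {s. idx s < i}"
      by (auto simp: less_Suc_eq)
    then show ?thesis
      using subtorus_closure_strict_mono[OF w, of s "{s. idx s < i}"] subtorus_closure_mono[of "{s. idx s < i}" "{s. idx s < Suc i}" \<sigma>] s
      by (auto simp: Z_def)
  qed
  then have "enat (CARD('d)) \<in> {enat l |l. \<exists>Z. (\<forall>i\<le>l. closedin (zariski \<sigma>) (Z i) \<and> irreducible_in (zariski \<sigma>) (Z i)) \<and> (\<forall>i<l. Z i \<subset> Z (Suc i))}"
    by (intro CollectI exI[of _ "CARD('d)"] conjI refl exI[of _ Z] allI impI)
      (simp_all add: Z_def closedin_subtorus_closure irreducible_subtorus_closure)
  then show "enat (CARD('d)) \<le> krull_dim (zariski \<sigma>)"
    unfolding krull_dim_def by (rule Sup_upper)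
qed

section \<open>Topological invariance of the Krull dimension\<close>

lemma irreducible_in_homeomorphic_image:
  assumes h: "homeomorphic_map S T h" and Z: "irreducible_in S Z" "Z \<subseteq> topspace S"
  shows "irreducible_in T (h ` Z)"
  unfolding irreducible_in_def
proof (intro conjI allI impI)
  show "h ` Z \<noteq> {}" using Z by (simp add: irreducible_in_def)
  fix A B assume AB: "closedin T A \<and> closedin T B \<and> h ` Z \<subseteq> A \<union> B"
  have cont: "continuous_map S T h" using h by (rule homeomorphic_imp_continuous_map)
  have sub: "Z \<subseteq> {x \<in> topspace S. h x \<in> A} \<union> {x \<in> topspace S. h x \<in> B}" using AB Z(2) by auto
  have "Z \<subseteq> {x \<in> topspace S. h x \<in> A} \<or> Z \<subseteq> {x \<in> topspace S. h x \<in> B}"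
    by (rule Z(1)[unfolded irreducible_in_def, THEN conjunct2, rule_format])
      (intro conjI closedin_continuous_map_preimage[OF cont] sub; use AB in blast)
  then show "h ` Z \<subseteq> A \<or> h ` Z \<subseteq> B" by blast
qed

lemma krull_dim_le_homeomorphic:
  assumes h: "homeomorphic_map S T h"
  shows "krull_dim S \<le> krull_dim T"
  unfolding krull_dim_def
proof (rule Sup_subset_mono, rule subsetI)
  fix x assume "x \<in> {enat l |l. \<exists>Z. (\<forall>i\<le>l. closedin S (Z i) \<and> irreducible_in S (Z i)) \<and> (\<forall>i<l. Z i \<subset> Z (Suc i))}"
  then obtain l Z where x: "x = enat l" and Z: "\<And>i. i \<le> l \<Longrightarrow> closedin S (Z i)"
      "\<And>i. i \<le> l \<Longrightarrow> irreducible_in S (Z i)" and less: "\<And>i. i < l \<Longrightarrow> Z i \<subset> Z (Suc i)"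
    by blast
  have sub: "Z i \<subseteq> topspace S" if "i \<le> l" for i using Z(1)[OF that] closedin_subset by blast
  have "closedin T (h ` Z i)" if "i \<le> l" for i
    using homeomorphic_map_closedness_eq[OF h] Z(1)[OF that] by blast
  moreover have "irreducible_in T (h ` Z i)" if "i \<le> l" for i
    using irreducible_in_homeomorphic_image[OF h Z(2)[OF that] sub[OF that]] .
  moreover have "h ` Z i \<subset> h ` Z (Suc i)" if "i < l" for i
  proof -
    have "inj_on h (topspace S)" using h by (rule homeomorphic_imp_injective_map)
    then have "inj_on h (Z (Suc i))" using sub[of "Suc i"] that inj_on_subset by fastforce
    then show ?thesis using less[OF that] by (metis image_strict_mono)
  qed
  ultimately show "x \<in> {enat l |l. \<exists>Z. (\<forall>i\<le>l. closedin T (Z i) \<and> irreducible_in T (Z i)) \<and> (\<forall>i<l. Z i \<subset> Z (Suc i))}"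
    using x by (intro CollectI exI[of _ l] conjI exI[of _ "\<lambda>i. h ` Z i"]) auto
qed

lemma krull_dim_homeomorphic_space:
  assumes "S homeomorphic_space T"
  shows "krull_dim S = krull_dim T"
proof (rule antisym)
  show "krull_dim S \<le> krull_dim T"
    using assms krull_dim_le_homeomorphic by (auto simp: homeomorphic_space)
  show "krull_dim T \<le> krull_dim S"
    using assms homeomorphic_space_sym[of S T] krull_dim_le_homeomorphic by (auto simp: homeomorphic_space)
qed

section \<open>Rational polyhedra and cones\<close>

lemma real_vec_simps [simp]:
  "real_vec v $ i = of_int (v $ i)" "real_vec 0 = 0"
  "real_vec (u + v) = real_vec u + real_vec v" "real_vec (u - v) = real_vec u - real_vec v"
  "real_vec (- v) = - real_vec v" "real_vec (c *s v) = of_int c *\<^sub>R real_vec v"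
  by (simp_all add: real_vec_def vec_eq_iff)

lemma real_vec_eq_iff [simp]: "real_vec u = real_vec v \<longleftrightarrow> u = v"
  by (simp add: vec_eq_iff)

lemma real_vec_eq_0_iff [simp]: "real_vec u = 0 \<longleftrightarrow> u = 0"
  by (simp add: vec_eq_iff)

lemma real_vec_inner: "real_vec u \<bullet> real_vec v = of_int (scalar_product u v)"
  by (simp add: inner_vec_def scalar_product_def)

lemma scalar_product_linear:
  "scalar_product (u + u') v = scalar_product u v + scalar_product u' (v :: int ^ 'd)"
  "scalar_product (u - u') v = scalar_product u v - scalar_product u' (v :: int ^ 'd)"
  "scalar_product (- u) v = - scalar_product u (v :: int ^ 'd)"
  "scalar_product (c *s u) v = c * scalar_product u (v :: int ^ 'd)"
  "scalar_product 0 v = 0"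
  by (simp_all add: scalar_product_def algebra_simps sum.distrib sum_subtractf sum_distrib_left sum_negf)

text \<open>The separating threshold b is negative, as 0 lies in C. A point of C with negative value
  could be scaled to have value exactly b, against strictness; so the threshold can be raised to
  0.\<close>

lemma closed_convex_cone_separate:
  fixes C :: "'a::euclidean_space set"
  assumes "convex_cone C" "closed C" "x \<notin> C"
  shows "\<exists>a. (\<forall>y\<in>C. 0 \<le> a \<bullet> y) \<and> a \<bullet> x < 0"
proof -
  have "convex C" using assms(1) by (simp add: convex_cone_def)
  then obtain a b where ab: "a \<bullet> x < b" "\<forall>y\<in>C. b < a \<bullet> y"
    using separating_hyperplane_closed_point[of C x] assms by blast
  have "b < 0" using ab(2) convex_cone_contains_0[OF assms(1)] by force
  have "0 \<le> a \<bullet> y" if "y \<in> C" for y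
  proof (rule ccontr)
    assume "\<not> 0 \<le> a \<bullet> y"
    then have "(b / (a \<bullet> y)) *\<^sub>R y \<in> C"
      using \<open>b < 0\<close> that by (intro convex_cone_scaleR assms(1)) (auto simp: divide_nonpos_nonpos)
    then have "b < b" using ab(2) \<open>\<not> 0 \<le> a \<bullet> y\<close> by force
    then show False by simp
  qed
  then show ?thesis using ab(1) \<open>b < 0\<close> by (intro exI[of _ a]) auto
qed

text \<open>A functional separating v from C would become negative far out on the ray; the parameter
  in the proof gives it the value -1.\<close>

lemma ray_in_closed_convex_cone:
  fixes C :: "'a::euclidean_space set"
  assumes C: "convex_cone C" "closed C" and ray: "\<And>t. t \<ge> 0 \<Longrightarrow> x + t *\<^sub>R v \<in> C"
  shows "v \<in> C"
proof (rule ccontr)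
  assume "v \<notin> C"
  then obtain a where a: "\<And>y. y \<in> C \<Longrightarrow> 0 \<le> a \<bullet> y" "a \<bullet> v < 0"
    using closed_convex_cone_separate[OF C] by blast
  have "a \<bullet> x \<ge> 0" using a(1)[OF ray[of 0]] by simp
  then have "0 \<le> a \<bullet> (x + ((a \<bullet> x + 1) / - (a \<bullet> v)) *\<^sub>R v)"
    using a(2) by (intro a(1) ray) (simp add: divide_nonneg_neg)
  also have "\<dots> = - 1" using a(2) by (simp add: inner_add_right inner_diff_right field_simps)
  finally show False by simp
qed

text \<open>Among the points at which the functional does not exceed its value at the start,
  one with the largest number of active constraints is extreme: otherwise one could move along a
  segment through it until a further constraint becomes active.\<close>

lemma extreme_point_minorizes:
  fixes H :: "('a::euclidean_space \<times> real) set"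
  assumes H: "finite H" and Q: "Q = {x. \<forall>(a, b)\<in>H. a \<bullet> x \<le> b}" and x: "x \<in> Q"
    and noline: "\<And>y v. (\<And>t. y + t *\<^sub>R v \<in> Q) \<Longrightarrow> v = 0"
    and recession: "\<And>y v. (\<And>t. t \<ge> 0 \<Longrightarrow> y + t *\<^sub>R v \<in> Q) \<Longrightarrow> 0 \<le> m \<bullet> v"
  shows "\<exists>q. q extreme_point_of Q \<and> m \<bullet> q \<le> m \<bullet> x"
proof -
  define tight where "tight y = {h \<in> H. fst h \<bullet> y = snd h}" for y
  have inQ: "y \<in> Q \<longleftrightarrow> (\<forall>h\<in>H. fst h \<bullet> y \<le> snd h)" for y by (auto simp: Q)
  have fin: "finite (tight y)" for y using H by (simp add: tight_def)
  have "\<exists>y. (y \<in> Q \<and> m \<bullet> y \<le> m \<bullet> x) \<and> (\<forall>z. z \<in> Q \<and> m \<bullet> z \<le> m \<bullet> x \<longrightarrow> card (tight z) \<le> card (tight y))"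
    using x H by (intro ex_has_greatest_nat[of _ x _ "Suc (card H)"]) (auto simp: tight_def card_mono less_Suc_eq_le)
  then obtain y where y: "y \<in> Q" "m \<bullet> y \<le> m \<bullet> x"
    and max: "\<And>z. z \<in> Q \<Longrightarrow> m \<bullet> z \<le> m \<bullet> x \<Longrightarrow> card (tight z) \<le> card (tight y)" by blast
  have stays: "y + t *\<^sub>R v \<in> Q"
    if v: "\<And>h. h \<in> tight y \<Longrightarrow> fst h \<bullet> v = 0" "m \<bullet> v \<le> 0" and t: "t \<ge> 0" for v t
  proof (rule ccontr)
    assume "y + t *\<^sub>R v \<notin> Q"
    then obtain h0 where h0: "h0 \<in> H" "fst h0 \<bullet> (y + t *\<^sub>R v) > snd h0" by (auto simp: inQ not_le)
    define K where "K = {h \<in> H. fst h \<bullet> v > 0}"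
    have "fst h0 \<bullet> y \<le> snd h0" using y(1) h0(1) inQ by blast
    then have "t * (fst h0 \<bullet> v) > 0" using h0(2) by (simp add: inner_add_right)
    then have "h0 \<in> K" using h0(1) t by (simp add: K_def zero_less_mult_iff)
    then have K: "finite K" "K \<noteq> {}" using H by (simp add: K_def, blast)
    \<comment> \<open>The parameter at which constraint h becomes active on the ray. The least one,
      at k, marks the point where the ray leaves Q, and there one more constraint is tight.\<close>
    define r where "r h = (snd h - fst h \<bullet> y) / (fst h \<bullet> v)" for h
    obtain k where k: "k \<in> K" "\<And>h. h \<in> K \<Longrightarrow> r k \<le> r h"
      using ex_min_if_finite[of "r ` K"] K by (metis (no_types, lifting) finite_imageI image_iff image_is_empty linorder_le_less_linear)
    have r0: "r k \<ge> 0" using k(1) y(1) by (auto simp: r_def K_def inQ)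
    define z where "z = y + r k *\<^sub>R v"
    have zQ: "z \<in> Q"
      unfolding inQ
    proof
      fix h assume h: "h \<in> H"
      show "fst h \<bullet> z \<le> snd h"
      proof (cases "h \<in> K")
        case True
        then have "r k \<le> (snd h - fst h \<bullet> y) / (fst h \<bullet> v)" "fst h \<bullet> v > 0"
          using k(2) by (auto simp: r_def[symmetric] K_def)
        then show ?thesis by (simp add: z_def inner_add_right field_simps)
      next
        case False
        then have "r k * (fst h \<bullet> v) \<le> 0" using h r0 by (simp add: K_def mult_nonneg_nonpos)
        moreover have "fst h \<bullet> y \<le> snd h" using y(1) h inQ by blast
        ultimately show ?thesis by (simp add: z_def inner_add_right)
      qed
    qed
    have "tight y \<subseteq> tight z" using v(1) by (auto simp: tight_def z_def inner_add_right)
    moreover have "k \<in> tight z" "k \<notin> tight y"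
      using k(1) v(1)[of k] by (auto simp: tight_def z_def inner_add_right r_def K_def)
    ultimately have "card (tight y) < card (tight z)"
      by (intro psubset_card_mono fin) blast
    moreover have "m \<bullet> z \<le> m \<bullet> x"
      using y(2) mult_nonneg_nonpos[OF r0 v(2)] by (simp add: z_def inner_add_right)
    ultimately show False using max[OF zQ] by simp
  qed
  have "y extreme_point_of Q"
  proof (rule ccontr)
    assume "\<not> y extreme_point_of Q"
    then obtain a b where ab: "a \<in> Q" "b \<in> Q" "y \<in> open_segment a b"
      using y(1) by (auto simp: extreme_point_of_def)
    then obtain u where u: "a \<noteq> b" "0 < u" "u < 1" "y = (1 - u) *\<^sub>R a + u *\<^sub>R b"
      by (auto simp: in_segment)
    have orth: "fst h \<bullet> (b - a) = 0" if "h \<in> tight y" for h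
    proof -
      have h: "fst h \<bullet> a \<le> snd h" "fst h \<bullet> b \<le> snd h" "fst h \<bullet> y = snd h"
        using that ab by (auto simp: tight_def inQ)
      have "(1 - u) * (snd h - fst h \<bullet> a) + u * (snd h - fst h \<bullet> b) = 0"
        using h(3) by (simp add: u(4) inner_add_right algebra_simps)
      then have "(1 - u) * (snd h - fst h \<bullet> a) = 0" "u * (snd h - fst h \<bullet> b) = 0"
        using h(1,2) u(2,3) by (simp_all add: add_nonneg_eq_0_iff)
      then show ?thesis using u by (simp add: inner_diff_right)
    qed
    \<comment> \<open>The sign makes m nonincreasing along v. Then \<open>stays\<close> keeps the
      ray in Q, \<open>recession\<close> makes m constant along v, and so the opposite ray stays in
      Q too: a line, excluded by \<open>noline\<close>.\<close>
    define v where "v = (if m \<bullet> (b - a) \<le> 0 then b - a else a - b)"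
    have v: "m \<bullet> v \<le> 0" "\<And>h. h \<in> tight y \<Longrightarrow> fst h \<bullet> v = 0" "v \<noteq> 0"
      using orth u(1) by (auto simp: v_def inner_diff_right)
    have fwd: "y + t *\<^sub>R v \<in> Q" if "t \<ge> 0" for t using stays[OF v(2) v(1) that] .
    then have "m \<bullet> v = 0" using recession v(1) by force
    then have bwd: "y + t *\<^sub>R (- v) \<in> Q" if "t \<ge> 0" for t
      using v(2) that by (intro stays) auto
    have "y + t *\<^sub>R v \<in> Q" for t
      using fwd[of t] bwd[of "- t"] by (cases "t \<ge> 0") auto
    then show False using noline v(3) by blast
  qed
  then show ?thesis using y(2) by blast
qed

text \<open>A \<open>\<rat>\<close>-linear retraction of \<open>\<real>\<close> onto \<open>\<rat>\<close> maps a real solution of a rational linear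
  system to a rational solution; hence a unique solution is rational.\<close>

lemma rational_retraction:
  "\<exists>g :: real \<Rightarrow> real. (\<forall>x y. g (x + y) = g x + g y) \<and> (\<forall>r\<in>\<rat>. \<forall>x. g (r * x) = r * g x) \<and>
     (\<forall>r\<in>\<rat>. g r = r) \<and> (\<forall>x. g x \<in> \<rat>)"
proof -
  interpret vector_space_pair "\<lambda>(r::rat) (x::real). of_rat r * x" "(*) :: rat \<Rightarrow> rat \<Rightarrow> rat"
    by unfold_locales (simp_all add: algebra_simps of_rat_add of_rat_mult)
  have "vs1.independent {1}" by (simp add: vs1.independent_insert)
  then obtain g where g: "Vector_Spaces.linear (\<lambda>(r::rat) (x::real). of_rat r * x) (*) g" "g 1 = (1::rat)"
    using linear_independent_extend[of "{1}" "\<lambda>_. 1"] by auto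
  interpret g: Vector_Spaces.linear "\<lambda>(r::rat) (x::real). of_rat r * x" "(*) :: rat \<Rightarrow> rat \<Rightarrow> rat" g
    by (rule g(1))
  have scale: "g (of_rat r * x) = r * g x" for r x by (rule g.scale)
  have "g (of_rat r) = r" for r using scale[of r 1] g(2) by simp
  then show ?thesis
    by (intro exI[of _ "\<lambda>x. of_rat (g x)"]) (auto simp: Rats_def g.add of_rat_add scale of_rat_mult)
qed

text \<open>The retraction applied to the coordinates of q gives a rational point q' at which the
  constraints active at q hold with equality again. Hence Q contains a small segment around q in the
  direction q' - q, and extremality forces q' = q.\<close>

lemma extreme_point_rational:
  fixes H :: "((real ^ 'd) \<times> real) set"
  assumes H: "finite H" and Q: "Q = {x. \<forall>(a, b)\<in>H. a \<bullet> x \<le> b}"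
    and rat: "\<forall>(a, b)\<in>H. (\<forall>i. a $ i \<in> \<rat>) \<and> b \<in> \<rat>" and q: "q extreme_point_of Q"
  shows "q $ i \<in> \<rat>"
proof -
  obtain g :: "real \<Rightarrow> real" where g: "\<And>x y. g (x + y) = g x + g y" "\<And>r x. r \<in> \<rat> \<Longrightarrow> g (r * x) = r * g x"
    "\<And>r. r \<in> \<rat> \<Longrightarrow> g r = r" "\<And>x. g x \<in> \<rat>"
    using rational_retraction by metis
  have inQ: "y \<in> Q \<longleftrightarrow> (\<forall>h\<in>H. fst h \<bullet> y \<le> snd h)" for y by (auto simp: Q)
  have g_sum: "g (\<Sum>i\<in>I. f i) = (\<Sum>i\<in>I. g (f i))" if "finite I" for I and f :: "'d \<Rightarrow> real"
    using that by induction (use g(1) g(3)[of 0] in auto)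
  define q' where "q' = (\<chi> i. g (q $ i))"
  define v where "v = q' - q"
  have qQ: "q \<in> Q" using q by (simp add: extreme_point_of_def)
  have orth: "fst h \<bullet> v = 0" if h: "h \<in> H" "fst h \<bullet> q = snd h" for h
  proof -
    have r: "fst h $ i \<in> \<rat>" "snd h \<in> \<rat>" for i using rat h(1) by auto
    have "fst h \<bullet> q' = g (fst h \<bullet> q)"
      by (simp add: inner_vec_def g_sum g(2)[OF r(1)] q'_def)
    then show ?thesis using h(2) g(3)[OF r(2)] by (simp add: v_def inner_diff_right)
  qed
  have ev: "\<forall>\<^sub>F e in at_right (0::real). fst h \<bullet> (q + e *\<^sub>R w) \<le> snd h"
    if h: "h \<in> H" and w: "w = v \<or> w = - v" for h w
  proof (cases "fst h \<bullet> q = snd h")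
    case True
    then show ?thesis using orth[OF h] w by (auto simp: inner_add_right)
  next
    case False
    then have "fst h \<bullet> q < snd h" using qQ h by (force simp: inQ)
    have "((\<lambda>e. fst h \<bullet> (q + e *\<^sub>R w)) \<longlongrightarrow> fst h \<bullet> (q + 0 *\<^sub>R w)) (at_right 0)"
      by (intro tendsto_intros)
    then have "\<forall>\<^sub>F e in at_right 0. fst h \<bullet> (q + e *\<^sub>R w) < snd h"
      using \<open>fst h \<bullet> q < snd h\<close> by (intro order_tendstoD(2)) simp_all
    then show ?thesis by eventually_elim simp
  qed
  have evQ: "\<forall>\<^sub>F e in at_right (0::real). q + e *\<^sub>R w \<in> Q" if w: "w = v \<or> w = - v" for w
    unfolding inQ using ev[OF _ w] by (intro eventually_ball_finite H) blast
  have "\<forall>\<^sub>F e in at_right (0::real). q + e *\<^sub>R v \<in> Q \<and> q + e *\<^sub>R (- v) \<in> Q \<and> 0 < e"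
    using evQ[of v] evQ[of "- v"] by (intro eventually_conj eventually_at_right_less) simp_all
  then obtain e :: real where e: "q + e *\<^sub>R v \<in> Q" "q + e *\<^sub>R (- v) \<in> Q" "0 < e"
    using eventually_happens'[OF trivial_limit_at_right_real] by blast
  have "v = 0"
  proof (rule ccontr)
    assume "v \<noteq> 0"
    have "q = (1 - 1/2) *\<^sub>R (q + e *\<^sub>R v) + (1/2) *\<^sub>R (q + e *\<^sub>R (- v))"
      by (simp add: algebra_simps flip: scaleR_add_left)
    moreover have "q + e *\<^sub>R v \<noteq> q + e *\<^sub>R (- v)"
      using \<open>v \<noteq> 0\<close> e(3) by (simp add: eq_neg_iff_add_eq_0 flip: scaleR_2)
    ultimately have "q \<in> open_segment (q + e *\<^sub>R v) (q + e *\<^sub>R (- v))"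
      unfolding in_segment by (intro conjI exI[of _ "1/2"]) auto
    then show False using q e by (simp add: extreme_point_of_def)
  qed
  then have "q = q'" by (simp add: v_def)
  then show ?thesis using g(4) by (metis q'_def vec_lambda_beta)
qed

text \<open>A segment through \<open>p j\<close> inside \<open>P j\<close>, translated by the other
  summands, is a segment through the vertex inside the sum.\<close>

lemma extreme_point_of_summand:
  fixes P :: "'j::finite \<Rightarrow> 'a::euclidean_space set"
  assumes q: "(\<Sum>j\<in>UNIV. p j) extreme_point_of (\<Sum>j\<in>UNIV. P j)" and p: "\<And>j. p j \<in> P j"
  shows "p j extreme_point_of P j"
  unfolding extreme_point_of_def
proof (intro conjI ballI p notI)
  fix a b assume ab: "a \<in> P j" "b \<in> P j" "p j \<in> open_segment a b"
  then obtain u where u: "a \<noteq> b" "0 < u" "u < 1" "p j = (1 - u) *\<^sub>R a + u *\<^sub>R b"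
    by (auto simp: in_segment)
  define r where "r = (\<Sum>i\<in>UNIV - {j}. p i)"
  have upd: "(\<Sum>i\<in>UNIV. (p(j := x)) i) = x + r" for x
    by (simp add: sum.remove[of UNIV j] r_def)
  have "x + r \<in> (\<Sum>j\<in>UNIV. P j)" if "x \<in> P j" for x
    unfolding set_sum_alt[OF finite] upd[symmetric] using that p
    by (intro CollectI exI[of _ "p(j := x)"]) auto
  moreover have "(\<Sum>j\<in>UNIV. p j) = (1 - u) *\<^sub>R (a + r) + u *\<^sub>R (b + r)"
  proof -
    have "(\<Sum>j\<in>UNIV. p j) = p j + r" using upd[of "p j"] by simp
    also have "\<dots> = (1 - u) *\<^sub>R (a + r) + u *\<^sub>R (b + r)" by (simp add: u(4) algebra_simps)
    finally show ?thesis .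
  qed
  then have "(\<Sum>j\<in>UNIV. p j) \<in> open_segment (a + r) (b + r)"
    unfolding in_segment using u by (intro conjI exI[of _ u]) auto
  ultimately show False using q ab(1,2) by (auto simp: extreme_point_of_def)
qed

section \<open>Faces and edges of finitely generated cones\<close>

lemma convex_cone_hull_finite:
  assumes "finite F"
  shows "convex_cone hull F = {\<Sum>f\<in>F. c f *\<^sub>R f | c. \<forall>f\<in>F. 0 \<le> c f}" (is "_ = ?R")
proof (rule hull_unique)
  show "F \<subseteq> ?R"
  proof
    fix g assume "g \<in> F"
    then have "g = (\<Sum>f\<in>F. (if f = g then 1 else 0) *\<^sub>R f)"
      using assms by (simp add: if_distrib[of "\<lambda>c. c *\<^sub>R _"] cong: if_cong)
    then show "g \<in> ?R" by (intro CollectI exI[of _ "\<lambda>f. if f = g then 1 else 0"]) auto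
  qed
  show "convex_cone ?R"
    unfolding convex_cone_iff
  proof (intro conjI ballI allI impI)
    show "0 \<in> ?R" by (intro CollectI exI[of _ "\<lambda>_. 0"]) auto
  next
    fix x y assume "x \<in> ?R" "y \<in> ?R"
    then obtain c d where "x = (\<Sum>f\<in>F. c f *\<^sub>R f)" "y = (\<Sum>f\<in>F. d f *\<^sub>R f)" "\<forall>f\<in>F. 0 \<le> c f" "\<forall>f\<in>F. 0 \<le> d f"
      by blast
    then show "x + y \<in> ?R"
      by (intro CollectI exI[of _ "\<lambda>f. c f + d f"]) (simp add: algebra_simps sum.distrib)
  next
    fix x and t :: real assume "x \<in> ?R" "0 \<le> t"
    then obtain c where "x = (\<Sum>f\<in>F. c f *\<^sub>R f)" "\<forall>f\<in>F. 0 \<le> c f" by blast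
    then show "t *\<^sub>R x \<in> ?R" using \<open>0 \<le> t\<close>
      by (intro CollectI exI[of _ "\<lambda>f. t * c f"]) (simp add: scaleR_sum_right)
  qed
next
  fix T assume T: "F \<subseteq> T" "convex_cone T"
  show "?R \<subseteq> T"
  proof
    fix x assume "x \<in> ?R"
    then obtain c where c: "x = (\<Sum>f\<in>F. c f *\<^sub>R f)" "\<forall>f\<in>F. 0 \<le> c f" by blast
    have "(\<Sum>f\<in>S. c f *\<^sub>R f) \<in> T" if "finite S" "S \<subseteq> F" for S
      using that by induction (use T c(2) in \<open>auto intro: convex_cone_add convex_cone_scaleR convex_cone_contains_0\<close>)
    then show "x \<in> T" using c(1) assms by blast
  qed
qed

text \<open>A nonzero x lies strictly between t x and 2 x if t < 1, and strictly between 0 and t x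
  if t > 1; a face contains the ends of such segments.\<close>

lemma face_of_cone_scaleR:
  assumes \<xi>: "\<xi> face_of C" and C: "convex_cone C" and x: "x \<in> \<xi>" and t: "0 \<le> t"
  shows "t *\<^sub>R x \<in> \<xi>"
proof (cases "x = 0 \<or> t = 1")
  case False
  have xC: "x \<in> C" using face_of_imp_subset[OF \<xi>] x by blast
  have seg: "a \<in> \<xi> \<and> b \<in> \<xi>" if "a \<in> C" "b \<in> C" "x \<in> open_segment a b" for a b
    using \<xi> x that by (auto simp: face_of_def)
  show ?thesis
  proof (cases "t < 1")
    case True
    define u where "u = (1 - t) / (2 - t)"
    have u: "0 < u" "u < 1" "(1 - u) * t + u * 2 = 1"
    proof -
      have "u * (2 - t) = 1 - t" using True by (simp add: u_def)
      then show "(1 - u) * t + u * 2 = 1" by (simp add: algebra_simps)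
    qed (use True in \<open>simp_all add: u_def divide_less_eq\<close>)
    have "(1 - u) *\<^sub>R (t *\<^sub>R x) + u *\<^sub>R (2 *\<^sub>R x) = ((1 - u) * t + u * 2) *\<^sub>R x"
      by (simp add: scaleR_add_left)
    then have "x = (1 - u) *\<^sub>R (t *\<^sub>R x) + u *\<^sub>R (2 *\<^sub>R x)" using u(3) by simp
    moreover have "t *\<^sub>R x \<noteq> 2 *\<^sub>R x" using True False by simp
    ultimately have "x \<in> open_segment (t *\<^sub>R x) (2 *\<^sub>R x)"
      unfolding in_segment using u by (intro conjI exI[of _ u]) auto
    then show ?thesis using seg xC t C by (meson convex_cone_scaleR zero_le_numeral)
  next
    case ge: False
    then have "t > 1" using False by simp
    have "x = (1 - 1 / t) *\<^sub>R 0 + (1 / t) *\<^sub>R (t *\<^sub>R x)" using \<open>t > 1\<close> by simp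
    then have "x \<in> open_segment 0 (t *\<^sub>R x)"
      unfolding in_segment using \<open>t > 1\<close> False by (intro conjI exI[of _ "1 / t"]) auto
    then show ?thesis using seg xC t C by (meson convex_cone_scaleR convex_cone_contains_0)
  qed
qed (use x in auto)

text \<open>x + y is the midpoint of 2 x and 2 y, so 2 x lies in the face.\<close>

lemma face_of_cone_addD:
  assumes \<xi>: "\<xi> face_of C" and C: "convex_cone C" and xy: "x \<in> C" "y \<in> C" "x + y \<in> \<xi>"
  shows "x \<in> \<xi>"
proof -
  have "2 *\<^sub>R x \<in> \<xi>"
  proof (cases "x = y")
    case True
    then show ?thesis using xy(3) by (simp add: scaleR_2)
  next
    case False
    have "x + y = (1 - 1/2) *\<^sub>R (2 *\<^sub>R x) + (1/2) *\<^sub>R (2 *\<^sub>R y)" by simp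
    then have "x + y \<in> open_segment (2 *\<^sub>R x) (2 *\<^sub>R y)"
      unfolding in_segment using False by (intro conjI exI[of _ "1/2"]) auto
    moreover have "2 *\<^sub>R x \<in> C" "2 *\<^sub>R y \<in> C" using xy C by (auto intro: convex_cone_scaleR)
    ultimately show ?thesis using \<xi> xy(3) by (auto simp: face_of_def)
  qed
  then show ?thesis using face_of_cone_scaleR[OF \<xi> C, of "2 *\<^sub>R x" "1/2"] by simp
qed

definition half_line :: "'a::real_vector \<Rightarrow> 'a set" where
  "half_line g = {t *\<^sub>R g | t. 0 \<le> t}"

lemma in_half_line: "x \<in> half_line g \<longleftrightarrow> (\<exists>t\<ge>0. x = t *\<^sub>R g)"
  by (auto simp: half_line_def)

lemma aff_dim_half_line:
  fixes g :: "'a::euclidean_space"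
  assumes "g \<noteq> 0"
  shows "aff_dim (half_line g) = 1"
proof -
  have g: "g \<in> half_line g" unfolding in_half_line by (intro exI[of _ 1]) simp
  have "0 \<in> half_line g" unfolding in_half_line by (intro exI[of _ 0]) simp
  then have "aff_dim (half_line g) = int (dim (half_line g))"
    by (intro aff_dim_zero hull_inc)
  moreover have "span (half_line g) = span {g}"
  proof (rule span_eq[THEN iffD2], intro conjI)
    show "half_line g \<subseteq> span {g}" by (auto simp: in_half_line span_singleton image_iff)
    show "{g} \<subseteq> span (half_line g)" using g by (simp add: span_base)
  qed
  then have "dim (half_line g) = dim {g}" by (metis dim_span)
  ultimately show ?thesis using assms by simp
qed

text \<open>Let x + y = s g with x, y in C, and let z collect the terms other than g of both. Then z
  is a multiple of g, not a positive one since g is irredundant. As w is positive on generators, all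
  coefficients in z vanish, so x and y lie on the half line.\<close>

lemma half_line_edge:
  fixes G :: "'a::euclidean_space set"
  assumes G: "finite G" and C: "C = convex_cone hull G" and pos: "\<And>g. g \<in> G \<Longrightarrow> 0 < w \<bullet> g"
    and g: "g \<in> G" and min: "g \<notin> convex_cone hull (G - {g})"
  shows "half_line g edge_of C"
proof -
  have cone: "convex_cone C" by (simp add: C convex_cone_convex_cone_hull)
  have gC: "g \<in> C" using g by (simp add: C hull_inc)
  have g0: "g \<noteq> 0" using pos[OF g] by auto
  have summand: "x \<in> half_line g" if xy: "x \<in> C" "y \<in> C" "x + y \<in> half_line g" for x y
  proof -
    obtain a where a: "x = (\<Sum>h\<in>G. a h *\<^sub>R h)" "\<forall>h\<in>G. 0 \<le> a h"
      using xy(1) unfolding C convex_cone_hull_finite[OF G] by blast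
    obtain b where b: "y = (\<Sum>h\<in>G. b h *\<^sub>R h)" "\<forall>h\<in>G. 0 \<le> b h"
      using xy(2) unfolding C convex_cone_hull_finite[OF G] by blast
    obtain s where s: "x + y = s *\<^sub>R g" using xy(3) by (auto simp: in_half_line)
    define z where "z = (\<Sum>h\<in>G - {g}. (a h + b h) *\<^sub>R h)"
    have "x + y = (a g + b g) *\<^sub>R g + z"
      using G g by (simp add: a(1) b(1) z_def sum.remove[of G g] algebra_simps sum.distrib)
    then have z: "z = (s - (a g + b g)) *\<^sub>R g" using s by (simp add: algebra_simps)
    have zC: "z \<in> convex_cone hull (G - {g})"
      unfolding convex_cone_hull_finite[OF finite_Diff[OF G]] z_def using a(2) b(2)
      by (intro CollectI exI[of _ "\<lambda>h. a h + b h"]) auto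
    have "\<not> a g + b g < s"
    proof
      assume "a g + b g < s"
      then have "g = (1 / (s - (a g + b g))) *\<^sub>R z" by (simp add: z)
      then have "g \<in> convex_cone hull (G - {g})"
        using zC \<open>a g + b g < s\<close> convex_cone_scaleR[OF convex_cone_convex_cone_hull _ zC, of "1 / (s - (a g + b g))"] by simp
      then show False using min by simp
    qed
    then have "w \<bullet> z \<le> 0"
      using pos[OF g] by (simp add: z mult_nonpos_nonneg)
    have wz: "w \<bullet> z = (\<Sum>h\<in>G - {g}. (a h + b h) * (w \<bullet> h))"
      by (simp add: z_def inner_sum_right)
    have nn: "0 \<le> (a h + b h) * (w \<bullet> h)" if "h \<in> G - {g}" for h
      using a(2) b(2) pos[of h] that by auto
    have "0 \<le> (\<Sum>h\<in>G - {g}. (a h + b h) * (w \<bullet> h))" by (rule sum_nonneg) (rule nn)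
    with \<open>w \<bullet> z \<le> 0\<close> have "(\<Sum>h\<in>G - {g}. (a h + b h) * (w \<bullet> h)) = 0" unfolding wz by linarith
    then have zero: "\<forall>h\<in>G - {g}. (a h + b h) * (w \<bullet> h) = 0"
      by (subst (asm) sum_nonneg_eq_0_iff) (use G nn in \<open>simp_all\<close>)
    have "a h = 0" if h: "h \<in> G - {g}" for h
    proof -
      have "(a h + b h) * (w \<bullet> h) = 0" using zero h by (rule bspec)
      then have "a h + b h = 0" using pos[of h] h by simp
      then show ?thesis using a(2) b(2) h by (simp add: add_nonneg_eq_0_iff)
    qed
    then have "x = a g *\<^sub>R g" using G g by (simp add: a(1) sum.remove[of G g])
    then show ?thesis using a(2) g by (auto simp: in_half_line)
  qed
  have scale: "x \<in> half_line g" if tx: "t *\<^sub>R x \<in> half_line g" "0 < t" for x t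
  proof -
    obtain r where "r \<ge> 0" "t *\<^sub>R x = r *\<^sub>R g" using tx(1) unfolding in_half_line by blast
    then have "(1 / t) *\<^sub>R (t *\<^sub>R x) = (r / t) *\<^sub>R g" by simp
    then have "x = (r / t) *\<^sub>R g" using tx(2) by simp
    then show ?thesis using \<open>r \<ge> 0\<close> tx(2) unfolding in_half_line by (intro exI[of _ "r / t"]) auto
  qed
  have "half_line g face_of C"
    unfolding face_of_def
  proof (intro conjI ballI impI)
    show "half_line g \<subseteq> C" using gC cone by (auto simp: in_half_line intro: convex_cone_scaleR)
    show "convex (half_line g)"
      unfolding convex_alt
    proof (intro ballI allI impI)
      fix x y and u :: real assume xy: "x \<in> half_line g" "y \<in> half_line g" and u: "0 \<le> u \<and> u \<le> 1"
      then obtain s t where "s \<ge> 0" "t \<ge> 0" "x = s *\<^sub>R g" "y = t *\<^sub>R g" by (auto simp: in_half_line)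
      moreover have "(1 - u) *\<^sub>R s *\<^sub>R g + u *\<^sub>R t *\<^sub>R g = ((1 - u) * s + u * t) *\<^sub>R g"
        by (simp add: scaleR_add_left)
      moreover have "0 \<le> (1 - u) * s + u * t" using u \<open>s \<ge> 0\<close> \<open>t \<ge> 0\<close> by simp
      ultimately show "(1 - u) *\<^sub>R x + u *\<^sub>R y \<in> half_line g"
        unfolding in_half_line by (intro exI[of _ "(1 - u) * s + u * t"]) simp
    qed
    fix a b x assume ab: "a \<in> C" "b \<in> C" "x \<in> half_line g" "x \<in> open_segment a b"
    then obtain u where u: "0 < u" "u < 1" "x = (1 - u) *\<^sub>R a + u *\<^sub>R b" by (auto simp: in_segment)
    have "(1 - u) *\<^sub>R a \<in> C" "u *\<^sub>R b \<in> C" using ab u cone by (auto intro: convex_cone_scaleR)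
    then have "(1 - u) *\<^sub>R a \<in> half_line g" "u *\<^sub>R b \<in> half_line g"
      using summand[of "(1 - u) *\<^sub>R a" "u *\<^sub>R b"] summand[of "u *\<^sub>R b" "(1 - u) *\<^sub>R a"] ab(3) u(3)
      by (simp_all add: add.commute)
    then show "a \<in> half_line g" "b \<in> half_line g" using scale u by auto
  qed
  then show ?thesis using aff_dim_half_line[OF g0] by (simp add: edge_of_def)
qed

text \<open>A generator with positive coefficient in a nonzero point of the edge lies in the edge,
  and its half line is a face of the edge of the same dimension 1.\<close>

lemma edge_is_half_line:
  fixes C :: "'a::euclidean_space set"
  assumes G: "finite G" and C: "C = convex_cone hull G"
    and edges: "\<And>g. g \<in> G \<Longrightarrow> half_line g edge_of C" and \<xi>: "\<xi> edge_of C"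
  shows "\<exists>g\<in>G. \<xi> = half_line g"
proof -
  have cone: "convex_cone C" by (simp add: C convex_cone_convex_cone_hull)
  have face: "\<xi> face_of C" and dim1: "aff_dim \<xi> = 1" using \<xi> by (auto simp: edge_of_def)
  have "\<not> \<xi> \<subseteq> {0}"
  proof
    assume "\<xi> \<subseteq> {0}"
    then have "aff_dim \<xi> \<le> aff_dim {0::'a}" by (rule aff_dim_subset)
    then show False using dim1 by simp
  qed
  then obtain x where x: "x \<in> \<xi>" "x \<noteq> 0" by blast
  then have "x \<in> C" using face_of_imp_subset[OF face] by blast
  then obtain c where c: "x = (\<Sum>h\<in>G. c h *\<^sub>R h)" "\<forall>h\<in>G. 0 \<le> c h"
    unfolding C convex_cone_hull_finite[OF G] by blast
  obtain h where h: "h \<in> G" "c h *\<^sub>R h \<noteq> 0" 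
  proof -
    have "\<exists>h\<in>G. c h *\<^sub>R h \<noteq> 0"
    proof (rule ccontr)
      assume "\<not> (\<exists>h\<in>G. c h *\<^sub>R h \<noteq> 0)"
      then have "x = 0" unfolding c(1) by (intro sum.neutral) blast
      then show False using x(2) by simp
    qed
    then show ?thesis using that by blast
  qed
  have "c h \<noteq> 0" using h(2) by auto
  then have "c h > 0" using c(2) h(1) by (simp add: less_le)
  have "(\<Sum>h\<in>G - {h}. c h *\<^sub>R h) \<in> C"
  proof -
    have "(\<Sum>h\<in>G - {h}. c h *\<^sub>R h) \<in> convex_cone hull (G - {h})"
      unfolding convex_cone_hull_finite[OF finite_Diff[OF G]] using c(2) by blast
    then show ?thesis unfolding C using hull_mono[of "G - {h}" G convex_cone] by blast
  qed
  moreover have "c h *\<^sub>R h \<in> C" using h(1) c(2) cone by (auto simp: C hull_inc intro: convex_cone_scaleR)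
  moreover have "x = c h *\<^sub>R h + (\<Sum>h\<in>G - {h}. c h *\<^sub>R h)" using G h(1) by (simp add: c(1) sum.remove)
  ultimately have "c h *\<^sub>R h \<in> \<xi>" using face_of_cone_addD[OF face cone] x(1) by metis
  then have "h \<in> \<xi>"
    using face_of_cone_scaleR[OF face cone, of "c h *\<^sub>R h" "1 / c h"] \<open>c h > 0\<close> by simp
  then have sub: "half_line h \<subseteq> \<xi>" by (auto simp: in_half_line intro: face_of_cone_scaleR[OF face cone])
  have "half_line h face_of \<xi>"
    using edges[OF h(1)] sub face_of_imp_subset[OF face] by (auto simp: edge_of_def intro: face_of_subset)
  then have "half_line h = \<xi>"
    using face_of_aff_dim_lt[of \<xi> "half_line h"] face_of_imp_convex[OF face] edges[OF h(1)] dim1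
    by (auto simp: edge_of_def)
  then show ?thesis using h(1) by blast
qed

text \<open>If 0 were a convex combination of \<open>G\<close>, a positive multiple of some
  generator would have its negative in C. So 0 can be separated from the compact convex
  hull.\<close>

lemma strongly_convex_positive:
  fixes C :: "(real ^ 'd) set"
  assumes G: "finite G" "0 \<notin> G" and C: "C = convex_cone hull G" and sc: "strongly_convex C"
  shows "\<exists>w. \<forall>g\<in>G. 0 < w \<bullet> g"
proof -
  have cone: "convex_cone C" by (simp add: C convex_cone_convex_cone_hull)
  have "0 \<notin> convex hull G"
  proof
    assume "0 \<in> convex hull G"
    then obtain u where u: "\<forall>x\<in>G. 0 \<le> u x" "sum u G = 1" "(\<Sum>x\<in>G. u x *\<^sub>R x) = 0"
      unfolding convex_hull_finite[OF G(1)] by blast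
    obtain g where g: "g \<in> G" "u g \<noteq> 0" 
    proof -
      have "\<exists>g\<in>G. u g \<noteq> 0"
      proof (rule ccontr)
        assume "\<not> (\<exists>g\<in>G. u g \<noteq> 0)"
        then have "sum u G = 0" by (intro sum.neutral) blast
        then show False using u(2) by simp
      qed
      then show ?thesis using that by blast
    qed
    have "(\<Sum>x\<in>G - {g}. u x *\<^sub>R x) \<in> convex_cone hull (G - {g})"
      unfolding convex_cone_hull_finite[OF finite_Diff[OF G(1)]] using u(1) by blast
    then have "(\<Sum>x\<in>G - {g}. u x *\<^sub>R x) \<in> C" unfolding C using hull_mono[of "G - {g}" G convex_cone] by blast
    moreover have "(\<Sum>x\<in>G - {g}. u x *\<^sub>R x) = - (u g *\<^sub>R g)"
      using u(3) G(1) g(1) by (simp add: sum.remove[of G g] eq_neg_iff_add_eq_0 add.commute)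
    moreover have "u g *\<^sub>R g \<in> C" using g(1) u(1) cone by (auto simp: C hull_inc intro: convex_cone_scaleR)
    ultimately have "- (u g *\<^sub>R g) \<in> C \<inter> uminus ` C" by auto
    then have "- (u g *\<^sub>R g) \<in> {0}" by (simp only: sc[unfolded strongly_convex_def])
    then have "u g *\<^sub>R g = 0" by simp
    then show False using g G(2) by auto
  qed
  moreover have "closed (convex hull G)" "convex (convex hull G)"
    using G(1) by (auto simp: finite_imp_compact_convex_hull compact_imp_closed)
  ultimately obtain w b where "0 < b" "\<forall>x\<in>convex hull G. b < w \<bullet> x"
    using separating_hyperplane_closed_0[of "convex hull G"] by auto
  then show ?thesis by (intro exI[of _ w] ballI) (meson hull_inc less_trans)
qed

text \<open>Rounding N w down changes the pairing with v by at most K, the sum of the absolute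
  coordinates of v, while the pairing of N w with v grows linearly in N.\<close>

lemma integral_positive_functional:
  fixes V :: "(int ^ 'd) set"
  assumes V: "finite V" and w: "\<And>v. v \<in> V \<Longrightarrow> 0 < w \<bullet> real_vec v"
  shows "\<exists>m. \<forall>v\<in>V. 1 \<le> scalar_product m v"
proof -
  define m where "m N = (\<chi> i. \<lfloor>N * w $ i\<rfloor>)" for N
  have "\<forall>\<^sub>F N in at_top. 1 \<le> scalar_product (m N) v" if v: "v \<in> V" for v
  proof -
    define K where "K = (\<Sum>i\<in>UNIV. \<bar>real_of_int (v $ i)\<bar>)"
    have "1 \<le> scalar_product (m N) v" if N: "(K + 1) / (w \<bullet> real_vec v) \<le> N" for N
    proof -
      have "N * (w \<bullet> real_vec v) - real_of_int (scalar_product (m N) v)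
          = (\<Sum>i\<in>UNIV. (N * w $ i - of_int \<lfloor>N * w $ i\<rfloor>) * of_int (v $ i))"
        by (simp add: inner_vec_def scalar_product_def m_def algebra_simps sum_subtractf sum_distrib_left)
      also have "\<dots> \<le> K"
        unfolding K_def
      proof (rule sum_mono)
        fix i
        have "0 \<le> N * w $ i - of_int \<lfloor>N * w $ i\<rfloor>" "N * w $ i - of_int \<lfloor>N * w $ i\<rfloor> \<le> 1" by linarith+
        then have "\<bar>(N * w $ i - of_int \<lfloor>N * w $ i\<rfloor>) * of_int (v $ i)\<bar> \<le> 1 * \<bar>real_of_int (v $ i)\<bar>"
          unfolding abs_mult by (intro mult_right_mono) auto
        then show "(N * w $ i - of_int \<lfloor>N * w $ i\<rfloor>) * of_int (v $ i) \<le> \<bar>real_of_int (v $ i)\<bar>" by linarith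
      qed
      finally have "real_of_int (scalar_product (m N) v) \<ge> N * (w \<bullet> real_vec v) - K" by simp
      moreover have "N * (w \<bullet> real_vec v) \<ge> K + 1" using N w[OF v] by (simp add: field_simps)
      ultimately show ?thesis by linarith
    qed
    then show ?thesis using eventually_ge_at_top by (rule eventually_mono[rotated])
  qed
  then have "\<forall>\<^sub>F N in at_top. \<forall>v\<in>V. 1 \<le> scalar_product (m N) v" by (intro eventually_ball_finite V) blast
  then show ?thesis using eventually_happens'[OF trivial_limit_at_top_linorder] by blast
qed

text \<open>A nonzero lattice point of least l1 norm on the ray generates the semigroup, since
  subtracting integral multiples of it from another point leaves a shorter one. Its uniqueness gives
  the definite description in \<open>ray_gen\<close> a meaning.\<close>

lemma ray_gen_half_line:
  fixes v\<^sub>0 :: "int ^ 'd"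
  assumes "v\<^sub>0 \<noteq> 0"
  shows "ray_gen (half_line (real_vec v\<^sub>0)) \<noteq> 0"
    and "half_line (real_vec (ray_gen (half_line (real_vec v\<^sub>0)))) = half_line (real_vec v\<^sub>0)"
proof -
  let ?\<xi> = "half_line (real_vec v\<^sub>0)"
  define W where "W = {w. real_vec w \<in> ?\<xi>}"
  have v0: "v\<^sub>0 \<in> W" unfolding W_def in_half_line by (intro CollectI exI[of _ 1]) simp
  define \<mu> :: "int ^ 'd \<Rightarrow> nat" where "\<mu> w = nat (\<Sum>i\<in>UNIV. \<bar>w $ i\<bar>)" for w
  have \<mu>: "real (\<mu> w) = (\<Sum>i\<in>UNIV. \<bar>real_vec w $ i\<bar>)" for w by (simp add: \<mu>_def sum_nonneg)
  obtain v where v: "v \<in> W" "v \<noteq> 0" and min: "\<And>w. w \<in> W \<Longrightarrow> w \<noteq> 0 \<Longrightarrow> \<mu> v \<le> \<mu> w"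
    using ex_has_least_nat[of "\<lambda>w. w \<in> W \<and> w \<noteq> 0" v\<^sub>0 \<mu>] v0 assms by blast
  obtain t where t: "t \<ge> 0" "real_vec v = t *\<^sub>R real_vec v\<^sub>0" using v(1) by (auto simp: W_def in_half_line)
  have "t > 0" using t v(2) by (cases "t = 0") auto
  have WN: "W = range (\<lambda>n::nat. of_nat n *s v)"
  proof (intro equalityI subsetI)
    fix w assume "w \<in> W"
    then obtain s where s: "s \<ge> 0" "real_vec w = s *\<^sub>R real_vec v\<^sub>0" by (auto simp: W_def in_half_line)
    define r where "r = s / t"
    have w: "real_vec w = r *\<^sub>R real_vec v" using s t \<open>t > 0\<close> by (simp add: r_def)
    have "r \<ge> 0" using s \<open>t > 0\<close> by (simp add: r_def)
    define w' where "w' = w - \<lfloor>r\<rfloor> *s v"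
    have w': "real_vec w' = (r - of_int \<lfloor>r\<rfloor>) *\<^sub>R real_vec v" by (simp add: w'_def w algebra_simps)
    have fr: "0 \<le> r - of_int \<lfloor>r\<rfloor>" "r - of_int \<lfloor>r\<rfloor> < 1" by linarith+
    have "w' \<in> W" unfolding W_def in_half_line using w' t fr
      by (intro CollectI exI[of _ "(r - of_int \<lfloor>r\<rfloor>) * t"]) simp
    have "w' = 0"
    proof (rule ccontr)
      assume "w' \<noteq> 0"
      then have "\<mu> v \<le> \<mu> w'" using min \<open>w' \<in> W\<close> by blast
      have "real (\<mu> w') = (r - of_int \<lfloor>r\<rfloor>) * real (\<mu> v)"
        unfolding \<mu> w' using fr(1) by (simp add: abs_mult sum_distrib_left)
      moreover have "real (\<mu> v) > 0"
      proof -
        obtain i where "v $ i \<noteq> 0" using v(2) by (auto simp: vec_eq_iff)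
        then have "0 < \<bar>real_vec v $ i\<bar>" by simp
        also have "\<dots> \<le> real (\<mu> v)" unfolding \<mu> by (intro member_le_sum) auto
        finally show ?thesis .
      qed
      ultimately have "real (\<mu> w') < real (\<mu> v)" using fr(2) by simp
      then show False using \<open>\<mu> v \<le> \<mu> w'\<close> by simp
    qed
    then have "w = of_nat (nat \<lfloor>r\<rfloor>) *s v" using \<open>r \<ge> 0\<close> by (simp add: w'_def)
    then show "w \<in> range (\<lambda>n::nat. of_nat n *s v)" by blast
  next
    fix w assume "w \<in> range (\<lambda>n::nat. of_nat n *s v)"
    then obtain n :: nat where "w = of_nat n *s v" by blast
    then show "w \<in> W" unfolding W_def in_half_line using t
      by (intro CollectI exI[of _ "real n * t"]) simp
  qed
  have "ray_gen ?\<xi> = v"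
    unfolding ray_gen_def
  proof (rule the_equality)
    show "{w. real_vec w \<in> ?\<xi>} = range (\<lambda>n::nat. of_nat n *s v)" using WN by (simp add: W_def)
    fix v' assume "{w. real_vec w \<in> ?\<xi>} = range (\<lambda>n::nat. of_nat n *s v')"
    then have W': "W = range (\<lambda>n::nat. of_nat n *s v')" by (simp add: W_def)
    have "v' \<in> W" unfolding W' by (rule range_eqI[of _ _ 1]) simp
    then obtain n :: nat where n: "v' = of_nat n *s v" unfolding WN by blast
    obtain k :: nat where k: "v = of_nat k *s v'" using v(1) unfolding W' by blast
    obtain i where i: "v $ i \<noteq> 0" using v(2) by (auto simp: vec_eq_iff)
    have "v $ i = int k * (int n * v $ i)" using n k by (metis vector_smult_component)
    then have "int k * int n = 1" using i by simp
    then have "n = 1" by (metis nat_mult_eq_1_iff of_nat_1 of_nat_eq_iff of_nat_mult)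
    then show "v' = v" using n by simp
  qed
  then show "ray_gen ?\<xi> \<noteq> 0" using v(2) by simp
  show "half_line (real_vec (ray_gen ?\<xi>)) = ?\<xi>"
    unfolding \<open>ray_gen ?\<xi> = v\<close>
  proof (intro equalityI subsetI)
    fix x assume "x \<in> half_line (real_vec v)"
    then show "x \<in> ?\<xi>" using t unfolding in_half_line by (metis mult_nonneg_nonneg scaleR_scaleR)
  next
    fix x assume "x \<in> ?\<xi>"
    then obtain s where "s \<ge> 0" "x = s *\<^sub>R real_vec v\<^sub>0" by (auto simp: in_half_line)
    then show "x \<in> half_line (real_vec v)" using t \<open>t > 0\<close> unfolding in_half_line
      by (intro exI[of _ "s / t"]) simp
  qed
qed

lemma dual_semigroup_hull:
  "u \<in> dual_semigroup (convex_cone hull S) \<longleftrightarrow> (\<forall>x\<in>S. 0 \<le> real_vec u \<bullet> x)"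
proof
  assume "\<forall>x\<in>S. 0 \<le> real_vec u \<bullet> x"
  then have "convex_cone hull S \<subseteq> {x. 0 \<le> real_vec u \<bullet> x}"
    by (intro hull_minimal convex_cone_halfspace_ge) auto
  then show "u \<in> dual_semigroup (convex_cone hull S)" by (auto simp: dual_semigroup_def)
qed (simp add: dual_semigroup_def hull_inc)

text \<open>A generating set of least cardinality is irredundant, so its members span exactly the
  edges. The last fact supplies an integral functional in the interior of the dual cone, on which
  the lower bound for the dimension rests.\<close>

theorem rational_cone_rays:
  fixes C :: "(real ^ 'd) set"
  assumes rat: "rational_polyhedral_cone C" and sc: "strongly_convex C"
  shows "finite (rays C)"
    and "\<And>\<xi>. \<xi> \<in> rays C \<Longrightarrow> ray_gen \<xi> \<noteq> 0 \<and> \<xi> = half_line (real_vec (ray_gen \<xi>))"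
    and "dual_semigroup C = {u. \<forall>\<xi>\<in>rays C. 0 \<le> scalar_product u (ray_gen \<xi>)}"
    and "\<exists>m. \<forall>\<xi>\<in>rays C. 1 \<le> scalar_product m (ray_gen \<xi>)"
proof -
  obtain F where F: "finite F" "F \<subseteq> lattice_points" "C = convex_cone hull F"
    using rat unfolding rational_polyhedral_cone_def by blast
  define P where "P G \<longleftrightarrow> G \<subseteq> F \<and> convex_cone hull G = C" for G
  have "P F" using F(3) by (simp add: P_def)
  then obtain G where G: "P G" and min: "\<And>G'. P G' \<Longrightarrow> card G \<le> card G'"
    using ex_has_least_nat[of P F card] by blast
  have GF: "G \<subseteq> F" and hull: "C = convex_cone hull G" using G by (auto simp: P_def)
  have finG: "finite G" using GF F(1) finite_subset by blast
  have irredundant: "g \<notin> convex_cone hull (G - {g})" if g: "g \<in> G" for g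
  proof
    assume "g \<in> convex_cone hull (G - {g})"
    then have "G \<subseteq> convex_cone hull (G - {g})" using hull_subset[of "G - {g}" convex_cone] by blast
    then have "convex_cone hull G \<subseteq> convex_cone hull (G - {g})"
      by (intro hull_minimal convex_cone_convex_cone_hull)
    moreover have "convex_cone hull (G - {g}) \<subseteq> convex_cone hull G" by (intro hull_mono) auto
    ultimately have "P (G - {g})" using GF hull by (auto simp: P_def)
    then have "card G \<le> card (G - {g})" by (rule min)
    then show False using card_Diff1_less[OF finG g] by linarith
  qed
  have "0 \<notin> G" using irredundant[of 0] convex_cone_hull_contains_0 by blast
  then obtain w where w: "\<And>g. g \<in> G \<Longrightarrow> 0 < w \<bullet> g"
    using strongly_convex_positive[OF finG _ hull sc] by blast
  have edges: "half_line g edge_of C" if "g \<in> G" for g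
    by (rule half_line_edge[OF finG hull w that irredundant[OF that]])
  have rays: "rays C = half_line ` G"
    using edges edge_is_half_line[OF finG hull edges] by (auto simp: rays_def)
  show fin: "finite (rays C)" using finG by (simp add: rays)
  show gen: "ray_gen \<xi> \<noteq> 0 \<and> \<xi> = half_line (real_vec (ray_gen \<xi>))" if \<xi>: "\<xi> \<in> rays C" for \<xi>
  proof -
    obtain g where g: "g \<in> G" "\<xi> = half_line g" using \<xi> rays by blast
    obtain v0 where v0: "g = real_vec v0" using g(1) GF F(2) unfolding lattice_points_def by blast
    have "v0 \<noteq> 0" using \<open>0 \<notin> G\<close> g(1) v0 by auto
    then show ?thesis using ray_gen_half_line g(2) v0 by blast
  qed
  have G_gen: "\<exists>\<xi>\<in>rays C. \<exists>t\<ge>0. g = t *\<^sub>R real_vec (ray_gen \<xi>)" if "g \<in> G" for g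
  proof -
    have "g \<in> half_line g" unfolding in_half_line by (intro exI[of _ 1]) simp
    moreover have hl: "half_line g \<in> rays C" using that rays by simp
    ultimately have "g \<in> half_line (real_vec (ray_gen (half_line g)))"
      by (rule_tac subsetD[OF equalityD1[OF conjunct2[OF gen[OF hl]]]])
    then show ?thesis using hl unfolding in_half_line by (intro bexI[of _ "half_line g"])
  qed
  have gen_G: "\<exists>g\<in>G. \<exists>t\<ge>0. real_vec (ray_gen \<xi>) = t *\<^sub>R g" if \<xi>: "\<xi> \<in> rays C" for \<xi>
  proof -
    obtain g where g: "g \<in> G" "\<xi> = half_line g" using \<xi> rays by blast
    have "real_vec (ray_gen \<xi>) \<in> half_line (real_vec (ray_gen \<xi>))" unfolding in_half_line by (intro exI[of _ 1]) simp
    then have "real_vec (ray_gen \<xi>) \<in> \<xi>" by (rule subsetD[OF equalityD2[OF conjunct2[OF gen[OF \<xi>]]]])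
    then have "real_vec (ray_gen \<xi>) \<in> half_line g" using g(2) by simp
    then show ?thesis using g(1) unfolding in_half_line by (intro bexI[of _ g])
  qed
  show "dual_semigroup C = {u. \<forall>\<xi>\<in>rays C. 0 \<le> scalar_product u (ray_gen \<xi>)}"
  proof (intro equalityI subsetI CollectI ballI)
    fix u \<xi> assume u: "u \<in> dual_semigroup C" and \<xi>: "\<xi> \<in> rays C"
    obtain g t where g: "g \<in> G" "t \<ge> 0" "real_vec (ray_gen \<xi>) = t *\<^sub>R g" using gen_G[OF \<xi>] by blast
    have "0 \<le> real_vec u \<bullet> real_vec (ray_gen \<xi>)"
      using u g unfolding hull dual_semigroup_hull g(3) by simp
    then show "0 \<le> scalar_product u (ray_gen \<xi>)" by (simp add: real_vec_inner)
  next
    fix u assume u: "u \<in> {u. \<forall>\<xi>\<in>rays C. 0 \<le> scalar_product u (ray_gen \<xi>)}"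
    show "u \<in> dual_semigroup C"
      unfolding hull dual_semigroup_hull
    proof
      fix g assume "g \<in> G"
      then obtain \<xi> t where \<xi>: "\<xi> \<in> rays C" "t \<ge> 0" "g = t *\<^sub>R real_vec (ray_gen \<xi>)" using G_gen by blast
      have "0 \<le> scalar_product u (ray_gen \<xi>)" using u \<xi>(1) by blast
      then show "0 \<le> real_vec u \<bullet> g" using \<xi>(2) by (simp add: \<xi>(3) real_vec_inner)
    qed
  qed
  have "0 < w \<bullet> real_vec v" if v: "v \<in> ray_gen ` rays C" for v
  proof -
    obtain \<xi> where \<xi>: "\<xi> \<in> rays C" "v = ray_gen \<xi>" using v by blast
    obtain g t where g: "g \<in> G" "t \<ge> 0" "real_vec v = t *\<^sub>R g" using gen_G[OF \<xi>(1)] \<xi>(2) by blast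
    have "v \<noteq> 0" using conjunct1[OF gen[OF \<xi>(1)]] \<xi>(2) by simp
    then have "t \<noteq> 0" using g(3) by auto
    then show ?thesis using g w[OF g(1)] by simp
  qed
  then show "\<exists>m. \<forall>\<xi>\<in>rays C. 1 \<le> scalar_product m (ray_gen \<xi>)"
    using integral_positive_functional[of "ray_gen ` rays C"] fin by auto
qed

text \<open>A nonzero element of a face is a sum of generators, all of which lie in the face.\<close>

lemma face_contains_generator:
  assumes \<xi>: "\<xi> face_of C" and C: "C = convex_cone hull S" and x: "x \<in> \<xi>" "x \<noteq> 0"
  shows "\<exists>s\<in>S. s \<in> \<xi> \<and> s \<noteq> 0"
proof -
  have cone: "convex_cone C" by (simp add: C convex_cone_convex_cone_hull)
  \<comment> \<open>Hull induction: the points of C that satisfy the claim form a convex cone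
    containing S.\<close>
  let ?K = "{x \<in> C. x \<in> \<xi> \<longrightarrow> x \<noteq> 0 \<longrightarrow> (\<exists>s\<in>S. s \<in> \<xi> \<and> s \<noteq> 0)}"
  have "convex_cone hull S \<subseteq> ?K"
  proof (rule hull_minimal)
    show "S \<subseteq> ?K" by (auto simp: C hull_inc)
    show "convex_cone ?K"
      unfolding convex_cone_iff
    proof (intro conjI ballI allI impI)
      show "0 \<in> ?K" using cone by (simp add: convex_cone_contains_0)
    next
      fix x y assume xy: "x \<in> ?K" "y \<in> ?K"
      have "\<exists>s\<in>S. s \<in> \<xi> \<and> s \<noteq> 0" if "x + y \<in> \<xi>" "x + y \<noteq> 0"
      proof -
        have "x \<in> \<xi>" "y \<in> \<xi>"
          using face_of_cone_addD[OF \<xi> cone, of x y] face_of_cone_addD[OF \<xi> cone, of y x] xy that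
          by (auto simp: add.commute)
        moreover have "x \<noteq> 0 \<or> y \<noteq> 0" using that by auto
        ultimately show ?thesis using xy by auto
      qed
      then show "x + y \<in> ?K" using xy cone by (auto intro: convex_cone_add)
    next
      fix x and c :: real assume x: "x \<in> ?K" "0 \<le> c"
      have "\<exists>s\<in>S. s \<in> \<xi> \<and> s \<noteq> 0" if "c *\<^sub>R x \<in> \<xi>" "c *\<^sub>R x \<noteq> 0"
      proof -
        have "c \<noteq> 0" "x \<noteq> 0" using that by auto
        then have "x \<in> \<xi>"
          using face_of_cone_scaleR[OF \<xi> cone that(1), of "1 / c"] x(2) by simp
        then show ?thesis using x(1) \<open>x \<noteq> 0\<close> by blast
      qed
      then show "c *\<^sub>R x \<in> ?K" using x cone by (auto intro: convex_cone_scaleR)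
    qed
  qed
  then show ?thesis using x face_of_imp_subset[OF \<xi>] C by blast
qed

lemma rational_multiple_lattice_point:
  fixes x :: "real ^ 'd"
  assumes "\<And>i. x $ i \<in> \<rat>"
  shows "\<exists>N::nat. N > 0 \<and> real N *\<^sub>R x \<in> lattice_points"
proof -
  have "\<exists>n::nat. n > 0 \<and> real n * x $ i \<in> \<int>" for i
  proof -
    obtain a b where "b > 0" "x $ i = of_int a / of_int b" using assms[of i] by (auto elim: Rats_cases')
    then show ?thesis by (intro exI[of _ "nat b"]) simp
  qed
  then obtain n :: "'d \<Rightarrow> nat" where n: "\<And>i. n i > 0" "\<And>i. real (n i) * x $ i \<in> \<int>" by metis
  define N where "N = (\<Prod>i\<in>UNIV. n i)"
  have "real N * x $ i \<in> \<int>" for i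
  proof -
    have "real N * x $ i = real (\<Prod>j\<in>UNIV - {i}. n j) * (real (n i) * x $ i)"
      by (simp add: N_def prod.remove[of UNIV i])
    then show ?thesis using n(2)[of i] by (metis Ints_mult Ints_of_nat)
  qed
  then have "real_vec (\<chi> i. \<lfloor>real N * x $ i\<rfloor>) = real N *\<^sub>R x" by (simp add: vec_eq_iff)
  moreover have "N > 0" using n(1) by (simp add: N_def prod_pos)
  ultimately show ?thesis unfolding lattice_points_def by (metis rangeI)
qed

section \<open>Extension of characters and closed embeddings\<close>

text \<open>A homomorphism from a subgroup \<open>H\<close> of a free abelian group to the nonzero
  complex numbers; the values of \<open>f\<close> off \<open>H\<close> carry no meaning.\<close>

definition is_character :: "('a \<Rightarrow>\<^sub>0 int) set \<Rightarrow> (('a \<Rightarrow>\<^sub>0 int) \<Rightarrow> complex) \<Rightarrow> bool" where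
  "is_character H f \<longleftrightarrow> 0 \<in> H \<and> (\<forall>a\<in>H. \<forall>b\<in>H. a - b \<in> H) \<and>
     (\<forall>a\<in>H. \<forall>b\<in>H. f (a + b) = f a * f b) \<and> (\<forall>a\<in>H. f a \<noteq> 0)"

context
  fixes H :: "('a \<Rightarrow>\<^sub>0 int) set" and f :: "('a \<Rightarrow>\<^sub>0 int) \<Rightarrow> complex"
  assumes char: "is_character H f"
begin

lemma character_zero: "0 \<in> H" "f 0 = 1"
proof -
  show 0: "0 \<in> H" using char by (simp add: is_character_def)
  have "f (0 + 0) = f 0 * f 0" using char 0 unfolding is_character_def by blast
  moreover have "f 0 \<noteq> 0" using char 0 unfolding is_character_def by blast
  ultimately show "f 0 = 1" by simp
qed

lemma character_diff_closed: "a \<in> H \<Longrightarrow> b \<in> H \<Longrightarrow> a - b \<in> H"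
  using char by (simp add: is_character_def)

lemma character_add_closed: "a \<in> H \<Longrightarrow> b \<in> H \<Longrightarrow> a + b \<in> H"
  using character_diff_closed[of a "0 - b"] character_diff_closed[OF character_zero(1)] by simp

lemma character_add: "a \<in> H \<Longrightarrow> b \<in> H \<Longrightarrow> f (a + b) = f a * f b"
  using char by (simp add: is_character_def)

lemma character_nonzero: "a \<in> H \<Longrightarrow> f a \<noteq> 0"
  using char by (simp add: is_character_def)

lemma character_nat_mult: "a \<in> H \<Longrightarrow> frag_cmul (int n) a \<in> H \<and> f (frag_cmul (int n) a) = f a ^ n"
  by (induction n)
    (simp_all add: character_zero frag_cmul_distrib character_add_closed character_add)

lemma character_uminus:
  assumes "a \<in> H"
  shows "- a \<in> H" "f (- a) = inverse (f a)"
proof -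
  show m: "- a \<in> H" using character_diff_closed[OF character_zero(1) assms] by simp
  have "f (a + - a) = f a * f (- a)" by (rule character_add[OF assms m])
  then have "f a * f (- a) = 1" by (simp add: character_zero)
  then show "f (- a) = inverse (f a)" by (metis inverse_unique)
qed

lemma character_int_mult:
  assumes "a \<in> H"
  shows "frag_cmul n a \<in> H \<and> f (frag_cmul n a) = f a powi n"
proof (cases "n \<ge> 0")
  case True
  then show ?thesis using character_nat_mult[OF assms, of "nat n"] by (simp add: power_int_def)
next
  case False
  then have eq: "frag_cmul n a = - frag_cmul (int (nat (- n))) a" by simp
  note k = character_nat_mult[OF assms, of "nat (- n)"]
  show ?thesis
    using False character_uminus[OF conjunct1[OF k]] conjunct2[OF k] unfolding eq
    by (simp add: power_int_def power_inverse)
qed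

text \<open>Divisibility of the nonzero complex numbers: if d is the least positive number with d g
  in H, take a d-th root of the value at d g; every multiple of g in H is a multiple of d g. If
  there is no such d, only 0 has to be matched.\<close>

lemma character_root: "\<exists>z. z \<noteq> 0 \<and> (\<forall>n. frag_cmul n g \<in> H \<longrightarrow> f (frag_cmul n g) = z powi n)"
proof (cases "\<exists>d::nat. d > 0 \<and> frag_cmul (int d) g \<in> H")
  case True
  define d where "d = (LEAST d::nat. d > 0 \<and> frag_cmul (int d) g \<in> H)"
  have d: "d > 0" "frag_cmul (int d) g \<in> H" using LeastI_ex[OF True] by (auto simp: d_def)
  have least: "d \<le> e" if "e > 0" "frag_cmul (int e) g \<in> H" for e
    unfolding d_def using that by (intro Least_le) simp
  define z where "z = exp (Ln (f (frag_cmul (int d) g)) / of_nat d)"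
  have z: "z ^ d = f (frag_cmul (int d) g)"
    using d character_nonzero[OF d(2)] by (simp add: z_def flip: exp_of_nat_mult)
  have "f (frag_cmul n g) = z powi n" if n: "frag_cmul n g \<in> H" for n
  proof -
    define q where "q = n div int d"
    have dq: "frag_cmul q (frag_cmul (int d) g) \<in> H" using character_int_mult[OF d(2)] by blast
    have "frag_cmul (n mod int d) g = frag_cmul n g - frag_cmul q (frag_cmul (int d) g)"
      by (simp add: q_def minus_div_mult_eq_mod[symmetric] frag_cmul_distrib[of n "- (n div int d * int d)" g, simplified])
    then have "frag_cmul (n mod int d) g \<in> H" using character_diff_closed[OF n dq] by simp
    then have "frag_cmul (int (nat (n mod int d))) g \<in> H" using d(1) by simp
    moreover have "nat (n mod int d) < d" using d(1) by (simp add: nat_less_iff)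
    ultimately have "nat (n mod int d) = 0" using least[of "nat (n mod int d)"] by linarith
    then have "n mod int d = 0" using d(1) by (simp add: order_antisym)
    then have "n = int d * q" by (auto simp: q_def)
    then have "f (frag_cmul n g) = f (frag_cmul q (frag_cmul (int d) g))" by (simp add: mult.commute)
    also have "\<dots> = (z ^ d) powi q" using character_int_mult[OF d(2), of q] z by simp
    also have "\<dots> = z powi n" by (simp add: \<open>n = int d * q\<close> power_int_mult)
    finally show ?thesis .
  qed
  then show ?thesis by (intro exI[of _ z]) (simp add: z_def)
next
  case False
  have n0: "n = 0" if n: "frag_cmul n g \<in> H" for n
  proof (rule ccontr)
    assume "n \<noteq> 0"
    have "frag_cmul (int (nat \<bar>n\<bar>)) g \<in> H"
      using n character_uminus(1)[OF n] by (cases "n \<ge> 0") simp_all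
    then show False using False \<open>n \<noteq> 0\<close> by (metis zero_less_abs_iff zero_less_nat_eq)
  qed
  have "f (frag_cmul n g) = 1 powi n" if "frag_cmul n g \<in> H" for n
    using n0[OF that] by (simp add: character_zero)
  then show ?thesis by (intro exI[of _ 1]) simp
qed

lemma character_extend_one:
  "\<exists>H' f'. is_character H' f' \<and> H \<subseteq> H' \<and> g \<in> H' \<and> (\<forall>a\<in>H. f' a = f a)"
proof -
  obtain z where z: "z \<noteq> 0" "\<And>n. frag_cmul n g \<in> H \<Longrightarrow> f (frag_cmul n g) = z powi n"
    using character_root[of g] by blast
  define H' where "H' = {a + frag_cmul n g | a n. a \<in> H}"
  \<comment> \<open>Defined through an arbitrary decomposition; since powers of z agree with f on
    the multiples of g in H, the value does not depend on it.\<close>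
  define f' where "f' y = (let (a, n) = SOME (a, n). a \<in> H \<and> y = a + frag_cmul n g in f a * z powi n)" for y
  have f': "f' (a + frag_cmul n g) = f a * z powi n" if a: "a \<in> H" for a n
  proof -
    define y where "y = a + frag_cmul n g"
    define bk where "bk = (SOME (b, k). b \<in> H \<and> y = b + frag_cmul k g)"
    define b where "b = fst bk"
    define k where "k = snd bk"
    have "case bk of (b, k) \<Rightarrow> b \<in> H \<and> y = b + frag_cmul k g"
      unfolding bk_def by (rule someI[of _ "(a, n)"]) (simp add: a y_def)
    then have b: "b \<in> H" and eq: "a + frag_cmul n g = b + frag_cmul k g"
      by (simp_all add: b_def k_def case_prod_unfold y_def)
    have f'y: "f' y = f b * z powi k"
      unfolding f'_def bk_def[symmetric] by (simp add: b_def k_def case_prod_unfold)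
    have "frag_cmul (n - k) g = b - a" using eq by (simp add: frag_cmul_diff_distrib algebra_simps)
    moreover from this have "f (frag_cmul (n - k) g) = z powi (n - k)"
      using character_diff_closed[OF b a] by (intro z(2)) simp
    ultimately have "f (b - a) = z powi (n - k)" by simp
    moreover have "f b = f (b - a) * f a"
      using character_add[OF character_diff_closed[OF b a] a] by simp
    ultimately have "f b * z powi k = f a * z powi n"
      using z(1) by (simp add: power_int_diff)
    then show ?thesis using f'y by (simp add: y_def)
  qed
  have "is_character H' f'"
    unfolding is_character_def
  proof (intro conjI ballI)
    show "0 \<in> H'" unfolding H'_def using character_zero(1)
      by (intro CollectI exI[of _ 0] exI[of _ "0::int"]) simp
    fix x assume "x \<in> H'"
    then obtain a n where x: "x = a + frag_cmul n g" "a \<in> H" unfolding H'_def by blast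
    show "f' x \<noteq> 0" using x z(1) character_nonzero by (simp add: f')
    fix y assume "y \<in> H'"
    then obtain b k where y: "y = b + frag_cmul k g" "b \<in> H" unfolding H'_def by blast
    have "x - y = (a - b) + frag_cmul (n - k) g" by (simp add: x y frag_cmul_diff_distrib)
    then show "x - y \<in> H'" unfolding H'_def using character_diff_closed[OF x(2) y(2)] by blast
    have "x + y = (a + b) + frag_cmul (n + k) g" by (simp add: x y frag_cmul_distrib)
    then have "f' (x + y) = f (a + b) * z powi (n + k)"
      using f'[OF character_add_closed[OF x(2) y(2)]] by simp
    then show "f' (x + y) = f' x * f' y"
      using x y z(1) by (simp add: f' character_add power_int_add)
  qed
  moreover have "H \<subseteq> H'"
  proof
    fix a assume "a \<in> H"
    then show "a \<in> H'" unfolding H'_def by (intro CollectI exI[of _ a] exI[of _ "0::int"]) simp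
  qed
  moreover have "g \<in> H'" unfolding H'_def using character_zero(1)
    by (intro CollectI exI[of _ 0] exI[of _ "1::int"]) simp
  moreover have "\<forall>a\<in>H. f' a = f a" using f'[of _ 0] by simp
  ultimately show ?thesis by blast
qed

end

lemma character_extend:
  assumes "is_character H f" "finite E"
  shows "\<exists>H' f'. is_character H' f' \<and> H \<subseteq> H' \<and> E \<subseteq> H' \<and> (\<forall>a\<in>H. f' a = f a)"
  using assms(2)
proof induction
  case empty
  then show ?case using assms(1) by blast
next
  case (insert g E)
  then obtain H1 f1 where 1: "is_character H1 f1" "H \<subseteq> H1" "E \<subseteq> H1" "\<forall>a\<in>H. f1 a = f a" by blast
  obtain H2 f2 where 2: "is_character H2 f2" "H1 \<subseteq> H2" "g \<in> H2" "\<forall>a\<in>H1. f2 a = f1 a"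
    using character_extend_one[OF 1(1), of g] by blast
  have "H \<subseteq> H2" "insert g E \<subseteq> H2" "\<forall>a\<in>H. f2 a = f a" using 1 2 by auto
  then show ?case using 2(1) by blast
qed

lemma character_sum:
  assumes c: "is_character H f" and "finite S" "frag_of ` S \<subseteq> H" "\<And>s. s \<in> S \<Longrightarrow> 0 \<le> n s"
  shows "(\<Sum>s\<in>S. frag_cmul (n s) (frag_of s)) \<in> H \<and>
    f (\<Sum>s\<in>S. frag_cmul (n s) (frag_of s)) = (\<Prod>s\<in>S. f (frag_of s) ^ nat (n s))"
  using assms(2-)
proof induction
  case empty
  then show ?case by (simp add: character_zero[OF c])
next
  case (insert s S)
  have "frag_of s \<in> H" "0 \<le> n s" using insert.prems by auto
  then have s: "frag_cmul (n s) (frag_of s) \<in> H" "f (frag_cmul (n s) (frag_of s)) = f (frag_of s) ^ nat (n s)"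
    using character_nat_mult[OF c, of "frag_of s" "nat (n s)"] by auto
  moreover have "(\<Sum>s\<in>S. frag_cmul (n s) (frag_of s)) \<in> H"
      "f (\<Sum>s\<in>S. frag_cmul (n s) (frag_of s)) = (\<Prod>s\<in>S. f (frag_of s) ^ nat (n s))"
    using insert.IH insert.prems by auto
  ultimately show ?case
    using insert.hyps character_add_closed[OF c] character_add[OF c] by simp
qed

section \<open>Closed embeddings on complex points\<close>

lemma closed_embedding_maps:
  assumes h: "closed_embedding \<sigma> \<tau> h"
  shows "f \<in> carrier (coord_ring \<tau>) \<Longrightarrow> h f \<in> carrier (coord_ring \<sigma>)"
    and "g \<in> carrier (coord_ring \<sigma>) \<Longrightarrow> \<exists>f\<in>carrier (coord_ring \<tau>). h f = g"
proof -
  show "h f \<in> carrier (coord_ring \<sigma>)" if "f \<in> carrier (coord_ring \<tau>)"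
    using h that unfolding closed_embedding_def by (blast intro: ring_hom_closed)
  show "\<exists>f\<in>carrier (coord_ring \<tau>). h f = g" if "g \<in> carrier (coord_ring \<sigma>)"
  proof -
    have "g \<in> h ` carrier (coord_ring \<tau>)" using h that unfolding closed_embedding_def by simp
    then show ?thesis by blast
  qed
qed

lemma morphism_of_apply:
  "f \<in> carrier (coord_ring \<tau>) \<Longrightarrow> morphism_of \<tau> h p f = p (h f)"
  by (simp add: morphism_of_def)

lemma morphism_of_in_toric_variety:
  assumes h: "closed_embedding \<sigma> \<tau> h" and p: "p \<in> toric_variety \<sigma>"
  shows "morphism_of \<tau> h p \<in> toric_variety \<tau>"
proof -
  interpret cring "coord_ring \<tau>" by (rule cring_coord_ring)
  have hh: "h \<in> ring_hom (coord_ring \<tau>) (coord_ring \<sigma>)"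
    and hc: "\<And>c. h (single 0 c) = single 0 c"
    using h by (auto simp: closed_embedding_def)
  have pp: "p \<in> ring_hom (coord_ring \<sigma>) complex_ring" using p by (simp add: toric_variety_def)
  have "morphism_of \<tau> h p \<in> ring_hom (coord_ring \<tau>) complex_ring"
  proof (rule ring_hom_memI)
    show "morphism_of \<tau> h p x \<in> carrier complex_ring" for x by (simp add: complex_ring_def)
  next
    fix x y assume xy: "x \<in> carrier (coord_ring \<tau>)" "y \<in> carrier (coord_ring \<tau>)"
    show "morphism_of \<tau> h p (x \<otimes>\<^bsub>coord_ring \<tau>\<^esub> y) = morphism_of \<tau> h p x \<otimes>\<^bsub>complex_ring\<^esub> morphism_of \<tau> h p y"
      using xy closed_embedding_maps(1)[OF h]
      by (simp add: morphism_of_apply ring_hom_mult[OF hh] ring_hom_mult[OF pp])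
    show "morphism_of \<tau> h p (x \<oplus>\<^bsub>coord_ring \<tau>\<^esub> y) = morphism_of \<tau> h p x \<oplus>\<^bsub>complex_ring\<^esub> morphism_of \<tau> h p y"
      using xy closed_embedding_maps(1)[OF h]
      by (simp add: morphism_of_apply ring_hom_add[OF hh] ring_hom_add[OF pp])
  next
    show "morphism_of \<tau> h p \<one>\<^bsub>coord_ring \<tau>\<^esub> = \<one>\<^bsub>complex_ring\<^esub>"
      by (simp add: morphism_of_apply ring_hom_one[OF hh] ring_hom_one[OF pp])
  qed
  moreover have "morphism_of \<tau> h p (single 0 c) = c" for c
    using morphism_of_apply[OF const_in_coord_ring] hc toric_variety_const[OF p] by metis
  moreover have "morphism_of \<tau> h p \<in> extensional (carrier (coord_ring \<tau>))"
    by (simp add: morphism_of_def)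
  ultimately show ?thesis by (simp add: toric_variety_def)
qed

text \<open>Transfers the dimension of X_\<sigma> to its image. Surjectivity of \<open>h\<close>
  gives both injectivity and closedness, as every function on X_\<sigma> is the restriction of one
  on X_\<tau>.\<close>

lemma closed_embedding_homeomorphic:
  assumes h: "closed_embedding \<sigma> \<tau> h"
  shows "zariski \<sigma> homeomorphic_space subtopology (zariski \<tau>) (morphism_of \<tau> h ` toric_variety \<sigma>)"
proof -
  let ?\<phi> = "morphism_of \<tau> h" and ?Y = "morphism_of \<tau> h ` toric_variety \<sigma>"
  have Y: "?Y \<subseteq> toric_variety \<tau>" using morphism_of_in_toric_variety[OF h] by blast
  have top: "topspace (subtopology (zariski \<tau>) ?Y) = ?Y"
    using Y by (simp add: topspace_subtopology Int_absorb1)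
  have "homeomorphic_map (zariski \<sigma>) (subtopology (zariski \<tau>) ?Y) ?\<phi>"
  proof (rule bijective_closed_imp_homeomorphic_map)
    show "continuous_map (zariski \<sigma>) (subtopology (zariski \<tau>) ?Y) ?\<phi>"
      unfolding continuous_map_in_subtopology
    proof (intro conjI)
      show "?\<phi> \<in> topspace (zariski \<sigma>) \<rightarrow> ?Y" by simp
      show "continuous_map (zariski \<sigma>) (zariski \<tau>) ?\<phi>"
        unfolding continuous_map_closedin
      proof (intro conjI ballI allI impI)
        show "?\<phi> \<in> topspace (zariski \<sigma>) \<rightarrow> topspace (zariski \<tau>)"
          using morphism_of_in_toric_variety[OF h] by simp
        fix C assume "closedin (zariski \<tau>) C"
        then obtain F where F: "F \<subseteq> carrier (coord_ring \<tau>)" "C = {p \<in> toric_variety \<tau>. \<forall>f\<in>F. p f = 0}"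
          unfolding closedin_zariski by (elim exE conjE) (rule that)
        have "{p \<in> topspace (zariski \<sigma>). ?\<phi> p \<in> C} = {p \<in> toric_variety \<sigma>. \<forall>f\<in>h ` F. p f = 0}"
          using F morphism_of_in_toric_variety[OF h] by (auto simp: morphism_of_apply subset_iff)
        moreover have "h ` F \<subseteq> carrier (coord_ring \<sigma>)"
          using F(1) closed_embedding_maps(1)[OF h] by blast
        ultimately show "closedin (zariski \<sigma>) {p \<in> topspace (zariski \<sigma>). ?\<phi> p \<in> C}"
          unfolding closedin_zariski by (intro exI[of _ "h ` F"] conjI)
      qed
    qed
    show "closed_map (zariski \<sigma>) (subtopology (zariski \<tau>) ?Y) ?\<phi>"
      unfolding closed_map_def
    proof (intro allI impI)
      fix C assume "closedin (zariski \<sigma>) C"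
      then obtain F where F: "F \<subseteq> carrier (coord_ring \<sigma>)" "C = {p \<in> toric_variety \<sigma>. \<forall>f\<in>F. p f = 0}"
        unfolding closedin_zariski by (elim exE conjE) (rule that)
      define F' where "F' = {f \<in> carrier (coord_ring \<tau>). h f \<in> F}"
      have "(\<forall>f\<in>F. p f = 0) \<longleftrightarrow> (\<forall>f\<in>F'. ?\<phi> p f = 0)" for p
      proof
        assume l: "\<forall>f\<in>F'. ?\<phi> p f = 0"
        show "\<forall>f\<in>F. p f = 0"
        proof
          fix g assume g: "g \<in> F"
          then obtain f where "f \<in> carrier (coord_ring \<tau>)" "h f = g"
            using closed_embedding_maps(2)[OF h] F(1) by blast
          then show "p g = 0" using l g by (auto simp: F'_def morphism_of_apply)
        qed
      qed (auto simp: F'_def morphism_of_apply)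
      then have "?\<phi> ` C = {q \<in> toric_variety \<tau>. \<forall>f\<in>F'. q f = 0} \<inter> ?Y"
        using F(2) Y by auto
      moreover have "closedin (zariski \<tau>) {q \<in> toric_variety \<tau>. \<forall>f\<in>F'. q f = 0}"
        unfolding closedin_zariski by (intro exI[of _ F']) (auto simp: F'_def)
      ultimately show "closedin (subtopology (zariski \<tau>) ?Y) (?\<phi> ` C)"
        unfolding closedin_subtopology by (intro exI[of _ "{q \<in> toric_variety \<tau>. \<forall>f\<in>F'. q f = 0}"] conjI)
    qed
    show "?\<phi> ` topspace (zariski \<sigma>) = topspace (subtopology (zariski \<tau>) ?Y)"
      unfolding top by simp
    show "inj_on ?\<phi> (topspace (zariski \<sigma>))"
    proof (rule inj_onI)
      fix p p' assume p: "p \<in> topspace (zariski \<sigma>)" "p' \<in> topspace (zariski \<sigma>)" and eq: "?\<phi> p = ?\<phi> p'"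
      show "p = p'"
      proof (rule extensionalityI[of _ "carrier (coord_ring \<sigma>)"])
        show "p \<in> extensional (carrier (coord_ring \<sigma>))" "p' \<in> extensional (carrier (coord_ring \<sigma>))"
          using p by (auto simp: toric_variety_def)
        fix g assume "g \<in> carrier (coord_ring \<sigma>)"
        then obtain f where f: "f \<in> carrier (coord_ring \<tau>)" "h f = g"
          using closed_embedding_maps(2)[OF h] by blast
        then show "p g = p' g" using fun_cong[OF eq, of f] by (simp add: morphism_of_apply)
      qed
    qed
  qed
  then show ?thesis using homeomorphic_space by blast
qed

text \<open>A functional that is at least 1 on all primitive generators, multiplied by a bound K for
  their coordinates, stays in the dual semigroup after adding any unit vector; it serves as
  \<open>w\<close> in \<open>krull_dim_zariski\<close>.\<close>

lemma krull_dim_strongly_convex: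
  fixes C :: "(real ^ 'd) set"
  assumes "rational_polyhedral_cone C" "strongly_convex C"
  shows "krull_dim (zariski C) = enat (CARD('d))"
proof -
  note rcr = rational_cone_rays[OF assms]
  obtain m where m: "\<And>\<xi>. \<xi> \<in> rays C \<Longrightarrow> 1 \<le> scalar_product m (ray_gen \<xi>)" using rcr(4) by blast
  define K where "K = (\<Sum>\<xi>\<in>rays C. \<Sum>s\<in>UNIV. \<bar>ray_gen \<xi> $ s\<bar>)"
  have K: "\<bar>ray_gen \<xi> $ s\<bar> \<le> K" if "\<xi> \<in> rays C" for \<xi> s
  proof -
    have "\<bar>ray_gen \<xi> $ s\<bar> \<le> (\<Sum>s\<in>UNIV. \<bar>ray_gen \<xi> $ s\<bar>)" by (rule member_le_sum) auto
    also have "\<dots> \<le> K" unfolding K_def using that rcr(1) by (intro member_le_sum) (auto intro: sum_nonneg)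
    finally show ?thesis .
  qed
  have Kpos: "K \<ge> 0" unfolding K_def by (intro sum_nonneg) auto
  have ax: "scalar_product (axis s 1) v = v $ s" for s and v :: "int ^ 'd"
    by (simp add: scalar_product_def axis_def if_distrib[of "\<lambda>x. x * _"] cong: if_cong)
  have Km: "K \<le> K * scalar_product m (ray_gen \<xi>)" if "\<xi> \<in> rays C" for \<xi>
    using mult_left_mono[OF m[OF that] Kpos] by simp
  have "K *s m \<in> dual_semigroup C"
    unfolding rcr(3) using Km Kpos by (force simp: scalar_product_linear)
  moreover have "K *s m + axis s 1 \<in> dual_semigroup C" for s
    unfolding rcr(3)
  proof (intro CollectI ballI)
    fix \<xi> assume \<xi>: "\<xi> \<in> rays C"
    show "0 \<le> scalar_product (K *s m + axis s 1) (ray_gen \<xi>)"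
      using Km[OF \<xi>] K[OF \<xi>, of s] by (simp add: scalar_product_linear ax)
  qed
  ultimately show ?thesis by (rule krull_dim_zariski)
qed

section \<open>The cone of a Minkowski decomposition\<close>

lemma sum_Plus_UNIV:
  fixes f :: "'a::finite + 'b::finite \<Rightarrow> 'c::comm_monoid_add"
  shows "(\<Sum>s\<in>UNIV. f s) = (\<Sum>i\<in>UNIV. f (Inl i)) + (\<Sum>j\<in>UNIV. f (Inr j))"
  unfolding UNIV_Plus_UNIV[symmetric] by (subst sum.Plus) simp_all

lemma sum_option_UNIV:
  fixes f :: "'a::finite option \<Rightarrow> 'c::comm_monoid_add"
  shows "(\<Sum>s\<in>UNIV. f s) = f None + (\<Sum>j\<in>UNIV. f (Some j))"
  unfolding UNIV_option_conv by (subst sum.insert) (auto simp: sum.reindex)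

lemma vec_append_simps [simp]:
  "vec_append x a $ Inl i = x $ i" "vec_append x a $ Inr j = a $ j"
  by (simp_all add: vec_append_def)

lemma vec_append_eq_iff:
  fixes u v :: "'a ^ ('n::finite + 'k::finite)"
  shows "u = v \<longleftrightarrow> (\<forall>i. u $ Inl i = v $ Inl i) \<and> (\<forall>j. u $ Inr j = v $ Inr j)"
  unfolding vec_eq_iff by (metis sum.exhaust)

lemma vec_append_inner: "vec_append m c \<bullet> vec_append x a = m \<bullet> x + c \<bullet> a"
  by (simp add: inner_vec_def sum_Plus_UNIV)

lemma vec_append_linear:
  "vec_append x a + vec_append y b = vec_append (x + y) (a + b)"
  "t *\<^sub>R vec_append x a = vec_append (t *\<^sub>R x) (t *\<^sub>R a)"
  "vec_append 0 0 = 0" "- vec_append x a = vec_append (- x) (- a)"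
  by (simp_all add: vec_append_eq_iff)

lemma vec_append_split:
  fixes u :: "'a ^ ('n::finite + 'k::finite)"
  shows "u = vec_append (\<chi> i. u $ Inl i) (\<chi> j. u $ Inr j)"
  by (simp add: vec_append_eq_iff)

lemma real_vec_append: "real_vec (vec_append m c) = vec_append (real_vec m) (real_vec c)"
  by (simp add: vec_append_eq_iff)

text \<open>The Z^k component of the generators coming from Q_j, which treats Q_0 like the other
  summands. These k + 1 vectors sum to 0, so adding the generators (q_j, level j) over all j leads
  back to (q, 0).\<close>

definition level :: "'k::finite option \<Rightarrow> real ^ 'k" where
  "level j = (case j of None \<Rightarrow> - (\<Sum>i\<in>UNIV. axis i 1) | Some i \<Rightarrow> axis i 1)"

lemma level_nth: "level j $ i = (case j of None \<Rightarrow> - 1 | Some i' \<Rightarrow> if i = i' then 1 else 0)"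
  by (auto simp: level_def axis_def split: option.split)

lemma sum_level: "(\<Sum>j\<in>UNIV. level j) = 0"
  by (simp add: sum_option_UNIV level_def)

definition cayley_gens :: "(real ^ 'n) set \<Rightarrow> ('k::finite option \<Rightarrow> (real ^ 'n) set) \<Rightarrow> (real ^ ('n + 'k)) set" where
  "cayley_gens \<sigma> P = (\<lambda>x. vec_append x 0) ` \<sigma> \<union> (\<Union>j. (\<lambda>q. vec_append q (level j)) ` P j)"

lemma cayley_cone_gens: "cayley_cone \<sigma> P = convex_cone hull (cayley_gens \<sigma> P)"
proof -
  have "(\<Union>j. (\<lambda>q. vec_append q (level j)) ` P j) =
    (\<lambda>q. vec_append q (- (\<Sum>i\<in>UNIV. axis i 1))) ` P None \<union> (\<Union>i. (\<lambda>q. vec_append q (axis i 1)) ` P (Some i))"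
    by (simp add: UNIV_option_conv level_def)
  then show ?thesis unfolding cayley_cone_def cayley_gens_def by (simp add: Un_assoc)
qed

lemma cayley_gens_cases:
  assumes "x \<in> cayley_gens \<sigma> P"
  obtains s where "s \<in> \<sigma>" "x = vec_append s 0"
    | j q where "q \<in> P j" "x = vec_append q (level j)"
  using assms unfolding cayley_gens_def by blast

text \<open>Admitting 0 makes the set a cone, so strict positivity passes from generators to their
  hull.\<close>

lemma convex_cone_positive:
  fixes w :: "'a::real_inner"
  shows "convex_cone {x. x \<noteq> 0 \<longrightarrow> 0 < w \<bullet> x}"
  unfolding convex_cone_iff mem_Collect_eq Ball_def
proof (intro conjI allI impI)
  fix x y assume "x \<noteq> 0 \<longrightarrow> 0 < w \<bullet> x" "y \<noteq> 0 \<longrightarrow> 0 < w \<bullet> y" "x + y \<noteq> 0"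
  then show "0 < w \<bullet> (x + y)"
    by (cases "x = 0"; cases "y = 0") (simp_all add: inner_add_right)
next
  fix x and c :: real assume "x \<noteq> 0 \<longrightarrow> 0 < w \<bullet> x" "0 \<le> c" "c *\<^sub>R x \<noteq> 0"
  then show "0 < w \<bullet> (c *\<^sub>R x)" by simp
qed simp

lemma lattice_point_rational: "x \<in> lattice_points \<Longrightarrow> x $ i \<in> \<rat>"
  by (auto simp: lattice_points_def)

locale minkowski_decomposition =
  fixes \<sigma> Q :: "(real ^ 'n) set" and P :: "'k::finite option \<Rightarrow> (real ^ 'n) set"
  assumes cone: "rational_polyhedral_cone \<sigma>" and pointed: "strongly_convex \<sigma>"
    and full_dim: "dim \<sigma> = DIM(real ^ 'n)"
    and polyhedron_Q: "rational_polyhedron Q" and nonempty: "Q \<noteq> {}" and sub: "Q \<subseteq> \<sigma>" and zero: "0 \<notin> Q"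
    and decomp: "Q = (\<Sum>j\<in>UNIV. P j)"
    and lattice: "\<And>q p. q extreme_point_of Q \<Longrightarrow> (\<And>j. p j extreme_point_of P j) \<Longrightarrow>
           q = (\<Sum>j\<in>UNIV. p j) \<Longrightarrow> card {j. p j \<notin> lattice_points} \<le> 1"
begin

section \<open>Vertices of Q, their decompositions, and the big cone\<close>

lemma sigma_closed_cone: "convex_cone \<sigma>" "closed \<sigma>"
  using cone unfolding rational_polyhedral_cone_def
  by (auto intro: convex_cone_convex_cone_hull closed_convex_cone_hull)

lemma sigma_positive: "\<exists>w. \<forall>x\<in>\<sigma>. x \<noteq> 0 \<longrightarrow> 0 < w \<bullet> x"
proof -
  obtain F where F: "finite F" "\<sigma> = convex_cone hull F"
    using cone unfolding rational_polyhedral_cone_def by blast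
  have "F \<subseteq> convex_cone hull (F - {0})"
    using hull_subset[of "F - {0}" convex_cone] convex_cone_hull_contains_0 by blast
  then have "convex_cone hull F \<subseteq> convex_cone hull (F - {0})"
    by (rule hull_minimal) (rule convex_cone_convex_cone_hull)
  then have eq: "\<sigma> = convex_cone hull (F - {0})"
    using F(2) hull_mono[of "F - {0}" F convex_cone] by auto
  have "0 \<notin> F - {0}" by simp
  then obtain w where w: "\<forall>g\<in>F - {0}. 0 < w \<bullet> g"
    using strongly_convex_positive[OF finite_Diff[OF F(1)] _ eq pointed] by blast
  have "F - {0} \<subseteq> {x. x \<noteq> 0 \<longrightarrow> 0 < w \<bullet> x}" using w by blast
  then have "\<sigma> \<subseteq> {x. x \<noteq> 0 \<longrightarrow> 0 < w \<bullet> x}"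
    unfolding eq by (rule hull_minimal) (rule convex_cone_positive)
  then show ?thesis by blast
qed

lemma recession_in_sigma:
  assumes "\<And>t. t \<ge> 0 \<Longrightarrow> y + t *\<^sub>R v \<in> Q"
  shows "v \<in> \<sigma>"
  by (rule ray_in_closed_convex_cone[OF sigma_closed_cone, of y]) (rule subsetD[OF sub assms])

definition verts :: "(real ^ 'n) set" where
  "verts = {q. q extreme_point_of Q}"

lemma finite_verts: "finite verts"
proof -
  obtain H where H: "finite H" "Q = {x. \<forall>(a, b)\<in>H. a \<bullet> x \<le> b}"
    using polyhedron_Q unfolding rational_polyhedron_def by blast
  have "Q = \<Inter>((\<lambda>(a, b). {x. a \<bullet> x \<le> b}) ` H)" using H(2) by auto
  moreover have "polyhedron (\<Inter>((\<lambda>(a, b). {x. a \<bullet> x \<le> b}) ` H))"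
    using H(1) by (intro polyhedron_Inter) (auto simp: polyhedron_halfspace_le)
  ultimately show ?thesis unfolding verts_def using finite_polyhedron_extreme_points by metis
qed

lemma vert_rational:
  assumes "q \<in> verts"
  shows "q $ i \<in> \<rat>"
proof -
  obtain H where H: "finite H" "\<forall>(a, b)\<in>H. (\<forall>i. a $ i \<in> \<rat>) \<and> b \<in> \<rat>" "Q = {x. \<forall>(a, b)\<in>H. a \<bullet> x \<le> b}"
    using polyhedron_Q unfolding rational_polyhedron_def by blast
  have "q extreme_point_of Q" using assms by (simp add: verts_def)
  then show ?thesis by (rule extreme_point_rational[OF H(1,3,2)])
qed

text \<open>For a vertex the parts are vertices of the summands by
  \<open>extreme_point_of_summand\<close>, so the lattice hypothesis applies to this choice.\<close>

definition part :: "real ^ 'n \<Rightarrow> 'k option \<Rightarrow> real ^ 'n" where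
  "part q = (SOME p. (\<forall>j. p j \<in> P j) \<and> q = (\<Sum>j\<in>UNIV. p j))"

lemma part:
  assumes "q \<in> Q"
  shows "part q j \<in> P j" "(\<Sum>j\<in>UNIV. part q j) = q"
proof -
  have "\<exists>p. (\<forall>j. p j \<in> P j) \<and> q = (\<Sum>j\<in>UNIV. p j)"
    using assms unfolding decomp set_sum_alt[OF finite] by auto
  then have "(\<forall>j. part q j \<in> P j) \<and> q = (\<Sum>j\<in>UNIV. part q j)"
    unfolding part_def by (rule someI_ex)
  then show "part q j \<in> P j" "(\<Sum>j\<in>UNIV. part q j) = q" by auto
qed

lemma vert_in: "q \<in> verts \<Longrightarrow> q \<in> Q"
  by (simp add: verts_def extreme_point_of_def)

lemma part_lattice:
  assumes q: "q \<in> verts"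
  shows "card {j. part q j \<notin> lattice_points} \<le> 1"
proof (rule lattice)
  show e: "q extreme_point_of Q" using q by (simp add: verts_def)
  show "q = (\<Sum>j\<in>UNIV. part q j)" using part(2)[OF vert_in[OF q]] by simp
  show "part q j extreme_point_of P j" for j
  proof (rule extreme_point_of_summand)
    show "sum (part q) UNIV extreme_point_of sum P UNIV"
      using e part(2)[OF vert_in[OF q]] unfolding decomp[symmetric] by simp
  qed (rule part(1)[OF vert_in[OF q]])
qed

lemma part_lattice_except:
  assumes q: "q \<in> verts"
  shows "\<exists>j\<^sub>0. \<forall>j. j \<noteq> j\<^sub>0 \<longrightarrow> part q j \<in> lattice_points"
proof (cases "\<exists>j. part q j \<notin> lattice_points")
  case True
  then obtain j where j: "part q j \<notin> lattice_points" by blast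
  have "j' = j" if "part q j' \<notin> lattice_points" for j'
    using part_lattice[OF q] j that card_le_Suc0_iff_eq[of "{j. part q j \<notin> lattice_points}"] by auto
  then show ?thesis by blast
qed blast

text \<open>The parts other than the exceptional one are lattice points, and the exceptional one is
  the rational vertex q minus their sum.\<close>

lemma part_rational:
  assumes q: "q \<in> verts"
  shows "part q j $ i \<in> \<rat>"
proof (cases "part q j \<in> lattice_points")
  case False
  obtain j0 where j0: "\<And>j. j \<noteq> j0 \<Longrightarrow> part q j \<in> lattice_points" using part_lattice_except[OF q] by blast
  have j: "j = j0" using j0 False by blast
  have "q $ i = part q j $ i + (\<Sum>j'\<in>UNIV - {j}. part q j' $ i)"
    using arg_cong[OF part(2)[OF vert_in[OF q]], of "\<lambda>x. x $ i"] by (simp add: sum.remove[of UNIV j])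
  moreover have "(\<Sum>j'\<in>UNIV - {j}. part q j' $ i) \<in> \<rat>"
    using j0 by (intro Rats_sum lattice_point_rational) (auto simp: j)
  ultimately show ?thesis using vert_rational[OF q, of i] by (metis Rats_diff add_diff_cancel_right')
qed (rule lattice_point_rational)

text \<open>Q contains no line as \<sigma> is pointed, and m is nonnegative on the recession
  directions of Q, which lie in \<sigma>. So every point of Q is minorized by one of finitely many
  vertices. Replacing a single part of the best vertex stays in Q, hence each part is minimal in its
  summand.\<close>

lemma minimizing_vert:
  assumes m: "\<And>x. x \<in> \<sigma> \<Longrightarrow> 0 \<le> m \<bullet> x"
  shows "\<exists>q\<in>verts. \<forall>j. \<forall>x\<in>P j. m \<bullet> part q j \<le> m \<bullet> x"
proof -
  obtain H where H: "finite H" "Q = {x. \<forall>(a, b)\<in>H. a \<bullet> x \<le> b}"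
    using polyhedron_Q unfolding rational_polyhedron_def by blast
  obtain w where w: "\<And>x. x \<in> \<sigma> \<Longrightarrow> x \<noteq> 0 \<Longrightarrow> 0 < w \<bullet> x" using sigma_positive by blast
  have noline: "v = 0" if line: "\<And>t. y + t *\<^sub>R v \<in> Q" for y v
  proof (rule ccontr)
    assume "v \<noteq> 0"
    have "v \<in> \<sigma>" by (rule recession_in_sigma) (rule line)
    moreover have "- v \<in> \<sigma>"
    proof (rule recession_in_sigma)
      show "y + t *\<^sub>R - v \<in> Q" for t using line[of "- t"] by simp
    qed
    ultimately show False using w[of v] w[of "- v"] \<open>v \<noteq> 0\<close> by simp
  qed
  have minor: "\<exists>q\<in>verts. m \<bullet> q \<le> m \<bullet> x" if "x \<in> Q" for x
  proof -
    have "\<exists>q. q extreme_point_of Q \<and> m \<bullet> q \<le> m \<bullet> x"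
    proof (rule extreme_point_minorizes[OF H that])
      fix y v assume "\<And>t. y + t *\<^sub>R v \<in> Q"
      then show "v = 0" by (rule noline)
    next
      fix y v assume "\<And>t. t \<ge> 0 \<Longrightarrow> y + t *\<^sub>R v \<in> Q"
      then show "0 \<le> m \<bullet> v" by (intro m recession_in_sigma)
    qed
    then show ?thesis unfolding verts_def by blast
  qed
  then have "verts \<noteq> {}" using nonempty by blast
  then obtain q where q: "q \<in> verts" "\<And>q'. q' \<in> verts \<Longrightarrow> m \<bullet> q \<le> m \<bullet> q'"
    using arg_min_if_finite[OF finite_verts, of "\<lambda>q. m \<bullet> q"] by (metis linorder_not_less)
  have qmin: "m \<bullet> q \<le> m \<bullet> x" if "x \<in> Q" for x using minor[OF that] q(2) by (meson order_trans)
  have "m \<bullet> part q j \<le> m \<bullet> x" if x: "x \<in> P j" for j x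
  proof -
    define r where "r = (\<Sum>i\<in>UNIV - {j}. part q i)"
    have upd: "(\<Sum>i\<in>UNIV. ((part q)(j := y)) i) = y + r" for y
      by (simp add: sum.remove[of UNIV j] r_def)
    have "x + r \<in> Q"
      unfolding decomp set_sum_alt[OF finite] upd[symmetric] using x part(1)[OF vert_in[OF q(1)]]
      by (intro CollectI exI[of _ "(part q)(j := x)"]) auto
    moreover have "q = part q j + r" using upd[of "part q j"] part(2)[OF vert_in[OF q(1)]] by simp
    ultimately have "m \<bullet> (part q j + r) \<le> m \<bullet> (x + r)" using qmin by metis
    then show ?thesis by (simp add: inner_add_right)
  qed
  then show ?thesis using q(1) by blast
qed

lemma P_nonempty: "P j \<noteq> {}"
  using part(1) nonempty by fast

abbreviation "\<tau> \<equiv> cayley_cone \<sigma> P"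

lemma cone_tau: "convex_cone \<tau>"
  by (simp add: cayley_cone_gens convex_cone_convex_cone_hull)

lemma nonneg_on_gens:
  assumes m: "\<And>x. x \<in> \<sigma> \<Longrightarrow> 0 \<le> m \<bullet> x"
    and mc: "\<And>q j. q \<in> verts \<Longrightarrow> 0 \<le> m \<bullet> part q j + c \<bullet> level j"
    and x: "x \<in> cayley_gens \<sigma> P"
  shows "0 \<le> vec_append m c \<bullet> x"
  using x
proof (cases rule: cayley_gens_cases)
  case (1 s)
  then show ?thesis using m by (simp add: vec_append_inner)
next
  case (2 j y)
  obtain q where "q \<in> verts" "m \<bullet> part q j \<le> m \<bullet> y" using minimizing_vert[OF m] 2(1) by blast
  then show ?thesis using mc[of q j] 2(2) by (simp add: vec_append_inner)
qed

text \<open>Generators of \<sigma> and multiples of (q_j, level j) for vertices q of Q, with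
  denominators cleared, generate the cone: by \<open>minimizing_vert\<close> a functional
  nonnegative on these is nonnegative on all of \<open>cayley_gens\<close>, so separation shows that
  nothing is missing.\<close>

lemma rational_tau: "rational_polyhedral_cone \<tau>"
proof -
  obtain F where F: "finite F" "F \<subseteq> lattice_points" "\<sigma> = convex_cone hull F"
    using cone unfolding rational_polyhedral_cone_def by blast
  have "\<exists>N::nat. N > 0 \<and> real N *\<^sub>R part q j \<in> lattice_points" if "q \<in> verts" for q j
    using part_rational[OF that] by (rule rational_multiple_lattice_point)
  then obtain N where N: "\<And>q j. q \<in> verts \<Longrightarrow> N q j > (0::nat)"
      "\<And>q j. q \<in> verts \<Longrightarrow> real (N q j) *\<^sub>R part q j \<in> lattice_points"
    by metis
  define g where "g q j = real (N q j) *\<^sub>R vec_append (part q j) (level j)" for q j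
  define G where "G = (\<lambda>f. vec_append f 0) ` F \<union> (\<lambda>(q, j). g q j) ` (verts \<times> UNIV)"
  have finG: "finite G" using F(1) finite_verts by (simp add: G_def)
  have G_lattice: "G \<subseteq> lattice_points"
  proof
    fix x assume "x \<in> G"
    then consider f where "f \<in> F" "x = vec_append f 0" | q j where "q \<in> verts" "x = g q j"
      unfolding G_def by auto
    then show "x \<in> lattice_points"
    proof cases
      case 1
      then obtain v where "f = real_vec v" using F(2) by (auto simp: lattice_points_def)
      then have "x = real_vec (vec_append v 0)" using 1 by (simp add: real_vec_append)
      then show ?thesis unfolding lattice_points_def by (rule range_eqI)
    next
      case 2
      obtain v where v: "real (N q j) *\<^sub>R part q j = real_vec v"
        using N(2)[OF 2(1), of j] unfolding lattice_points_def by blast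
      define e :: "int ^ 'k" where "e = (\<chi> i. int (N q j) * (case j of None \<Rightarrow> - 1 | Some i' \<Rightarrow> if i = i' then 1 else 0))"
      have "real (N q j) *\<^sub>R level j = real_vec e"
        by (simp add: vec_eq_iff e_def level_nth split: option.split)
      then have "x = real_vec (vec_append v e)"
        unfolding 2(2) g_def by (simp add: vec_append_linear real_vec_append v)
      then show ?thesis unfolding lattice_points_def by (rule range_eqI)
    qed
  qed
  have cone_G: "convex_cone (convex_cone hull G)" by (rule convex_cone_convex_cone_hull)
  have "G \<subseteq> \<tau>"
  proof
    fix x assume "x \<in> G"
    then consider f where "f \<in> F" "x = vec_append f 0" | q j where "q \<in> verts" "x = g q j"
      unfolding G_def by auto
    then show "x \<in> \<tau>"
    proof cases
      case 1
      then have "x \<in> cayley_gens \<sigma> P" by (auto simp: cayley_gens_def F(3) hull_inc)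
      then show ?thesis by (simp add: cayley_cone_gens hull_inc)
    next
      case 2
      then have "vec_append (part q j) (level j) \<in> cayley_gens \<sigma> P"
        unfolding cayley_gens_def using part(1)[OF vert_in[OF 2(1)], of j] by (intro UnI2 UN_I[of j] imageI) simp_all
      then have "vec_append (part q j) (level j) \<in> \<tau>" by (simp add: cayley_cone_gens hull_inc)
      then show ?thesis unfolding 2(2) g_def by (intro convex_cone_scaleR cone_tau) auto
    qed
  qed
  then have "convex_cone hull G \<subseteq> \<tau>" by (intro hull_minimal cone_tau)
  moreover have "cayley_gens \<sigma> P \<subseteq> convex_cone hull G"
  proof
    fix x assume x: "x \<in> cayley_gens \<sigma> P"
    show "x \<in> convex_cone hull G"
    proof (rule ccontr)
      assume "x \<notin> convex_cone hull G"
      then obtain u where u: "\<And>y. y \<in> convex_cone hull G \<Longrightarrow> 0 \<le> u \<bullet> y" "u \<bullet> x < 0"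
        using closed_convex_cone_separate[OF cone_G closed_convex_cone_hull[OF finG]] by blast
      define m where "m = (\<chi> i. u $ Inl i)"
      define c where "c = (\<chi> i. u $ Inr i)"
      have umc: "u = vec_append m c" unfolding m_def c_def by (rule vec_append_split)
      have "0 \<le> m \<bullet> f" if "f \<in> F" for f
      proof -
        have "vec_append f 0 \<in> convex_cone hull G" using that by (intro hull_inc) (simp add: G_def)
        then show ?thesis using u(1) by (force simp: umc vec_append_inner)
      qed
      then have "\<sigma> \<subseteq> {x. 0 \<le> m \<bullet> x}"
        unfolding F(3) by (intro hull_minimal convex_cone_halfspace_ge) auto
      then have m: "0 \<le> m \<bullet> x" if "x \<in> \<sigma>" for x using that by blast
      have "0 \<le> m \<bullet> part q j + c \<bullet> level j" if q: "q \<in> verts" for q j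
      proof -
        have "g q j \<in> convex_cone hull G" using q by (intro hull_inc) (auto simp: G_def)
        then have "0 \<le> u \<bullet> g q j" by (rule u(1))
        then have "0 \<le> real (N q j) * (m \<bullet> part q j + c \<bullet> level j)"
          by (simp add: g_def umc vec_append_linear vec_append_inner algebra_simps)
        then show ?thesis using N(1)[OF q, of j] by (simp add: zero_le_mult_iff)
      qed
      then have "0 \<le> u \<bullet> x" unfolding umc by (intro nonneg_on_gens m x)
      then show False using u(2) by simp
    qed
  qed
  then have "\<tau> \<subseteq> convex_cone hull G" unfolding cayley_cone_gens by (intro hull_minimal cone_G)
  ultimately show ?thesis using finG G_lattice unfolding rational_polyhedral_cone_def
    by (intro exI[of _ G]) auto
qed

text \<open>A functional positive on \<sigma> away from 0 is extended by c so that its minimum over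
  every piece (P j, level j) is the same \<delta> > 0; it is then positive on the whole cone away
  from 0.\<close>

lemma pointed_tau: "strongly_convex \<tau>"
proof -
  obtain m where m: "\<And>x. x \<in> \<sigma> \<Longrightarrow> x \<noteq> 0 \<Longrightarrow> 0 < m \<bullet> x" using sigma_positive by blast
  have m0: "0 \<le> m \<bullet> x" if "x \<in> \<sigma>" for x using m[OF that] by (cases "x = 0") auto
  obtain q where q: "q \<in> verts" "\<And>j x. x \<in> P j \<Longrightarrow> m \<bullet> part q j \<le> m \<bullet> x"
    using minimizing_vert[OF m0] by blast
  define h where "h j = m \<bullet> part q j" for j
  \<comment> \<open>The average of the minima \<open>h j\<close>, whose sum is m \<bullet> q: as the
    levels sum to 0, no other common value is possible. It is positive because 0 \<notin> Q.\<close>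
  define \<delta> where "\<delta> = m \<bullet> q / (CARD('k) + 1)"
  have "q \<in> \<sigma>" "q \<noteq> 0" using vert_in[OF q(1)] sub zero by auto
  then have "m \<bullet> q > 0" using m by blast
  then have \<delta>: "\<delta> > 0" by (simp add: \<delta>_def)
  have sum_h: "(\<Sum>j\<in>UNIV. h j) = (CARD('k) + 1) * \<delta>"
    using arg_cong[OF part(2)[OF vert_in[OF q(1)]], of "\<lambda>x. m \<bullet> x"]
    by (simp add: h_def \<delta>_def inner_sum_right)
  define c :: "real ^ 'k" where "c = (\<chi> i. \<delta> - h (Some i))"
  have lev: "h j + c \<bullet> level j = \<delta>" for j
  proof (cases j)
    case None
    have "c \<bullet> level None = - (\<Sum>i\<in>UNIV. c $ i)"
      by (simp add: level_def inner_sum_right inner_axis)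
    also have "\<dots> = (\<Sum>i\<in>UNIV. h (Some i)) - CARD('k) * \<delta>" by (simp add: c_def sum_subtractf)
    finally show ?thesis using sum_h unfolding sum_option_UNIV None by (simp add: algebra_simps)
  qed (simp add: level_def inner_axis c_def)
  let ?K = "{x. x \<noteq> 0 \<longrightarrow> 0 < vec_append m c \<bullet> x}"
  have "cayley_gens \<sigma> P \<subseteq> ?K"
  proof
    fix x assume "x \<in> cayley_gens \<sigma> P"
    then show "x \<in> ?K"
    proof (cases rule: cayley_gens_cases)
      case (1 s)
      then show ?thesis using m[of s] by (cases "s = 0") (simp_all add: vec_append_inner vec_append_linear(3))
    next
      case (2 j y)
      have "h j \<le> m \<bullet> y" using q(2)[OF 2(1)] by (simp add: h_def)
      then show ?thesis using \<delta> lev[of j] 2(2) by (simp add: vec_append_inner)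
    qed
  qed
  then have "\<tau> \<subseteq> ?K" unfolding cayley_cone_gens by (intro hull_minimal convex_cone_positive)
  then have pos: "0 < vec_append m c \<bullet> x" if "x \<in> \<tau>" "x \<noteq> 0" for x using that by blast
  have "x = 0" if "x \<in> \<tau>" "- x \<in> \<tau>" for x
  proof (rule ccontr)
    assume "x \<noteq> 0"
    then show False using pos[OF that(1)] pos[OF that(2)] by simp
  qed
  moreover have "0 \<in> \<tau>" by (rule convex_cone_contains_0[OF cone_tau])
  ultimately show ?thesis unfolding strongly_convex_def by force
qed

lemmas tau_rays = rational_cone_rays[OF rational_tau pointed_tau]

section \<open>Dual semigroup and rays of the big cone\<close>

lemma dual_tau: "u \<in> dual_semigroup \<tau> \<longleftrightarrow> (\<forall>x\<in>cayley_gens \<sigma> P. 0 \<le> real_vec u \<bullet> x)"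
  unfolding cayley_cone_gens by (rule dual_semigroup_hull)

lemma restrict_dual_in:
  assumes "u \<in> dual_semigroup \<tau>"
  shows "restrict_dual u \<in> dual_semigroup \<sigma>"
  unfolding dual_semigroup_def
proof (intro CollectI ballI)
  fix x assume "x \<in> \<sigma>"
  then have "vec_append x 0 \<in> cayley_gens \<sigma> P" by (auto simp: cayley_gens_def)
  then have "0 \<le> real_vec u \<bullet> vec_append x 0" using assms dual_tau by blast
  also have "real_vec u = vec_append (real_vec (restrict_dual u)) (\<chi> j. real_vec u $ Inr j)"
    by (simp add: vec_append_eq_iff restrict_dual_def)
  finally show "0 \<le> real_vec (restrict_dual u) \<bullet> x" by (simp add: vec_append_inner)
qed

text \<open>The at most one nonintegral summand \<open>m \<bullet> q\<^sub>j\<close> loses less than \<open>1\<close> when rounded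
  down, so the rounded values still have a nonnegative sum.\<close>

lemma restrict_dual_surj:
  assumes mdual: "m \<in> dual_semigroup \<sigma>"
  shows "\<exists>u\<in>dual_semigroup \<tau>. restrict_dual u = m"
proof -
  have m: "0 \<le> real_vec m \<bullet> x" if "x \<in> \<sigma>" for x using mdual that by (simp add: dual_semigroup_def)
  obtain q where q: "q \<in> verts" "\<And>j x. x \<in> P j \<Longrightarrow> real_vec m \<bullet> part q j \<le> real_vec m \<bullet> x"
    using minimizing_vert[OF m] by blast
  define h where "h j = real_vec m \<bullet> part q j" for j
  obtain j0 where j0: "\<And>j. j \<noteq> j0 \<Longrightarrow> part q j \<in> lattice_points" using part_lattice_except[OF q(1)] by blast
  have h_int: "of_int \<lfloor>h j\<rfloor> = h j" if j: "j \<noteq> j0" for j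
  proof -
    obtain v where "part q j = real_vec v" using j0[OF j] by (auto simp: lattice_points_def)
    then show ?thesis by (simp add: h_def real_vec_inner)
  qed
  have "0 \<le> real_vec m \<bullet> q" using vert_in[OF q(1)] sub m by blast
  also have "real_vec m \<bullet> q = (\<Sum>j\<in>UNIV. h j)"
    using arg_cong[OF part(2)[OF vert_in[OF q(1)]], of "\<lambda>x. real_vec m \<bullet> x"] by (simp add: h_def inner_sum_right)
  also have "\<dots> = h j0 + (\<Sum>j\<in>UNIV - {j0}. of_int \<lfloor>h j\<rfloor>)"
    by (simp add: sum.remove[of UNIV j0] h_int)
  \<comment> \<open>Strictness matters: an integer greater than -1 is nonnegative.\<close>
  also have "\<dots> < of_int \<lfloor>h j0\<rfloor> + 1 + (\<Sum>j\<in>UNIV - {j0}. of_int \<lfloor>h j\<rfloor>)" by simp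
  also have "\<dots> = of_int ((\<Sum>j\<in>UNIV. \<lfloor>h j\<rfloor>) + 1)" by (simp add: sum.remove[of UNIV j0])
  finally have "0 \<le> (\<Sum>j\<in>UNIV. \<lfloor>h j\<rfloor>)" by linarith
  then have floor_sum: "0 \<le> \<lfloor>h None\<rfloor> + (\<Sum>i\<in>UNIV. \<lfloor>h (Some i)\<rfloor>)" by (simp add: sum_option_UNIV)
  \<comment> \<open>At \<open>Some i\<close> the fractional part of \<open>h (Some i)\<close>
    remains. At \<open>None\<close> the floors are added to \<open>h None\<close>, which gives at
    least the nonnegative sum of all floors.\<close>
  define c :: "int ^ 'k" where "c = (\<chi> i. - \<lfloor>h (Some i)\<rfloor>)"
  have lev: "0 \<le> h j + real_vec c \<bullet> level j" for j
  proof (cases j)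
    case None
    have "real_vec c \<bullet> level None = - (\<Sum>i\<in>UNIV. of_int (c $ i))"
      by (simp add: level_def inner_sum_right inner_axis)
    also have "\<dots> = of_int (\<Sum>i\<in>UNIV. \<lfloor>h (Some i)\<rfloor>)" by (simp add: c_def sum_negf)
    finally have "real_vec c \<bullet> level j = of_int (\<Sum>i\<in>UNIV. \<lfloor>h (Some i)\<rfloor>)" unfolding None .
    moreover have "0 \<le> real_of_int (\<lfloor>h None\<rfloor> + (\<Sum>i\<in>UNIV. \<lfloor>h (Some i)\<rfloor>))"
      using floor_sum by (simp only: of_int_0_le_iff)
    moreover have "of_int \<lfloor>h None\<rfloor> \<le> h j" unfolding None by (rule of_int_floor_le)
    ultimately show ?thesis unfolding of_int_add by linarith
  next
    case (Some i)
    have "real_vec c \<bullet> level j = - of_int \<lfloor>h (Some i)\<rfloor>" by (simp add: Some level_def inner_axis c_def)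
    then show ?thesis using Some by simp
  qed
  have "vec_append m c \<in> dual_semigroup \<tau>"
    unfolding dual_tau real_vec_append
  proof
    fix x assume "x \<in> cayley_gens \<sigma> P"
    then show "0 \<le> vec_append (real_vec m) (real_vec c) \<bullet> x"
    proof (cases rule: cayley_gens_cases)
      case (1 s)
      then show ?thesis using m by (simp add: vec_append_inner)
    next
      case (2 j y)
      have "h j \<le> real_vec m \<bullet> y" using q(2)[OF 2(1)] by (simp add: h_def)
      then show ?thesis using lev[of j] 2(2) by (simp add: vec_append_inner)
    qed
  qed
  moreover have "restrict_dual (vec_append m c) = m" by (simp add: restrict_dual_def vec_eq_iff)
  ultimately show ?thesis by blast
qed

text \<open>The rays span: full dimension of \<sigma> kills the component of t in M, and one point
  of each \<open>P (Some i)\<close> kills the remaining coordinates. Thus a character is determined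
  by its pairings with the rays.\<close>

lemma pairing_eq_0D:
  assumes "\<And>\<xi>. \<xi> \<in> rays \<tau> \<Longrightarrow> scalar_product t (ray_gen \<xi>) = 0"
  shows "t = 0"
proof -
  have "t \<in> dual_semigroup \<tau>" "- t \<in> dual_semigroup \<tau>"
    unfolding tau_rays(3) using assms by (auto simp: scalar_product_linear)
  then have orth: "real_vec t \<bullet> x = 0" if "x \<in> cayley_gens \<sigma> P" for x
    using that unfolding dual_tau by (force intro: antisym)
  define m where "m = (\<chi> i. real_vec t $ Inl i)"
  define c where "c = (\<chi> i. real_vec t $ Inr i)"
  have tmc: "real_vec t = vec_append m c" unfolding m_def c_def by (rule vec_append_split)
  have "m \<bullet> x = 0" if "x \<in> \<sigma>" for x
  proof -
    have "vec_append x 0 \<in> cayley_gens \<sigma> P" using that by (auto simp: cayley_gens_def)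
    then show ?thesis using orth by (force simp: tmc vec_append_inner)
  qed
  then have "\<sigma> \<subseteq> {x. m \<bullet> x = 0}" by blast
  then have "span \<sigma> \<subseteq> {x. m \<bullet> x = 0}" by (intro span_minimal subspace_hyperplane)
  moreover have "span \<sigma> = UNIV" using full_dim dim_eq_full[of \<sigma>] by blast
  ultimately have "m \<bullet> m = 0" by blast
  then have m0: "m = 0" by simp
  have "c $ i = 0" for i
  proof -
    obtain y where "y \<in> P (Some i)" using P_nonempty by blast
    then have "vec_append y (level (Some i)) \<in> cayley_gens \<sigma> P" by (auto simp: cayley_gens_def)
    then have "vec_append m c \<bullet> vec_append y (level (Some i)) = 0" using orth tmc by metis
    then show ?thesis by (simp add: vec_append_inner m0 level_def inner_axis)
  qed
  then have "c = 0" by (simp add: vec_eq_iff)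
  then have "real_vec t = 0" by (simp add: tmc m0 vec_append_linear)
  then show ?thesis by simp
qed

text \<open>An edge contains a nonzero member of \<open>cayley_gens\<close>, so its primitive vector
  is a positive multiple of that member.\<close>

lemma ray_types:
  assumes \<xi>: "\<xi> \<in> rays \<tau>"
  shows "(\<forall>i. ray_gen \<xi> $ Inr i = 0) \<or>
    (\<exists>j d. \<exists>q\<in>P j. 0 < d \<and> real_vec (ray_gen \<xi>) = d *\<^sub>R vec_append q (level j))"
proof -
  have face: "\<xi> face_of \<tau>" using \<xi> by (simp add: rays_def edge_of_def)
  have v: "ray_gen \<xi> \<noteq> 0" "\<xi> = half_line (real_vec (ray_gen \<xi>))" using tau_rays(2)[OF \<xi>] by auto
  have "real_vec (ray_gen \<xi>) \<in> half_line (real_vec (ray_gen \<xi>))"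
    unfolding in_half_line by (intro exI[of _ 1]) simp
  then have "real_vec (ray_gen \<xi>) \<in> \<xi>" by (rule subsetD[OF equalityD2[OF v(2)]])
  moreover have "real_vec (ray_gen \<xi>) \<noteq> 0" using v(1) by simp
  ultimately obtain s where s: "s \<in> cayley_gens \<sigma> P" "s \<in> \<xi>" "s \<noteq> 0"
    using face_contains_generator[OF face cayley_cone_gens] by blast
  have "s \<in> half_line (real_vec (ray_gen \<xi>))" by (rule subsetD[OF equalityD1[OF v(2)] s(2)])
  then obtain t where t: "t \<ge> 0" "s = t *\<^sub>R real_vec (ray_gen \<xi>)" unfolding in_half_line by blast
  have "t > 0" using t s(3) by (cases "t = 0") auto
  then have gen: "real_vec (ray_gen \<xi>) = (1 / t) *\<^sub>R s" using t(2) by simp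
  from s(1) show ?thesis
  proof (cases rule: cayley_gens_cases)
    case (1 x)
    have "real_vec (ray_gen \<xi>) $ Inr i = 0" for i unfolding gen 1(2) by simp
    then show ?thesis by simp
  next
    case (2 j q)
    then show ?thesis using gen \<open>t > 0\<close> by (intro disjI2 exI[of _ j] exI[of _ "1 / t"] bexI[of _ q]) auto
  qed
qed

end

section \<open>The complete intersection\<close>

lemma additive_single: "Modules.additive (single a)"
  by standard (simp add: single_add)

lemma toric_comorphism_lin_sum:
  "toric_comorphism L = lin_sum (\<lambda>u. single (L u))"
  by (simp add: fun_eq_iff toric_comorphism_def lin_sum_def)

lemma additive_times: "Modules.additive (\<lambda>c::complex. c * x)"
  by standard (simp add: algebra_simps)

lemma toric_variety_expand:
  assumes p: "p \<in> toric_variety \<sigma>" and f: "f \<in> carrier (coord_ring \<sigma>)"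
  shows "p f = lin_sum (\<lambda>u c. c * p (single u 1)) f"
proof -
  have c: "single u c \<in> carrier (coord_ring \<sigma>)" if "u \<in> dual_semigroup \<sigma>" for u c
    using that by (simp add: carrier_coord_ring)
  have keys: "u \<in> dual_semigroup \<sigma>" if "u \<in> keys f" for u
    using f that by (auto simp: carrier_coord_ring)
  have single: "p (single u c) = c * p (single u 1)" if u: "u \<in> dual_semigroup \<sigma>" for u c
  proof -
    have "single u c = single 0 c * single u 1" by (simp add: mult_single)
    then show ?thesis
      using toric_variety_mult[OF p const_in_coord_ring c[OF u]] toric_variety_const[OF p] by metis
  qed
  have "p f = p (\<Sum>u\<in>keys f. single u (lookup f u))"
    using poly_mapping_expansion[of f] by simp
  also have "\<dots> = (\<Sum>u\<in>keys f. p (single u (lookup f u)))"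
    by (intro conjunct2[OF toric_variety_sum[OF p]] c keys)
  also have "\<dots> = (\<Sum>u\<in>keys f. lookup f u * p (single u 1))"
    by (intro sum.cong refl single keys)
  finally show ?thesis by (simp add: lin_sum_def)
qed

lemma restrict_dual_add: "restrict_dual (u + v) = restrict_dual u + restrict_dual v" "restrict_dual 0 = 0"
  by (simp_all add: restrict_dual_def vec_eq_iff)

lemma lin_sum_toric_comorphism:
  fixes \<phi> :: "int ^ 'n \<Rightarrow> complex \<Rightarrow> complex"
  assumes "\<And>a. Modules.additive (\<phi> a)"
  shows "lin_sum \<phi> (toric_comorphism L f) = lin_sum (\<lambda>u. \<phi> (L u)) f"
  unfolding toric_comorphism_def additive.sum[OF additive_lin_sum[OF assms]] lin_sum_single[OF assms]
  by (simp add: lin_sum_def)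

lemma keys_toric_comorphism:
  assumes "\<And>u. u \<in> keys f \<Longrightarrow> L u \<in> S"
  shows "keys (toric_comorphism L f) \<subseteq> S"
proof -
  have "keys (toric_comorphism L f) \<subseteq>
      (\<Union>u\<in>keys f. keys (single (L u) (lookup f u)))"
    unfolding toric_comorphism_def by (rule keys_sum)
  also have "\<dots> \<subseteq> S" using assms by auto
  finally show ?thesis .
qed

lemma prod_cox_var:
  assumes "finite S"
  shows "(\<Prod>\<xi>\<in>S. cox_var \<xi> ^ n \<xi>) = single (\<Sum>\<xi>\<in>S. single \<xi> (n \<xi>)) 1"
proof -
  have pow: "cox_var \<xi> ^ m = single (single \<xi> m) 1" for \<xi> :: "(real ^ 'd) set" and m
  proof (induction m)
    case (Suc m)
    then show ?case by (simp add: cox_var_def mult_single single_add[symmetric])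
  qed simp
  show ?thesis
    using assms by induction (simp_all add: pow mult_single)
qed

context minkowski_decomposition
begin

lemma closed_embedding_restrict_dual: "closed_embedding \<sigma> \<tau> (toric_comorphism restrict_dual)"
proof -
  let ?h = "toric_comorphism restrict_dual :: (int ^ ('n + 'k) \<Rightarrow>\<^sub>0 complex) \<Rightarrow> (int ^ 'n \<Rightarrow>\<^sub>0 complex)"
  interpret \<tau>: cring "coord_ring \<tau>" by (rule cring_coord_ring)
  have single: "?h (single u c) = single (restrict_dual u) c" for u c
    unfolding toric_comorphism_lin_sum by (rule lin_sum_single) (rule additive_single)
  have closed: "?h f \<in> carrier (coord_ring \<sigma>)" if "f \<in> carrier (coord_ring \<tau>)" for f
    using that restrict_dual_in unfolding carrier_coord_ring
    by (intro CollectI keys_toric_comorphism) auto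
  have "?h \<in> ring_hom (coord_ring \<tau>) (coord_ring \<sigma>)"
  proof (rule ring_hom_memI)
    fix f g assume fg: "f \<in> carrier (coord_ring \<tau>)" "g \<in> carrier (coord_ring \<tau>)"
    have "?h (f * g) = ?h f * ?h g"
      unfolding toric_comorphism_lin_sum
      by (rule lin_sum_mult[where S = UNIV]) (simp_all add: additive_single mult_single restrict_dual_add)
    then show "?h (f \<otimes>\<^bsub>coord_ring \<tau>\<^esub> g) = ?h f \<otimes>\<^bsub>coord_ring \<sigma>\<^esub> ?h g" by (simp add: coord_ring_def)
    have "?h (f + g) = ?h f + ?h g"
      unfolding toric_comorphism_lin_sum by (intro additive.add additive_lin_sum additive_single)
    then show "?h (f \<oplus>\<^bsub>coord_ring \<tau>\<^esub> g) = ?h f \<oplus>\<^bsub>coord_ring \<sigma>\<^esub> ?h g" by (simp add: coord_ring_def)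
  next
    show "?h \<one>\<^bsub>coord_ring \<tau>\<^esub> = \<one>\<^bsub>coord_ring \<sigma>\<^esub>"
      using single[of 0 1] by (simp add: coord_ring_def restrict_dual_add)
  qed (rule closed)
  moreover have "?h (single 0 c) = single 0 c" for c
    by (simp add: single restrict_dual_add)
  moreover have "?h ` carrier (coord_ring \<tau>) = carrier (coord_ring \<sigma>)"
  proof (intro equalityI subsetI)
    fix g assume g: "g \<in> carrier (coord_ring \<sigma>)"
    \<comment> \<open>Chosen monomial by monomial; \<open>lift\<close> need not be additive, since
      only a preimage of \<open>g\<close> is wanted.\<close>
    obtain lift where lift: "\<And>m. m \<in> dual_semigroup \<sigma> \<Longrightarrow> lift m \<in> dual_semigroup \<tau> \<and> restrict_dual (lift m) = m"
      using restrict_dual_surj by metis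
    have keys: "m \<in> dual_semigroup \<sigma>" if "m \<in> keys g" for m
      using g that by (auto simp: carrier_coord_ring)
    have "?h (toric_comorphism lift g) = (\<Sum>m\<in>keys g. single (restrict_dual (lift m)) (lookup g m))"
      unfolding toric_comorphism_def[of lift] unfolding toric_comorphism_lin_sum
        additive.sum[OF additive_lin_sum[OF additive_single]] lin_sum_single[OF additive_single] ..
    also have "\<dots> = g"
      using lift keys by (subst poly_mapping_expansion[of g]) (intro sum.cong refl, simp)
    finally have "?h (toric_comorphism lift g) = g" .
    moreover have "toric_comorphism lift g \<in> carrier (coord_ring \<tau>)"
      unfolding carrier_coord_ring using lift keys by (intro CollectI keys_toric_comorphism) blast
    ultimately show "g \<in> ?h ` carrier (coord_ring \<tau>)" by (metis image_eqI)
  qed (use closed in blast)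
  ultimately show ?thesis by (simp add: closed_embedding_def)
qed

text \<open>On the rays coming from \<open>Q\<^sub>0\<close> all coordinates in \<open>\<int>\<^sup>k\<close> agree, so an arbitrary index serves
  for \<open>None\<close>.\<close>

definition height :: "'k option \<Rightarrow> (real ^ ('n + 'k)) set \<Rightarrow> nat" where
  "height j \<xi> = nat (case j of None \<Rightarrow> - (ray_gen \<xi> $ Inr undefined) | Some i \<Rightarrow> ray_gen \<xi> $ Inr i)"

definition block :: "'k option \<Rightarrow> (real ^ ('n + 'k)) set \<Rightarrow>\<^sub>0 nat" where
  "block j = (\<Sum>\<xi>\<in>rays \<tau>. single \<xi> (height j \<xi>))"

lemma lookup_block: "lookup (block j) \<xi> = (if \<xi> \<in> rays \<tau> then height j \<xi> else 0)"
  using tau_rays(1) by (simp add: block_def lookup_sum lookup_single when_def)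

lemma ray_level:
  assumes d: "real_vec v = d *\<^sub>R vec_append q (level j)"
  shows "real_of_int (v $ Inr i) = (case j of None \<Rightarrow> - d | Some i' \<Rightarrow> if i = i' then d else 0)"
  using arg_cong[OF d, of "\<lambda>x. x $ Inr i"] by (simp add: level_nth split: option.splits)

text \<open>At a ray through (q, level j0) with multiple d only the height at j0 is nonzero, and it
  equals d; at a ray with zero Z^k component all heights are 0. Hence a ray belongs to at most one
  block.\<close>

lemma ray_height:
  assumes \<xi>: "\<xi> \<in> rays \<tau>"
  shows "ray_gen \<xi> $ Inr i = int (height (Some i) \<xi>) - int (height None \<xi>)"
    and "height j \<xi> > 0 \<Longrightarrow> j' \<noteq> j \<Longrightarrow> height j' \<xi> = 0"
    and "height j \<xi> > 0 \<Longrightarrow> \<exists>q\<in>P j. real_vec (ray_gen \<xi>) = real (height j \<xi>) *\<^sub>R vec_append q (level j)"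
proof -
  consider "\<forall>i. ray_gen \<xi> $ Inr i = 0"
    | j0 d q where "q \<in> P j0" "0 < d" "real_vec (ray_gen \<xi>) = d *\<^sub>R vec_append q (level j0)"
    using ray_types[OF \<xi>] by blast
  then have "(ray_gen \<xi> $ Inr i = int (height (Some i) \<xi>) - int (height None \<xi>)) \<and>
    (height j \<xi> > 0 \<longrightarrow> j' \<noteq> j \<longrightarrow> height j' \<xi> = 0) \<and>
    (height j \<xi> > 0 \<longrightarrow> (\<exists>q\<in>P j. real_vec (ray_gen \<xi>) = real (height j \<xi>) *\<^sub>R vec_append q (level j)))"
  proof cases
    case 1
    then have "height j \<xi> = 0" for j by (simp add: height_def split: option.split)
    then show ?thesis using 1 by simp
  next
    case 2
    note lev = ray_level[OF 2(3)]
    have h: "height j \<xi> = (if j = j0 then nat \<lfloor>d\<rfloor> else 0)" "real (height j0 \<xi>) = d" for j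
    proof -
      \<comment> \<open>d is an integer because it is, up to sign, a coordinate of the primitive
        vector.\<close>
      obtain D :: int where D: "d = of_int D"
      proof (cases j0)
        case None
        then have "d = of_int (- (ray_gen \<xi> $ Inr undefined))" using lev[of undefined] by simp
        then show ?thesis by (rule that)
      next
        case (Some i)
        then have "d = of_int (ray_gen \<xi> $ Inr i)" using lev[of i] by simp
        then show ?thesis by (rule that)
      qed
      have v: "ray_gen \<xi> $ Inr i = (case j0 of None \<Rightarrow> - D | Some i' \<Rightarrow> if i = i' then D else 0)" for i
      proof -
        have "real_of_int (ray_gen \<xi> $ Inr i) = of_int (case j0 of None \<Rightarrow> - D | Some i' \<Rightarrow> if i = i' then D else 0)"
          using lev[of i] by (simp add: D split: option.splits)
        then show ?thesis unfolding of_int_eq_iff .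
      qed
      have "D > 0" using 2(2) D by simp
      then have h: "height j \<xi> = (if j = j0 then nat D else 0)" for j
        by (auto simp: height_def v split: option.splits)
      then show "height j \<xi> = (if j = j0 then nat \<lfloor>d\<rfloor> else 0)" by (simp add: D)
      show "real (height j0 \<xi>) = d" using h[of j0] \<open>D > 0\<close> by (simp add: D)
    qed
    have "real_of_int (ray_gen \<xi> $ Inr i) = real_of_int (int (height (Some i) \<xi>) - int (height None \<xi>))"
    proof (cases j0)
      case None
      then have "height (Some i) \<xi> = 0" "real (height None \<xi>) = d" using h by auto
      then show ?thesis using lev[of i] None by simp
    next
      case (Some i0)
      have "height None \<xi> = 0" using h(1)[of None] Some by simp
      moreover have "real (height (Some i) \<xi>) = (if i = i0 then d else 0)"
      proof (cases "i = i0")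
        case True
        then show ?thesis using h(2) Some by simp
      next
        case False
        then show ?thesis using h(1)[of "Some i"] Some by simp
      qed
      ultimately show ?thesis using lev[of i] Some by simp
    qed
    then have "ray_gen \<xi> $ Inr i = int (height (Some i) \<xi>) - int (height None \<xi>)" unfolding of_int_eq_iff .
    moreover have "height j \<xi> > 0 \<longrightarrow> j' \<noteq> j \<longrightarrow> height j' \<xi> = 0" using h(1)[of j] h(1)[of j'] by auto
    moreover have "height j \<xi> > 0 \<longrightarrow> j = j0" using h(1)[of j] by auto
    ultimately show ?thesis using 2(1,3) h(2) by auto
  qed
  then show "ray_gen \<xi> $ Inr i = int (height (Some i) \<xi>) - int (height None \<xi>)"
    and "height j \<xi> > 0 \<Longrightarrow> j' \<noteq> j \<Longrightarrow> height j' \<xi> = 0"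
    and "height j \<xi> > 0 \<Longrightarrow> \<exists>q\<in>P j. real_vec (ray_gen \<xi>) = real (height j \<xi>) *\<^sub>R vec_append q (level j)"
    by auto
qed

lemma scalar_product_dual_basis: "scalar_product (dual_basis i) v = v $ Inr i"
  by (simp add: scalar_product_def sum_Plus_UNIV dual_basis_def axis_def if_distrib[of "\<lambda>x. x * _"] cong: if_cong)

text \<open>With the value 0 at \<open>None\<close>, the difference
  \<open>lev_dual i - lev_dual j\<close> pairs with each ray to height i minus height j for all
  indices alike; adding it to an exponent trades y_j for y_i.\<close>

definition lev_dual :: "'k option \<Rightarrow> int ^ ('n + 'k)" where
  "lev_dual j = (case j of None \<Rightarrow> 0 | Some i \<Rightarrow> dual_basis i)"

lemma pairing_lev_dual:
  assumes "\<xi> \<in> rays \<tau>"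
  shows "scalar_product (lev_dual j) (ray_gen \<xi>) = int (height j \<xi>) - int (height None \<xi>)"
  using ray_height(1)[OF assms]
  by (cases j) (simp_all add: lev_dual_def scalar_product_linear scalar_product_dual_basis)

lemma restrict_lev_dual: "restrict_dual (lev_dual j) = 0"
  by (cases j) (simp_all add: lev_dual_def restrict_dual_def dual_basis_def vec_eq_iff)

text \<open>Without a ray of positive height j, a dual basis vector (for \<open>None\<close>) or the
  negative of the i-th one (for \<open>Some i\<close>) would be nonnegative on all rays, hence in
  the dual, yet it is -1 on the generators coming from \<open>P j\<close>.\<close>

lemma block_nonempty: "\<exists>\<xi>\<in>rays \<tau>. height j \<xi> > 0"
proof (rule ccontr)
  assume "\<not> ?thesis"
  then have 0: "height j \<xi> = 0" if "\<xi> \<in> rays \<tau>" for \<xi> using that by auto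
  obtain y where y: "y \<in> P j" using P_nonempty by blast
  then have gen: "vec_append y (level j) \<in> cayley_gens \<sigma> P" by (auto simp: cayley_gens_def)
  define i :: 'k where "i = (case j of None \<Rightarrow> undefined | Some i \<Rightarrow> i)"
  define u :: "int ^ ('n + 'k)" where "u = (case j of None \<Rightarrow> dual_basis i | Some _ \<Rightarrow> - dual_basis i)"
  have "u \<in> dual_semigroup \<tau>"
    unfolding tau_rays(3)
  proof (intro CollectI ballI)
    fix \<xi> assume \<xi>: "\<xi> \<in> rays \<tau>"
    show "0 \<le> scalar_product u (ray_gen \<xi>)"
      using ray_height(1)[OF \<xi>, of i] 0[OF \<xi>]
      by (cases j) (simp_all add: u_def i_def scalar_product_linear scalar_product_dual_basis)
  qed
  then have "0 \<le> real_vec u \<bullet> vec_append y (level j)" using gen dual_tau by blast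
  moreover have "real_vec (dual_basis i) \<bullet> vec_append y (level j) = level j $ i"
  proof -
    have "real_vec (dual_basis i) = vec_append (0 :: real ^ 'n) (axis i 1)"
      by (simp add: vec_append_eq_iff dual_basis_def axis_def)
    then show ?thesis by (simp add: vec_append_inner inner_axis' )
  qed
  moreover have "real_vec u \<bullet> vec_append y (level j) = - 1"
    using calculation(2) by (cases j) (simp_all add: u_def i_def level_nth)
  ultimately show False by simp
qed

sublocale block_binomials "rays \<tau>" None block
proof
  show "finite (rays \<tau>)" by (rule tau_rays(1))
  show "keys (block j) \<subseteq> rays \<tau>" for j
    by (auto simp: in_keys_iff lookup_block split: if_splits)
  show "keys (block j) \<noteq> {}" for j
  proof -
    obtain \<xi> where "\<xi> \<in> rays \<tau>" "height j \<xi> > 0" using block_nonempty by blast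
    then have "\<xi> \<in> keys (block j)" by (simp add: in_keys_iff lookup_block)
    then show ?thesis by blast
  qed
  show "keys (block i) \<inter> keys (block j) = {}" if "i \<noteq> j" for i j
  proof (rule ccontr)
    assume "keys (block i) \<inter> keys (block j) \<noteq> {}"
    then obtain \<xi> where "\<xi> \<in> keys (block i)" "\<xi> \<in> keys (block j)" by blast
    then have "\<xi> \<in> rays \<tau>" "height i \<xi> > 0" "height j \<xi> > 0"
      by (auto simp: in_keys_iff lookup_block split: if_splits)
    then show False using ray_height(2)[of \<xi> i j] \<open>i \<noteq> j\<close> by auto
  qed
qed

section \<open>The binomials in the Cox ring\<close>

lemma cox_ring_eq: "cox_ring \<tau> = A"
  by (simp add: cox_ring_def)

text \<open>No ray has positive height at both \<open>Some i\<close> and \<open>None\<close>, so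
  these two heights are the positive and negative parts of the pairing with the i-th dual basis
  vector.\<close>

lemma cox_binomial_eq: "cox_binomial \<tau> i = bin (Some i)"
proof -
  have a: "scalar_product (dual_basis i) (ray_gen \<xi>) = int (height (Some i) \<xi>) - int (height None \<xi>)"
    if "\<xi> \<in> rays \<tau>" for \<xi>
    using ray_height(1)[OF that] by (simp add: scalar_product_dual_basis)
  have excl: "height (Some i) \<xi> = 0 \<or> height None \<xi> = 0" if "\<xi> \<in> rays \<tau>" for \<xi>
    using ray_height(2)[OF that, of "Some i" None] by (cases "height (Some i) \<xi> > 0") auto
  have "(\<Sum>\<xi>\<in>{\<xi> \<in> rays \<tau>. scalar_product (dual_basis i) (ray_gen \<xi>) > 0}.
      single \<xi> (nat (scalar_product (dual_basis i) (ray_gen \<xi>)))) = block (Some i)"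
    unfolding block_def
  proof (rule sum.mono_neutral_cong_left[OF tau_rays(1)])
    show "\<forall>\<xi>\<in>rays \<tau> - {\<xi> \<in> rays \<tau>. scalar_product (dual_basis i) (ray_gen \<xi>) > 0}.
        single \<xi> (height (Some i) \<xi>) = 0"
    proof
      fix \<xi> assume "\<xi> \<in> rays \<tau> - {\<xi> \<in> rays \<tau>. scalar_product (dual_basis i) (ray_gen \<xi>) > 0}"
      then have "height (Some i) \<xi> = 0" using a[of \<xi>] excl[of \<xi>] by auto
      then show "single \<xi> (height (Some i) \<xi>) = 0" by simp
    qed
    show "single \<xi> (nat (scalar_product (dual_basis i) (ray_gen \<xi>))) =
        single \<xi> (height (Some i) \<xi>)"
      if "\<xi> \<in> {\<xi> \<in> rays \<tau>. scalar_product (dual_basis i) (ray_gen \<xi>) > 0}" for \<xi>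
      using that a[of \<xi>] excl[of \<xi>] by auto
  qed blast
  moreover have "(\<Sum>\<xi>\<in>{\<xi> \<in> rays \<tau>. scalar_product (dual_basis i) (ray_gen \<xi>) < 0}.
      single \<xi> (nat (- scalar_product (dual_basis i) (ray_gen \<xi>)))) = block None"
    unfolding block_def
  proof (rule sum.mono_neutral_cong_left[OF tau_rays(1)])
    show "\<forall>\<xi>\<in>rays \<tau> - {\<xi> \<in> rays \<tau>. scalar_product (dual_basis i) (ray_gen \<xi>) < 0}.
        single \<xi> (height None \<xi>) = 0"
    proof
      fix \<xi> assume "\<xi> \<in> rays \<tau> - {\<xi> \<in> rays \<tau>. scalar_product (dual_basis i) (ray_gen \<xi>) < 0}"
      then have "height None \<xi> = 0" using a[of \<xi>] excl[of \<xi>] by auto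
      then show "single \<xi> (height None \<xi>) = 0" by simp
    qed
    show "single \<xi> (nat (- scalar_product (dual_basis i) (ray_gen \<xi>))) =
        single \<xi> (height None \<xi>)"
      if "\<xi> \<in> {\<xi> \<in> rays \<tau>. scalar_product (dual_basis i) (ray_gen \<xi>) < 0}" for \<xi>
      using that a[of \<xi>] excl[of \<xi>] by auto
  qed blast
  ultimately show ?thesis
    using tau_rays(1) by (simp add: cox_binomial_def Let_def prod_cox_var bin_def)
qed

text \<open>The exponents of y_i and y_0 differ by the pairings with the i-th dual basis vector,
  which represent 0 in the grading group.\<close>

lemma cox_degree_block: "cox_degree \<tau> (b + block (Some i)) = cox_degree \<tau> (b + block None)"
proof -
  have shift: "int (lookup (b + block (Some i)) \<xi>) =
      int (lookup (b + block None) \<xi>) + scalar_product (dual_basis i) (ray_gen \<xi>)"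
    if "\<xi> \<in> rays \<tau>" for \<xi>
    using that ray_height(1)[OF that, of i] by (simp add: lookup_add lookup_block scalar_product_dual_basis)
  have "(\<exists>m. \<forall>\<xi>\<in>rays \<tau>. \<beta> \<xi> = int (lookup (b + block (Some i)) \<xi>) + scalar_product m (ray_gen \<xi>)) \<longleftrightarrow>
    (\<exists>m. \<forall>\<xi>\<in>rays \<tau>. \<beta> \<xi> = int (lookup (b + block None) \<xi>) + scalar_product m (ray_gen \<xi>))" for \<beta>
  proof (intro iffI; elim exE)
    fix m assume "\<forall>\<xi>\<in>rays \<tau>. \<beta> \<xi> = int (lookup (b + block (Some i)) \<xi>) + scalar_product m (ray_gen \<xi>)"
    then show "\<exists>m. \<forall>\<xi>\<in>rays \<tau>. \<beta> \<xi> = int (lookup (b + block None) \<xi>) + scalar_product m (ray_gen \<xi>)"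
      using shift by (intro exI[of _ "m + dual_basis i"]) (simp add: scalar_product_linear)
  next
    fix m assume "\<forall>\<xi>\<in>rays \<tau>. \<beta> \<xi> = int (lookup (b + block None) \<xi>) + scalar_product m (ray_gen \<xi>)"
    then show "\<exists>m. \<forall>\<xi>\<in>rays \<tau>. \<beta> \<xi> = int (lookup (b + block (Some i)) \<xi>) + scalar_product m (ray_gen \<xi>)"
      using shift by (intro exI[of _ "m - dual_basis i"]) (simp add: scalar_product_linear)
  qed
  then show ?thesis unfolding cox_degree_def by simp
qed

lemma cox_homogeneous_bin: "cox_homogeneous \<tau> (bin (Some i))"
proof -
  have "keys (bin (Some i)) \<subseteq> {block (Some i), block None}"
    using keys_diff[of "single (block (Some i)) (1::complex)" "single (block None) 1"]
    by (auto simp: bin_def)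
  then show ?thesis
    unfolding cox_homogeneous_def using cox_degree_block[of 0 i]
    by (intro exI[of _ "cox_degree \<tau> (block None)"]) auto
qed

abbreviation "I\<^sub>\<tau> \<equiv> genideal A (bin ` range Some)"

lemma homogeneous_ideal_tau: "homogeneous_ideal \<tau> I\<^sub>\<tau>"
  unfolding homogeneous_ideal_def homogeneous_component_def cox_ring_eq
proof (intro conjI ballI allI genideal_bin)
  fix f \<gamma> assume f: "f \<in> I\<^sub>\<tau>"
  show "(\<Sum>a\<in>{a \<in> keys f. cox_degree \<tau> a = \<gamma>}. single a (lookup f a)) \<in> I\<^sub>\<tau>"
    by (rule genideal_component[OF _ f]) (auto simp: cox_degree_block)
qed

lemma cox_eval_eq_ev:
  assumes "f \<in> carrier A"
  shows "cox_eval x f = ev x f"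
  unfolding cox_eval_def ev_def lin_sum_def mon_def
proof (intro sum.cong refl arg_cong2[where f = "(*)"])
  fix a assume "a \<in> keys f"
  then have "keys a \<subseteq> rays \<tau>" using assms by auto
  then show "(\<Prod>\<xi>\<in>keys a. x \<xi> ^ lookup a \<xi>) = (\<Prod>\<xi>\<in>rays \<tau>. x \<xi> ^ lookup a \<xi>)"
    using tau_rays(1) by (intro prod.mono_neutral_left) (auto simp: in_keys_iff)
qed

lemma vanishes_on_ideal_iff:
  "(\<forall>f\<in>I\<^sub>\<tau>. cox_eval x f = 0) \<longleftrightarrow> (\<forall>j. mon x (block j) = mon x (block None))"
proof
  assume l: "\<forall>f\<in>I\<^sub>\<tau>. cox_eval x f = 0"
  show "\<forall>j. mon x (block j) = mon x (block None)"
  proof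
    fix j
    show "mon x (block j) = mon x (block None)"
    proof (cases j)
      case (Some i)
      have "bin ` range Some \<subseteq> I\<^sub>\<tau>" using bin_carrier by (intro genideal_self) auto
      then have "bin (Some i) \<in> I\<^sub>\<tau>" by blast
      then have "ev x (bin (Some i)) = 0" using l cox_eval_eq_ev[OF bin_carrier] by metis
      then show ?thesis by (simp add: ev_bin Some)
    qed simp
  qed
next
  assume r: "\<forall>j. mon x (block j) = mon x (block None)"
  show "\<forall>f\<in>I\<^sub>\<tau>. cox_eval x f = 0"
  proof
    fix f assume f: "f \<in> I\<^sub>\<tau>"
    have "ev x f = 0" by (rule genideal_ev[OF f]) (use r in blast)
    then show "cox_eval x f = 0" using cox_eval_eq_ev[OF ideal.Icarr[OF genideal_bin f]] by simp
  qed
qed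

text \<open>The character of u pulled back to Cox space; truncation by \<open>nat\<close> is
  harmless for u in the dual semigroup.\<close>

definition cox_mon :: "((real ^ ('n + 'k)) set \<Rightarrow> complex) \<Rightarrow> int ^ ('n + 'k) \<Rightarrow> complex" where
  "cox_mon x u = (\<Prod>\<xi>\<in>rays \<tau>. x \<xi> ^ nat (scalar_product u (ray_gen \<xi>)))"

lemma cox_quotient_eq:
  "cox_quotient \<tau> x = restrict (lin_sum (\<lambda>u c. c * cox_mon x u)) (carrier (coord_ring \<tau>))"
  unfolding cox_quotient_def lin_sum_def cox_mon_def ..

section \<open>Values of characters at solutions of the equations\<close>

lemma pairing_nonneg: "u \<in> dual_semigroup \<tau> \<Longrightarrow> \<xi> \<in> rays \<tau> \<Longrightarrow> 0 \<le> scalar_product u (ray_gen \<xi>)"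
  by (simp add: tau_rays(3))

lemma cox_mon_add:
  assumes "u \<in> dual_semigroup \<tau>" "v \<in> dual_semigroup \<tau>"
  shows "cox_mon x (u + v) = cox_mon x u * cox_mon x v"
  unfolding cox_mon_def prod.distrib[symmetric]
  by (intro prod.cong refl)
    (simp add: scalar_product_linear nat_add_distrib pairing_nonneg[OF assms(1)] pairing_nonneg[OF assms(2)] power_add)

lemma cox_mon_0: "cox_mon x 0 = 1"
  by (simp add: cox_mon_def scalar_product_linear)

lemma mon_block: "mon x (block j) = (\<Prod>\<xi>\<in>rays \<tau>. x \<xi> ^ height j \<xi>)"
  unfolding mon_def by (intro prod.cong) (simp_all add: lookup_block)

lemma pairing_by_levels:
  assumes r: "restrict_dual u = restrict_dual u'" and \<xi>: "\<xi> \<in> rays \<tau>"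
  shows "scalar_product u (ray_gen \<xi>) - scalar_product u' (ray_gen \<xi>) =
    (\<Sum>i\<in>UNIV. (u $ Inr i - u' $ Inr i) * (int (height (Some i) \<xi>) - int (height None \<xi>)))"
proof -
  have "u $ Inl i = u' $ Inl i" for i using arg_cong[OF r, of "\<lambda>m. m $ i"] by (simp add: restrict_dual_def)
  then show ?thesis
    by (simp add: scalar_product_def sum_Plus_UNIV algebra_simps sum_subtractf ray_height(1)[OF \<xi>, symmetric])
qed

text \<open>If all blocks vanish at \<open>x\<close>, a monomial not vanishing at \<open>x\<close> has zero pairing with a point
  \<open>(q\<^sub>j, \<epsilon>\<^sub>j)\<close> for every \<open>j\<close>; as the \<open>\<epsilon>\<^sub>j\<close> sum to \<open>0\<close>, this determines it by its restriction.\<close>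

lemma cox_mon_eq_0:
  assumes x: "\<And>j. mon x (block j) = 0"
    and u: "u \<in> dual_semigroup \<tau>" and u': "u' \<in> dual_semigroup \<tau>"
    and r: "restrict_dual u = restrict_dual u'" and ne: "u \<noteq> u'"
  shows "cox_mon x u = 0"
proof (rule ccontr)
  assume nz: "cox_mon x u \<noteq> 0"
  have "\<exists>q\<in>P j. real_vec u \<bullet> vec_append q (level j) = 0" for j
  proof -
    obtain \<xi> where \<xi>: "\<xi> \<in> rays \<tau>" "x \<xi> ^ height j \<xi> = 0"
      using x[of j] tau_rays(1) unfolding mon_block by (auto simp: prod_zero_iff)
    then have "x \<xi> = 0" and h: "height j \<xi> > 0" by auto
    have "x \<xi> ^ nat (scalar_product u (ray_gen \<xi>)) \<noteq> 0"
      using nz \<xi>(1) tau_rays(1) unfolding cox_mon_def by (simp add: prod_zero_iff)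
    then have "nat (scalar_product u (ray_gen \<xi>)) = 0" using \<open>x \<xi> = 0\<close> by (metis gr0I zero_power)
    then have "scalar_product u (ray_gen \<xi>) = 0" using pairing_nonneg[OF u \<xi>(1)] by simp
    then have "real_vec u \<bullet> real_vec (ray_gen \<xi>) = 0" by (simp add: real_vec_inner)
    moreover obtain q where q: "q \<in> P j" "real_vec (ray_gen \<xi>) = real (height j \<xi>) *\<^sub>R vec_append q (level j)"
      using ray_height(3)[OF \<xi>(1) h] by blast
    ultimately have "real_vec u \<bullet> vec_append q (level j) = 0" using h by simp
    then show ?thesis using q(1) by blast
  qed
  then obtain q where q: "\<And>j. q j \<in> P j" "\<And>j. real_vec u \<bullet> vec_append (q j) (level j) = 0" by metis
  define m where "m = real_vec (restrict_dual u)"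
  define c :: "int ^ 'k" where "c = (\<chi> i. u $ Inr i)"
  define c' :: "int ^ 'k" where "c' = (\<chi> i. u' $ Inr i)"
  have um: "real_vec u = vec_append m (real_vec c)" "real_vec u' = vec_append m (real_vec c')"
    using r by (simp_all add: m_def c_def c'_def vec_append_eq_iff restrict_dual_def vec_eq_iff)
  \<comment> \<open>The values of u' at points where u vanishes. They are nonnegative, and their sum
    is that of the values of u, namely 0; so u' vanishes there as well.\<close>
  define t where "t j = m \<bullet> q j + real_vec c' \<bullet> level j" for j
  have "0 \<le> t j" for j
  proof -
    have "vec_append (q j) (level j) \<in> cayley_gens \<sigma> P" using q(1)[of j] by (auto simp: cayley_gens_def)
    then have "0 \<le> real_vec u' \<bullet> vec_append (q j) (level j)" using u' dual_tau by blast
    then show ?thesis by (simp add: t_def um vec_append_inner)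
  qed
  moreover have "(\<Sum>j\<in>UNIV. t j) = 0"
  proof -
    have sum_pairing: "(\<Sum>j\<in>UNIV. m \<bullet> q j + real_vec e \<bullet> level j) = (\<Sum>j\<in>UNIV. m \<bullet> q j)" for e :: "int ^ 'k"
      by (simp add: sum.distrib sum_level flip: inner_sum_right)
    have "m \<bullet> q j + real_vec c \<bullet> level j = 0" for j using q(2)[of j] by (simp add: um vec_append_inner)
    then have "(\<Sum>j\<in>UNIV. m \<bullet> q j) = 0" using sum_pairing[of c] by simp
    then show ?thesis unfolding t_def sum_pairing .
  qed
  ultimately have t0: "t j = 0" for j by (simp add: sum_nonneg_eq_0_iff)
  have "c $ i = c' $ i" for i
  proof -
    have "real_vec c \<bullet> level (Some i) = real_vec c' \<bullet> level (Some i)"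
      using t0[of "Some i"] q(2)[of "Some i"] by (simp add: t_def um vec_append_inner)
    then show ?thesis by (simp add: level_def inner_axis)
  qed
  then have "c = c'" by (simp add: vec_eq_iff)
  then have "real_vec u = real_vec u'" using um by simp
  then show False using ne by simp
qed

text \<open>If the common value of the blocks is 0, \<open>cox_mon_eq_0\<close> applies to both
  exponents. Otherwise they differ on the rays by integral combinations of the exponents of y_i /
  y_0, and these quotients are 1 at x.\<close>

lemma cox_mon_restrict:
  assumes x: "\<And>j. mon x (block j) = mon x (block None)"
    and u: "u \<in> dual_semigroup \<tau>" and u': "u' \<in> dual_semigroup \<tau>"
    and r: "restrict_dual u = restrict_dual u'"
  shows "cox_mon x u = cox_mon x u'"
proof (cases "mon x (block None) = 0")
  case True
  then have "mon x (block j) = 0" for j using x by simp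
  then show ?thesis using cox_mon_eq_0 u u' r by (cases "u = u'") metis+
next
  case False
  define e where "e i = u $ Inr i - u' $ Inr i" for i
  \<comment> \<open>Exponents are natural numbers, so \<open>e i\<close> is split into positive and
    negative part and both sides are multiplied by a common nonzero factor.\<close>
  define F where "F = (\<Prod>i\<in>UNIV. mon x (block None) ^ nat (e i) * mon x (block None) ^ nat (- e i))"
  have F0: "F \<noteq> 0" using False by (simp add: F_def)
  have eq: "nat (scalar_product u (ray_gen \<xi>)) + (\<Sum>i\<in>UNIV. height None \<xi> * nat (e i) + height (Some i) \<xi> * nat (- e i)) =
      nat (scalar_product u' (ray_gen \<xi>)) + (\<Sum>i\<in>UNIV. height (Some i) \<xi> * nat (e i) + height None \<xi> * nat (- e i))"
    if \<xi>: "\<xi> \<in> rays \<tau>" for \<xi>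
  proof -
    have ne: "e i = int (nat (e i)) - int (nat (- e i))" for i by simp
    have "scalar_product u (ray_gen \<xi>) - scalar_product u' (ray_gen \<xi>) =
      (\<Sum>i\<in>UNIV. (int (nat (e i)) - int (nat (- e i))) * (int (height (Some i) \<xi>) - int (height None \<xi>)))"
      unfolding pairing_by_levels[OF r \<xi>] e_def[symmetric] ne[symmetric] ..
    also have "\<dots> = (\<Sum>i\<in>UNIV. int (height (Some i) \<xi> * nat (e i) + height None \<xi> * nat (- e i))) -
        (\<Sum>i\<in>UNIV. int (height None \<xi> * nat (e i) + height (Some i) \<xi> * nat (- e i)))"
      unfolding sum_subtractf[symmetric] by (intro sum.cong) (simp_all only: of_nat_add of_nat_mult, simp only: algebra_simps)
    finally have "scalar_product u (ray_gen \<xi>) - scalar_product u' (ray_gen \<xi>) =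
        int (\<Sum>i\<in>UNIV. height (Some i) \<xi> * nat (e i) + height None \<xi> * nat (- e i)) -
        int (\<Sum>i\<in>UNIV. height None \<xi> * nat (e i) + height (Some i) \<xi> * nat (- e i))"
      unfolding of_nat_sum .
    moreover have "int (nat (scalar_product u (ray_gen \<xi>))) = scalar_product u (ray_gen \<xi>)"
        "int (nat (scalar_product u' (ray_gen \<xi>))) = scalar_product u' (ray_gen \<xi>)"
      using pairing_nonneg[OF u \<xi>] pairing_nonneg[OF u' \<xi>] by simp_all
    ultimately show ?thesis by linarith
  qed
  have A: "(\<Prod>\<xi>\<in>rays \<tau>. x \<xi> ^ (\<Sum>i\<in>UNIV. height (j i) \<xi> * nat (e i) + height (j' i) \<xi> * nat (- e i))) = F"
    for j j' :: "'k \<Rightarrow> 'k option"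
  proof -
    have "(\<Prod>\<xi>\<in>rays \<tau>. x \<xi> ^ (\<Sum>i\<in>UNIV. height (j i) \<xi> * nat (e i) + height (j' i) \<xi> * nat (- e i))) =
      (\<Prod>i\<in>UNIV. \<Prod>\<xi>\<in>rays \<tau>. x \<xi> ^ (height (j i) \<xi> * nat (e i) + height (j' i) \<xi> * nat (- e i)))"
      unfolding power_sum by (rule prod.swap)
    also have "\<dots> = (\<Prod>i\<in>UNIV. mon x (block (j i)) ^ nat (e i) * mon x (block (j' i)) ^ nat (- e i))"
      by (simp add: mon_block power_add power_mult prod.distrib prod_power_distrib)
    also have "\<dots> = F" unfolding F_def using x by metis
    finally show ?thesis .
  qed
  have "cox_mon x u * F = (\<Prod>\<xi>\<in>rays \<tau>. x \<xi> ^ (nat (scalar_product u (ray_gen \<xi>)) +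
      (\<Sum>i\<in>UNIV. height None \<xi> * nat (e i) + height (Some i) \<xi> * nat (- e i))))"
    unfolding cox_mon_def A[of "\<lambda>_. None" Some, symmetric] power_add prod.distrib ..
  also have "\<dots> = (\<Prod>\<xi>\<in>rays \<tau>. x \<xi> ^ (nat (scalar_product u' (ray_gen \<xi>)) +
      (\<Sum>i\<in>UNIV. height (Some i) \<xi> * nat (e i) + height None \<xi> * nat (- e i))))"
    by (intro prod.cong refl) (simp only: eq)
  also have "\<dots> = cox_mon x u' * F"
    unfolding cox_mon_def A[of Some "\<lambda>_. None", symmetric] power_add prod.distrib ..
  finally show ?thesis using F0 by simp
qed

abbreviation "toric_embedding \<equiv> morphism_of \<tau> (toric_comorphism restrict_dual)"

text \<open>The preimage takes on m the value of any lift of m. By \<open>cox_mon_restrict\<close>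
  the lift does not matter, which yields multiplicativity although \<open>lift\<close> need not be
  additive.\<close>

lemma vanishing_locus_subset:
  assumes p: "p \<in> vanishing_locus \<tau> I\<^sub>\<tau>"
  shows "p \<in> toric_embedding ` toric_variety \<sigma>"
proof -
  obtain x where px: "cox_quotient \<tau> x = p" and "\<forall>f\<in>I\<^sub>\<tau>. cox_eval x f = 0"
    using p unfolding vanishing_locus_def by blast
  then have x: "mon x (block j) = mon x (block None)" for j using vanishes_on_ideal_iff by blast
  obtain lift where lift: "\<And>m. m \<in> dual_semigroup \<sigma> \<Longrightarrow> lift m \<in> dual_semigroup \<tau>"
      "\<And>m. m \<in> dual_semigroup \<sigma> \<Longrightarrow> restrict_dual (lift m) = m"
    using restrict_dual_surj by metis
  define e where "e m = cox_mon x (lift m)" for m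
  have e: "e (restrict_dual u) = cox_mon x u" if u: "u \<in> dual_semigroup \<tau>" for u
    unfolding e_def using lift restrict_dual_in[OF u] by (intro cox_mon_restrict x u) auto
  define p' where "p' = restrict (lin_sum (\<lambda>u c. c * e u)) (carrier (coord_ring \<sigma>))"
  have "p' \<in> toric_variety \<sigma>"
    unfolding p'_def
  proof (rule toric_pointI)
    show "e 0 = 1" using e[OF zero_in_dual_semigroup] by (simp add: restrict_dual_add cox_mon_0)
    fix m m' assume m: "m \<in> dual_semigroup \<sigma>" "m' \<in> dual_semigroup \<sigma>"
    have "e (m + m') = e (restrict_dual (lift m + lift m'))" using m lift by (simp add: restrict_dual_add)
    also have "\<dots> = cox_mon x (lift m + lift m')" using m lift by (intro e dual_semigroup_add)
    also have "\<dots> = e m * e m'" unfolding e_def using m lift by (intro cox_mon_add)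
    finally show "e (m + m') = e m * e m'" .
  qed
  moreover have "toric_embedding p' = p"
  proof (rule extensionalityI[of _ "carrier (coord_ring \<tau>)"])
    show "toric_embedding p' \<in> extensional (carrier (coord_ring \<tau>))" by (simp add: morphism_of_def)
    show "p \<in> extensional (carrier (coord_ring \<tau>))" by (simp add: px[symmetric] cox_quotient_eq)
    fix f assume f: "f \<in> carrier (coord_ring \<tau>)"
    have "toric_embedding p' f = lin_sum (\<lambda>u c. c * e u) (toric_comorphism restrict_dual f)"
      using closed_embedding_maps(1)[OF closed_embedding_restrict_dual f] f
      by (simp add: morphism_of_apply p'_def)
    also have "\<dots> = lin_sum (\<lambda>u c. c * e (restrict_dual u)) f"
      by (rule lin_sum_toric_comorphism) (rule additive_times)
    also have "\<dots> = lin_sum (\<lambda>u c. c * cox_mon x u) f"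
      unfolding lin_sum_def using f e by (intro sum.cong) (auto simp: carrier_coord_ring)
    also have "\<dots> = p f" using f by (simp add: px[symmetric] cox_quotient_eq)
    finally show "toric_embedding p' f = p f" .
  qed
  ultimately show ?thesis by blast
qed

text \<open>The homogeneous coordinates of a point are chosen to vanish exactly at the rays on which all
  monomials not vanishing at the point are constant; the remaining coordinates come from
  extending a character to a free group.\<close>

lemma embed_in_vanishing_locus:
  assumes p: "p \<in> toric_variety \<sigma>"
  shows "toric_embedding p \<in> vanishing_locus \<tau> I\<^sub>\<tau>"
proof -
  define e :: "int ^ ('n + 'k) \<Rightarrow> complex" where "e u = p (single (restrict_dual u) 1)" for u
  have e0: "e 0 = 1" by (simp add: e_def restrict_dual_add toric_variety_zero_one(2)[OF p])
  have e_add: "e (u + v) = e u * e v" if "u \<in> dual_semigroup \<tau>" "v \<in> dual_semigroup \<tau>" for u v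
  proof -
    have "single (restrict_dual (u + v)) (1::complex) =
        single (restrict_dual u) 1 * single (restrict_dual v) 1"
      by (simp add: mult_single restrict_dual_add)
    moreover have "single (restrict_dual u) 1 \<in> carrier (coord_ring \<sigma>)"
        "single (restrict_dual v) 1 \<in> carrier (coord_ring \<sigma>)"
      using that restrict_dual_in by (auto simp: carrier_coord_ring)
    ultimately show ?thesis unfolding e_def using toric_variety_mult[OF p] by metis
  qed
  have e_restrict: "e u = e u'" if "restrict_dual u = restrict_dual u'" for u u' using that by (simp add: e_def)
  \<comment> \<open>The characters not vanishing at the point, a face of the dual semigroup;
    \<open>Z\<close> below consists of the rays orthogonal to it.\<close>
  define \<F> where "\<F> = {u \<in> dual_semigroup \<tau>. e u \<noteq> 0}"
  have F0: "0 \<in> \<F>" by (simp add: \<F>_def zero_in_dual_semigroup e0)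
  have F_add: "u + v \<in> \<F>" if "u \<in> \<F>" "v \<in> \<F>" for u v
    using that by (simp add: \<F>_def dual_semigroup_add e_add)
  have F_scale: "int n *s u \<in> \<F>" if "u \<in> \<F>" for n u
  proof (induction n)
    case (Suc n)
    have "int (Suc n) *s u = u + int n *s u" by (simp add: vec_eq_iff algebra_simps)
    then show ?case using F_add[OF that Suc] by simp
  qed (simp add: F0)
  have F_dual: "u \<in> dual_semigroup \<tau>" if "u \<in> \<F>" for u using that by (simp add: \<F>_def)
  define Z where "Z = {\<xi> \<in> rays \<tau>. \<forall>u\<in>\<F>. scalar_product u (ray_gen \<xi>) = 0}"
  \<comment> \<open>Adding up members of \<F>, one for each ray outside \<open>Z\<close>, gives
    \<open>u0\<close> in \<F> that is positive exactly off \<open>Z\<close>.\<close>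
  have pos_on: "\<exists>u\<in>\<F>. \<forall>\<xi>\<in>S. 1 \<le> scalar_product u (ray_gen \<xi>)" if "finite S" "S \<subseteq> rays \<tau> - Z" for S
    using that
  proof induction
    case (insert \<xi> S)
    then obtain u where u: "u \<in> \<F>" "\<forall>\<xi>\<in>S. 1 \<le> scalar_product u (ray_gen \<xi>)" by blast
    obtain v where v: "v \<in> \<F>" "scalar_product v (ray_gen \<xi>) \<noteq> 0" using insert.prems by (auto simp: Z_def)
    have "0 \<le> scalar_product v (ray_gen \<xi>)" using pairing_nonneg[OF F_dual[OF v(1)]] insert.prems by blast
    then have "1 \<le> scalar_product v (ray_gen \<xi>)" using v(2) by linarith
    moreover have "0 \<le> scalar_product u (ray_gen \<xi>)" using pairing_nonneg[OF F_dual[OF u(1)]] insert.prems by blast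
    moreover have "0 \<le> scalar_product v (ray_gen \<eta>)" if "\<eta> \<in> S" for \<eta>
      using pairing_nonneg[OF F_dual[OF v(1)]] insert.prems that by blast
    ultimately have "\<forall>\<eta>\<in>insert \<xi> S. 1 \<le> scalar_product (u + v) (ray_gen \<eta>)"
      using u(2) by (force simp: scalar_product_linear)
    then show ?case using F_add[OF u(1) v(1)] by blast
  qed (use F0 in blast)
  obtain u0 where u0: "u0 \<in> \<F>" "\<And>\<xi>. \<xi> \<in> rays \<tau> - Z \<Longrightarrow> 1 \<le> scalar_product u0 (ray_gen \<xi>)"
    using pos_on[of "rays \<tau> - Z"] tau_rays(1) by blast
  have u0_Z: "scalar_product u0 (ray_gen \<xi>) = 0" if "\<xi> \<in> Z" for \<xi> using that u0(1) by (simp add: Z_def)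
  \<comment> \<open>A large multiple of \<open>u0\<close> minus u stays in the dual, so u is a
    factor of a character that does not vanish at the point.\<close>
  have in_F: "u \<in> \<F>" if u: "u \<in> dual_semigroup \<tau>" and uZ: "\<And>\<xi>. \<xi> \<in> Z \<Longrightarrow> scalar_product u (ray_gen \<xi>) = 0" for u
  proof -
    define n where "n = nat (\<Sum>\<xi>\<in>rays \<tau>. scalar_product u (ray_gen \<xi>))"
    have le: "scalar_product u (ray_gen \<xi>) \<le> int n" if "\<xi> \<in> rays \<tau>" for \<xi>
    proof -
      have "scalar_product u (ray_gen \<xi>) \<le> (\<Sum>\<xi>\<in>rays \<tau>. scalar_product u (ray_gen \<xi>))"
        using that tau_rays(1) pairing_nonneg[OF u] by (intro member_le_sum) auto
      then show ?thesis by (simp add: n_def)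
    qed
    have "int n *s u0 - u \<in> dual_semigroup \<tau>"
      unfolding tau_rays(3)
    proof (intro CollectI ballI)
      fix \<xi> assume \<xi>: "\<xi> \<in> rays \<tau>"
      show "0 \<le> scalar_product (int n *s u0 - u) (ray_gen \<xi>)"
      proof (cases "\<xi> \<in> Z")
        case True
        then show ?thesis using u0_Z uZ by (simp add: scalar_product_linear)
      next
        case False
        then have "int n * 1 \<le> int n * scalar_product u0 (ray_gen \<xi>)" using u0(2) \<xi> by (intro mult_left_mono) auto
        then show ?thesis using le[OF \<xi>] by (simp add: scalar_product_linear)
      qed
    qed
    then have "e (int n *s u0) = e u * e (int n *s u0 - u)" using e_add[OF u] by (metis add_diff_cancel_left' add_diff_eq)
    moreover have "e (int n *s u0) \<noteq> 0" using F_scale[OF u0(1)] by (simp add: \<F>_def)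
    ultimately show ?thesis using u by (auto simp: \<F>_def)
  qed
  define R' where "R' = rays \<tau> - Z"
  have finR': "finite R'" using tau_rays(1) by (simp add: R'_def)
  \<comment> \<open>Exponents at the rays off \<open>Z\<close>, in a free abelian group. On \<F>
    nothing is lost: the pairings with \<open>Z\<close> vanish there, and the rays span.\<close>
  define \<rho> where "\<rho> u = (\<Sum>\<xi>\<in>R'. frag_cmul (scalar_product u (ray_gen \<xi>)) (frag_of \<xi>))" for u
  have lookup_\<rho>: "lookup (\<rho> u) \<xi> = (if \<xi> \<in> R' then scalar_product u (ray_gen \<xi>) else 0)" for u \<xi>
    using finR' by (simp add: \<rho>_def lookup_sum if_distrib[of "\<lambda>x. _ * x"] cong: if_cong)
  have \<rho>_add: "\<rho> (u + v) = \<rho> u + \<rho> v" for u v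
    by (rule poly_mapping_eqI) (simp add: lookup_\<rho> lookup_add scalar_product_linear)
  have \<rho>_0: "\<rho> 0 = 0" by (rule poly_mapping_eqI) (simp add: lookup_\<rho> scalar_product_linear)
  have \<rho>_inj: "u = v" if uv: "u \<in> \<F>" "v \<in> \<F>" and eq: "\<rho> u = \<rho> v" for u v
  proof -
    have "scalar_product (u - v) (ray_gen \<xi>) = 0" if \<xi>: "\<xi> \<in> rays \<tau>" for \<xi>
    proof (cases "\<xi> \<in> Z")
      case True
      then show ?thesis using uv by (simp add: Z_def scalar_product_linear)
    next
      case False
      then have "\<xi> \<in> R'" using \<xi> by (simp add: R'_def)
      then show ?thesis using arg_cong[OF eq, of "\<lambda>f. lookup f \<xi>"]
        by (simp add: lookup_\<rho> scalar_product_linear)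
    qed
    then have "u - v = 0" by (rule pairing_eq_0D)
    then show ?thesis by simp
  qed
  define H where "H = {\<rho> u - \<rho> v | u v. u \<in> \<F> \<and> v \<in> \<F>}"
  \<comment> \<open>Quotients of values extend \<open>e\<close> from the semigroup to the group of
    differences; injectivity of \<rho> on \<F> makes this independent of the choice.\<close>
  define f where "f y = (case (SOME (u, v). u \<in> \<F> \<and> v \<in> \<F> \<and> y = \<rho> u - \<rho> v) of (u, v) \<Rightarrow> e u / e v)" for y
  have f: "f (\<rho> u - \<rho> v) = e u / e v" if uv: "u \<in> \<F>" "v \<in> \<F>" for u v
  proof -
    define y where "y = \<rho> u - \<rho> v"
    define uv' where "uv' = (SOME (u, v). u \<in> \<F> \<and> v \<in> \<F> \<and> y = \<rho> u - \<rho> v)"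
    define u' where "u' = fst uv'"
    define v' where "v' = snd uv'"
    have "case uv' of (u, v) \<Rightarrow> u \<in> \<F> \<and> v \<in> \<F> \<and> y = \<rho> u - \<rho> v"
      unfolding uv'_def by (rule someI[of _ "(u, v)"]) (simp add: uv y_def)
    then have u'v': "u' \<in> \<F>" "v' \<in> \<F>" "\<rho> u - \<rho> v = \<rho> u' - \<rho> v'"
      by (simp_all add: u'_def v'_def case_prod_unfold y_def)
    have "\<rho> (u + v') = \<rho> (u' + v)" unfolding \<rho>_add using u'v'(3) by (simp add: algebra_simps)
    then have "u + v' = u' + v" by (intro \<rho>_inj F_add uv u'v')
    then have "e u * e v' = e u' * e v" using e_add[OF F_dual F_dual] uv u'v' by metis
    moreover have "e v \<noteq> 0" "e v' \<noteq> 0" using uv u'v' by (auto simp: \<F>_def)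
    ultimately have "e u' / e v' = e u / e v" by (simp add: field_simps)
    then show ?thesis
      unfolding f_def y_def[symmetric] uv'_def[symmetric] by (simp add: u'_def v'_def case_prod_unfold)
  qed
  have "is_character H f"
    unfolding is_character_def
  proof (intro conjI ballI)
    show "0 \<in> H" unfolding H_def using F0 by (intro CollectI exI[of _ 0]) simp
    fix a assume "a \<in> H"
    then obtain u v where a: "a = \<rho> u - \<rho> v" "u \<in> \<F>" "v \<in> \<F>" unfolding H_def by blast
    show "f a \<noteq> 0" using a by (simp add: f) (simp add: \<F>_def)
    fix b assume "b \<in> H"
    then obtain u' v' where b: "b = \<rho> u' - \<rho> v'" "u' \<in> \<F>" "v' \<in> \<F>" unfolding H_def by blast
    have "a - b = \<rho> (u + v') - \<rho> (v + u')" by (simp add: a b \<rho>_add)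
    then show "a - b \<in> H" unfolding H_def using a b F_add by blast
    have "a + b = \<rho> (u + u') - \<rho> (v + v')" by (simp add: a b \<rho>_add)
    then have "f (a + b) = e (u + u') / e (v + v')" using f a b F_add by simp
    also have "\<dots> = f a * f b" using a b by (simp add: f e_add F_dual)
    finally show "f (a + b) = f a * f b" .
  qed
  then obtain H' f' where f': "is_character H' f'" "H \<subseteq> H'" "frag_of ` R' \<subseteq> H'" "\<forall>a\<in>H. f' a = f a"
    using character_extend[of H f "frag_of ` R'"] finR' by blast
  define x where "x \<xi> = (if \<xi> \<in> rays \<tau> then if \<xi> \<in> Z then 0 else f' (frag_of \<xi>) else undefined)" for \<xi>
  have x_space: "x \<in> cox_space \<tau>" by (auto simp: cox_space_def x_def)
  have cox_e: "cox_mon x u = e u" if u: "u \<in> dual_semigroup \<tau>" for u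
  proof (cases "u \<in> \<F>")
    case True
    have "cox_mon x u = (\<Prod>\<xi>\<in>R'. f' (frag_of \<xi>) ^ nat (scalar_product u (ray_gen \<xi>)))"
      unfolding cox_mon_def R'_def
      by (rule prod.mono_neutral_cong_right[OF tau_rays(1)])
        (use True in \<open>auto simp: Z_def x_def\<close>)
    also have "\<dots> = f' (\<rho> u)"
      unfolding \<rho>_def using character_sum[OF f'(1) finR' f'(3), of "\<lambda>\<xi>. scalar_product u (ray_gen \<xi>)"]
        pairing_nonneg[OF u] by (simp add: R'_def)
    also have "\<rho> u = \<rho> u - \<rho> 0" by (simp add: \<rho>_0)
    also have "f' (\<rho> u - \<rho> 0) = f (\<rho> u - \<rho> 0)" using f'(4) True F0 unfolding H_def by blast
    also have "\<dots> = e u" using f[OF True F0] by (simp add: e0)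
    finally show ?thesis .
  next
    case False
    then obtain \<xi> where \<xi>: "\<xi> \<in> Z" "scalar_product u (ray_gen \<xi>) \<noteq> 0" using in_F[OF u] by blast
    have "\<xi> \<in> rays \<tau>" using \<xi>(1) by (simp add: Z_def)
    then have "x \<xi> ^ nat (scalar_product u (ray_gen \<xi>)) = 0"
      using \<xi> pairing_nonneg[OF u, of \<xi>] by (simp add: x_def zero_power)
    then have "cox_mon x u = 0" unfolding cox_mon_def using \<open>\<xi> \<in> rays \<tau>\<close> tau_rays(1) by (intro prod_zero) auto
    then show ?thesis using False u by (simp add: \<F>_def)
  qed
  have quot: "cox_quotient \<tau> x = toric_embedding p"
  proof (rule extensionalityI[of _ "carrier (coord_ring \<tau>)"])
    show "toric_embedding p \<in> extensional (carrier (coord_ring \<tau>))" by (simp add: morphism_of_def)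
    show "cox_quotient \<tau> x \<in> extensional (carrier (coord_ring \<tau>))" by (simp add: cox_quotient_eq)
    fix g assume g: "g \<in> carrier (coord_ring \<tau>)"
    have hg: "toric_comorphism restrict_dual g \<in> carrier (coord_ring \<sigma>)"
      by (rule closed_embedding_maps(1)[OF closed_embedding_restrict_dual g])
    have "toric_embedding p g = lin_sum (\<lambda>u c. c * p (single u 1)) (toric_comorphism restrict_dual g)"
      using toric_variety_expand[OF p hg] g by (simp add: morphism_of_apply)
    also have "\<dots> = lin_sum (\<lambda>u c. c * e u) g"
      unfolding e_def by (rule lin_sum_toric_comorphism) (rule additive_times)
    also have "\<dots> = cox_quotient \<tau> x g"
      using g cox_e by (auto simp: cox_quotient_eq lin_sum_def carrier_coord_ring intro!: sum.cong)
    finally show "cox_quotient \<tau> x g = toric_embedding p g" ..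
  qed
  \<comment> \<open>A nonzero y_j has no variable in \<open>Z\<close>, so a multiple u of
    \<open>u0\<close> dominates the exponents of y_j. Trading y_j for y_i in u keeps the restriction
    to N and hence the value; cancelling gives y_i = y_j.\<close>
  have blocks: "mon x (block i) = mon x (block j)" if nz: "mon x (block j) \<noteq> 0" for i j
  proof -
    have notZ: "\<xi> \<in> R'" if "\<xi> \<in> rays \<tau>" "height j \<xi> > 0" for \<xi>
    proof (rule ccontr)
      assume "\<xi> \<notin> R'"
      then have "x \<xi> ^ height j \<xi> = 0" using that by (simp add: R'_def x_def zero_power)
      then show False using nz that(1) tau_rays(1) unfolding mon_block by (metis prod_zero)
    qed
    define n where "n = (\<Sum>\<xi>\<in>rays \<tau>. height j \<xi>)"
    define u where "u = int n *s u0"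
    define u' where "u' = u + (lev_dual i - lev_dual j)"
    have uF: "u \<in> \<F>" unfolding u_def by (rule F_scale[OF u0(1)])
    have u'_pair: "scalar_product u' (ray_gen \<xi>) = scalar_product u (ray_gen \<xi>) + int (height i \<xi>) - int (height j \<xi>)"
      if "\<xi> \<in> rays \<tau>" for \<xi>
      by (simp add: u'_def scalar_product_linear pairing_lev_dual[OF that])
    have ge: "int (height j \<xi>) \<le> scalar_product u (ray_gen \<xi>)" if \<xi>: "\<xi> \<in> rays \<tau>" for \<xi>
    proof (cases "height j \<xi> > 0")
      case True
      then have "1 \<le> scalar_product u0 (ray_gen \<xi>)" using u0(2) notZ[OF \<xi>] by (simp add: R'_def)
      then have "int n * 1 \<le> int n * scalar_product u0 (ray_gen \<xi>)" by (intro mult_left_mono) auto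
      moreover have "height j \<xi> \<le> n" unfolding n_def using \<xi> tau_rays(1) by (intro member_le_sum) auto
      ultimately show ?thesis by (simp add: u_def scalar_product_linear)
    next
      case False
      then show ?thesis using pairing_nonneg[OF F_dual[OF uF] \<xi>] by simp
    qed
    have u'_dual: "u' \<in> dual_semigroup \<tau>"
      unfolding tau_rays(3) using ge u'_pair by force
    have "restrict_dual u' = restrict_dual u"
      using restrict_lev_dual[of i] restrict_lev_dual[of j] by (simp add: u'_def restrict_dual_def vec_eq_iff)
    then have eu: "cox_mon x u' = cox_mon x u"
      using cox_e[OF u'_dual] cox_e[OF F_dual[OF uF]] e_restrict by metis
    have "cox_mon x u' * mon x (block j) = cox_mon x u * mon x (block i)"
      unfolding cox_mon_def mon_block prod.distrib[symmetric] power_add[symmetric]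
    proof (intro prod.cong refl arg_cong2[where f = "(^)"])
      fix \<xi> assume \<xi>: "\<xi> \<in> rays \<tau>"
      show "nat (scalar_product u' (ray_gen \<xi>)) + height j \<xi> = nat (scalar_product u (ray_gen \<xi>)) + height i \<xi>"
        using u'_pair[OF \<xi>] ge[OF \<xi>] by simp
    qed
    moreover have "cox_mon x u \<noteq> 0" using cox_e[OF F_dual[OF uF]] uF by (simp add: \<F>_def)
    ultimately show ?thesis using eu by simp
  qed
  \<comment> \<open>One nonzero block makes all blocks equal; otherwise all are 0.\<close>
  have "mon x (block j) = mon x (block None)" for j
    using blocks[of j None] blocks[of None j] by (cases "mon x (block None) = 0") auto
  then have "\<forall>f\<in>I\<^sub>\<tau>. cox_eval x f = 0" using vanishes_on_ideal_iff by blast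
  moreover have "toric_embedding p \<in> toric_variety \<tau>"
    by (rule morphism_of_in_toric_variety[OF closed_embedding_restrict_dual p])
  ultimately show ?thesis unfolding vanishing_locus_def using x_space quot by blast
qed

lemma vanishing_locus_tau: "toric_embedding ` toric_variety \<sigma> = vanishing_locus \<tau> I\<^sub>\<tau>"
  using vanishing_locus_subset embed_in_vanishing_locus by blast

text \<open>The image has dimension n as it is homeomorphic to X_\<sigma>, and the ambient variety n
  + k because the big cone is again rational and pointed; the difference is the number of
  equations.\<close>

theorem complete_intersection_tau:
  assumes ks: "distinct ks" "set ks = UNIV"
  shows "complete_intersection \<tau> (toric_embedding ` toric_variety \<sigma>) (map (cox_binomial \<tau>) ks)"
proof -
  have map_eq: "map (cox_binomial \<tau>) ks = map bin (map Some ks)" by (simp add: cox_binomial_eq)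
  have set_eq: "set (map bin (map Some ks)) = bin ` range Some" using ks(2) by (simp add: image_image)
  have "regular_sequence A (map bin (map Some ks))"
    using ks(1) by (intro regular_sequence_bin) (auto simp: distinct_map)
  moreover have "radical_ideal I\<^sub>\<tau> A" by (rule radical_genideal) auto
  moreover have "krull_dim (subtopology (zariski \<tau>) (toric_embedding ` toric_variety \<sigma>)) = enat (CARD('n))"
    using krull_dim_homeomorphic_space[OF closed_embedding_homeomorphic[OF closed_embedding_restrict_dual]]
      krull_dim_strongly_convex[OF cone pointed] by simp
  moreover have "krull_dim (zariski \<tau>) = enat (CARD('n) + length (map bin (map Some ks)))"
    using krull_dim_strongly_convex[OF rational_tau pointed_tau] distinct_card[OF ks(1)] ks(2) by simp
  ultimately show ?thesis
    unfolding complete_intersection_def Let_def map_eq set_eq cox_ring_eq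
    using cox_homogeneous_bin homogeneous_ideal_tau vanishing_locus_tau by blast
qed

end

theorem theorem2p9:
  fixes \<sigma> Q :: "(real ^ 'n) set"
    and P :: "'k::{finite, linorder} option \<Rightarrow> (real ^ 'n) set"
  assumes "rational_polyhedral_cone \<sigma>" and "strongly_convex \<sigma>"
    and "dim \<sigma> = DIM(real ^ 'n)"
    and "rational_polyhedron Q" and "Q \<noteq> {}" and "Q \<subseteq> \<sigma>" and "0 \<notin> Q"
    and "\<And>j. polyhedron (P j)"
    and "\<And>j. recession_cone (P j) = recession_cone Q"
    and "Q = (\<Sum>j\<in>UNIV. P j)"
    and "\<And>q p. q extreme_point_of Q \<Longrightarrow> (\<And>j. p j extreme_point_of P j) \<Longrightarrow>
           q = (\<Sum>j\<in>UNIV. p j) \<Longrightarrow> card {j. p j \<notin> lattice_points} \<le> 1"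
  shows "closed_embedding \<sigma> (cayley_cone \<sigma> P) (toric_comorphism restrict_dual) \<and>
    complete_intersection (cayley_cone \<sigma> P)
      (morphism_of (cayley_cone \<sigma> P) (toric_comorphism restrict_dual) ` toric_variety \<sigma>)
      (map (cox_binomial (cayley_cone \<sigma> P)) (sorted_list_of_set UNIV))"
proof -
  interpret minkowski_decomposition \<sigma> Q P
    by unfold_locales (fact assms)+
  show ?thesis
    by (intro conjI closed_embedding_restrict_dual complete_intersection_tau) simp_all
qed

end
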